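(* Let $f\colon \mathbb{H}^n\to \mathbb{R}$ be a Lipschitz function with $\mathrm{Lip}_{\mathbb{H}}(f) \leq 1/2$. Suppose $(x_{\ast}, E_{\ast})\in D^{f}$. Let $M$ denote the set of pairs $(x,E)\in D^{f}$ such that $Ef(x)\geq E_{\ast}f(x_{\ast})$ and \[ |(f(x + tE_{\ast}(x))-f(x)) - (f(x_{\ast} + tE_{\ast}(x_{\ast}))-f(x_{\ast}))| \leq 6|t| \big( (Ef(x)-E_{\ast}f(x_{\ast}))\mathrm{Lip}_{\mathbb{H}}(f)\big)^{\frac{1}{4}}\] for every $t\in (-1,1)$. If \[\lim_{\delta \downarrow 0} \sup \{Ef(x)\colon (x,E)\in M \mbox{ and }d(x,x_{\ast})\leq \delta\}\leq E_{\ast}f(x_{\ast}),\] then $f$ is Pansu differentiable at $x_{\ast}$ with Pansu derivative \[L(x)=E_{\ast}f(x_{\ast})\langle x , E_{\ast}(0) \rangle=E_{\ast}f(x_{\ast})\langle p(x) , p(E_{\ast}) \rangle.\]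
   Context: Fix an integer $n\geq 1$. The Heisenberg group $\mathbb{H}^n$ is $\mathbb{R}^{2n+1}$, with points written $(a,b,c)$, $a,b\in\mathbb{R}^n$, $c\in\mathbb{R}$, equipped with the group law $(a,b,c)(a',b',c')=(a+a',b+b',c+c'-2(\langle a,b'\rangle-\langle b,a'\rangle))$. Dilations are $\delta_r(a,b,c)=(ra,rb,r^2c)$ for $r>0$; $p\colon\mathbb{H}^n\to\mathbb{R}^{2n}$ is the projection onto the first $2n$ coordinates. For $1\le i\le n$ define vector fields $X_i(a,b,c)=e_i+2b_ie_{2n+1}$, $Y_i(a,b,c)=e_{n+i}-2a_ie_{2n+1}$, where $e_1,\dots,e_{2n+1}$ is the standard basis. $V=\mathrm{Span}\{X_i,Y_i:1\le i\le n\}$ and $\omega$ is the inner product norm on $V$ making $\{X_i,Y_i\}$ orthonormal. For $E\in V$, $p(E):=p(E(x))\in\mathbb{R}^{2n}$ does not depend on $x$. $\langle\cdot,\cdot\rangle$ and $|\cdot|$ are the Euclidean inner product and norm. An absolutely continuous curve $\gamma\colon I\to\mathbb{H}^n$ ($I\subset\mathbb{R}$ an interval) is horizontal if there is $h\colon I\to\mathbb{R}^{2n}$ with $\gamma'(t)=\sum_{i=1}^n(h_i(t)X_i(\gamma(t))+h_{n+i}(t)Y_i(\gamma(t)))$ for a.e. $t\in I$; its horizontal length is $L_{\mathbb{H}}(\gamma)=\int_I|h|$. The Carnot-Carathéodory distance is $d(x,y)=\inf\{L_{\mathbb{H}}(\gamma):\gamma \text{ a horizontal curve joining } x \text{ to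 } y\}$. "Lipschitz" is with respect to $d$ when the domain or target is $\mathbb{H}^n$, and $\mathrm{Lip}_{\mathbb{H}}$ is the corresponding Lipschitz constant. For $f\colon\mathbb{H}^n\to\mathbb{R}$ Lipschitz and $E\in V$, $Ef(x):=(f\circ\gamma)'(t)$ whenever it exists, where $\gamma$ is any Lipschitz horizontal curve with $\gamma(t)=x$ and $\gamma'(t)=E(x)$ (independent of the choice of $\gamma$; e.g. $Ef(x)=\lim_{t\to0}(f(x+tE(x))-f(x))/t$). $N\subset\mathbb{H}^n$ is a fixed Lebesgue measure zero $G_\delta$ set containing all (entire) straight lines which are also horizontal curves and join pairs of points of $\mathbb{Q}^{2n+1}$. For Lipschitz $f\colon\mathbb{H}^n\to\mathbb{R}$, $D^f:=\{(x,E)\in N\times V:\omega(E)=1,\ Ef(x)\text{ exists}\}$. A function $L\colon\mathbb{H}^n\to\mathbb{R}$ is $\mathbb{H}$-linear if $L(xy)=L(x)+L(y)$ and $L(\delta_r(x))=rL(x)$ for all $x,y\in\mathbb{H}^n$, $r>0$. A function $f\colon\mathbb{H}^n\to\mathbb{R}$ is Pansu differentiable at $x$ with Pansu derivative $L$ if $L$ is $\mathbb{H}$-linear and $\lim_{y\to x}|f(y)-f(x)-L(x^{-1}y)|/d(x,y)=0$. *)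

theory Defs
  imports "HOL-Analysis.Analysis"
begin

text \<open>
  The points \<open>(a, b, c)\<close> of \<open>\<real>\<^sup>2\<^sup>n\<^sup>+\<^sup>1\<close> are nested pairs, where \<open>n = CARD('n) \<ge> 1\<close>, and
  \<open>\<real>\<^sup>2\<^sup>n\<close> is \<open>(real^'n) \<times> (real^'n)\<close>. The product instances of \<open>+\<close>, \<open>*\<^sub>R\<close>, \<open>\<bullet>\<close>, \<open>norm\<close>,
  the topology and Lebesgue measure are the Euclidean ones; the group law and the
  Carnot-Caratheodory distance are separate constants.
\<close>

type_synonym 'n heis = "(real^'n) \<times> (real^'n) \<times> real"

type_synonym 'n hvec = "(real^'n) \<times> (real^'n)"

fun hmult :: "'n::finite heis \<Rightarrow> 'n heis \<Rightarrow> 'n heis" where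
  "hmult (a, b, c) (a', b', c') = (a + a', b + b', c + c' - 2 * (a \<bullet> b' - b \<bullet> a'))"

fun hinv :: "'n::finite heis \<Rightarrow> 'n heis" where
  "hinv (a, b, c) = (- a, - b, - c)"

fun hdil :: "real \<Rightarrow> 'n::finite heis \<Rightarrow> 'n heis" where
  "hdil r (a, b, c) = (r *\<^sub>R a, r *\<^sub>R b, r\<^sup>2 * c)"

fun hproj :: "'n::finite heis \<Rightarrow> 'n hvec" where
  "hproj (a, b, c) = (a, b)"

fun X_field :: "'n::finite \<Rightarrow> 'n heis \<Rightarrow> 'n heis" where
  "X_field i (a, b, c) = (axis i 1, 0, 2 * b $ i)"

fun Y_field :: "'n::finite \<Rightarrow> 'n heis \<Rightarrow> 'n heis" where
  "Y_field i (a, b, c) = (0, axis i 1, - 2 * a $ i)"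

definition hfield :: "'n::finite hvec \<Rightarrow> 'n heis \<Rightarrow> 'n heis" where
  "hfield h = (\<lambda>x. \<Sum>i\<in>UNIV. (fst h $ i) *\<^sub>R X_field i x + (snd h $ i) *\<^sub>R Y_field i x)"

definition horizontal_fields :: "('n::finite heis \<Rightarrow> 'n heis) set" where
  "horizontal_fields = range hfield"

text \<open>
  The coefficients of \<open>E \<in> horizontal_fields\<close> are unique, and the norm of a pair of Euclidean vectors is the
  square root of the sum of the squares of all their components, so this is the inner product
  norm for which the fields \<open>X_field i\<close>, \<open>Y_field i\<close> are orthonormal.
\<close>

definition omega :: "('n::finite heis \<Rightarrow> 'n heis) \<Rightarrow> real" where
  "omega E = (THE r. \<exists>h. E = hfield h \<and> r = norm h)"

text \<open>For \<open>E \<in> horizontal_fields\<close> the base point is irrelevant; the origin is used.\<close>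

definition hproj_field :: "('n::finite heis \<Rightarrow> 'n heis) \<Rightarrow> 'n hvec" where
  "hproj_field E = hproj (E 0)"

definition abs_cont_curve_on :: "real set \<Rightarrow> (real \<Rightarrow> 'a::real_normed_vector) \<Rightarrow> bool" where
  "abs_cont_curve_on I \<gamma> \<longleftrightarrow>
     (\<forall>\<epsilon>>0. \<exists>\<delta>>0. \<forall>P :: (real \<times> real) set.
        finite P \<longrightarrow>
        (\<forall>(u, v)\<in>P. u \<le> v \<and> {u..v} \<subseteq> I) \<longrightarrow>
        disjoint_family_on (\<lambda>(u, v). {u<..<v}) P \<longrightarrow>
        (\<Sum>(u, v)\<in>P. v - u) < \<delta> \<longrightarrow>
        (\<Sum>(u, v)\<in>P. norm (\<gamma> v - \<gamma> u)) < \<epsilon>)"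

definition horizontal_coeffs ::
    "real set \<Rightarrow> (real \<Rightarrow> 'n::finite heis) \<Rightarrow> (real \<Rightarrow> 'n hvec) \<Rightarrow> bool" where
  "horizontal_coeffs I \<gamma> h \<longleftrightarrow>
     (AE t in lebesgue. t \<in> I \<longrightarrow>
        (\<gamma> has_vector_derivative hfield (h t) (\<gamma> t)) (at t within I))"

definition horizontal_curve_on :: "real set \<Rightarrow> (real \<Rightarrow> 'n::finite heis) \<Rightarrow> bool" where
  "horizontal_curve_on I \<gamma> \<longleftrightarrow>
     is_interval I \<and> abs_cont_curve_on I \<gamma> \<and> (\<exists>h. horizontal_coeffs I \<gamma> h)"

text \<open>
  The coefficients \<open>h\<close> are determined by \<open>\<gamma>\<close> almost everywhere on \<open>I\<close>, so the choice does not
  affect the integral.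
\<close>

definition hlength :: "real set \<Rightarrow> (real \<Rightarrow> 'n::finite heis) \<Rightarrow> real" where
  "hlength I \<gamma> = (LINT t:I|lebesgue. norm ((SOME h. horizontal_coeffs I \<gamma> h) t))"

definition cc_dist :: "'n::finite heis \<Rightarrow> 'n heis \<Rightarrow> real" where
  "cc_dist x y =
     Inf {hlength {a..b} \<gamma> | a b \<gamma>.
            a \<le> b \<and> horizontal_curve_on {a..b} \<gamma> \<and> \<gamma> a = x \<and> \<gamma> b = y}"

definition hLipschitz_bounds :: "('n::finite heis \<Rightarrow> real) \<Rightarrow> real set" where
  "hLipschitz_bounds f = {K. 0 \<le> K \<and> (\<forall>x y. \<bar>f x - f y\<bar> \<le> K * cc_dist x y)}"

definition hLipschitz :: "('n::finite heis \<Rightarrow> real) \<Rightarrow> bool" where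
  "hLipschitz f \<longleftrightarrow> hLipschitz_bounds f \<noteq> {}"

definition Lip_H :: "('n::finite heis \<Rightarrow> real) \<Rightarrow> real" where
  "Lip_H f = Inf (hLipschitz_bounds f)"

definition hLipschitz_curve_on :: "real set \<Rightarrow> (real \<Rightarrow> 'n::finite heis) \<Rightarrow> bool" where
  "hLipschitz_curve_on I \<gamma> \<longleftrightarrow>
     (\<exists>K\<ge>0. \<forall>s\<in>I. \<forall>t\<in>I. cc_dist (\<gamma> s) (\<gamma> t) \<le> K * \<bar>s - t\<bar>)"

text \<open>
  For Lipschitz \<open>f\<close> the existence and value of \<open>(f \<circ> \<gamma>)'(t)\<close> do not depend on the admissible
  curve \<open>\<gamma>\<close>, so \<open>\<gamma>\<close> ranges over all of them. There always is one:
  \<open>s \<mapsto> x + s *\<^sub>R E x\<close> on all of \<open>\<real>\<close>, at \<open>s = 0\<close>.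
  The parameter \<open>t\<close> is interior to \<open>I\<close>, so all derivatives are two-sided.
\<close>

definition has_hderiv ::
    "('n::finite heis \<Rightarrow> real) \<Rightarrow> ('n heis \<Rightarrow> 'n heis) \<Rightarrow> 'n heis \<Rightarrow> real \<Rightarrow> bool" where
  "has_hderiv f E x D \<longleftrightarrow>
     (\<forall>I \<gamma> t. horizontal_curve_on I \<gamma> \<longrightarrow> hLipschitz_curve_on I \<gamma> \<longrightarrow> t \<in> interior I \<longrightarrow>
        \<gamma> t = x \<longrightarrow> (\<gamma> has_vector_derivative E x) (at t) \<longrightarrow>
        ((f \<circ> \<gamma>) has_real_derivative D) (at t))"

definition hderiv ::
    "('n::finite heis \<Rightarrow> real) \<Rightarrow> ('n heis \<Rightarrow> 'n heis) \<Rightarrow> 'n heis \<Rightarrow> real" where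
  "hderiv f E x = (THE D. has_hderiv f E x D)"

definition rational_points :: "'n::finite heis set" where
  "rational_points = {(a, b, c). (\<forall>i. a $ i \<in> \<rat>) \<and> (\<forall>i. b $ i \<in> \<rat>) \<and> c \<in> \<rat>}"

definition contains_rational_horizontal_lines :: "'n::finite heis set \<Rightarrow> bool" where
  "contains_rational_horizontal_lines N \<longleftrightarrow>
     (\<forall>p\<in>rational_points. \<forall>q\<in>rational_points. p \<noteq> q \<longrightarrow>
        horizontal_curve_on UNIV (\<lambda>s. p + s *\<^sub>R (q - p)) \<longrightarrow>
        range (\<lambda>s. p + s *\<^sub>R (q - p)) \<subseteq> N)"

definition D_set ::
    "'n::finite heis set \<Rightarrow> ('n heis \<Rightarrow> real) \<Rightarrow> ('n heis \<times> ('n heis \<Rightarrow> 'n heis)) set" where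
  "D_set N f = {(x, E). x \<in> N \<and> E \<in> horizontal_fields \<and> omega E = 1 \<and> (\<exists>D. has_hderiv f E x D)}"

definition M_set ::
    "'n::finite heis set \<Rightarrow> ('n heis \<Rightarrow> real) \<Rightarrow> 'n heis \<Rightarrow> ('n heis \<Rightarrow> 'n heis) \<Rightarrow>
     ('n heis \<times> ('n heis \<Rightarrow> 'n heis)) set" where
  "M_set N f x\<^sub>0 E\<^sub>0 =
     {(x, E) \<in> D_set N f.
        hderiv f E x \<ge> hderiv f E\<^sub>0 x\<^sub>0 \<and>
        (\<forall>t\<in>{-1<..<1}.
           \<bar>(f (x + t *\<^sub>R E\<^sub>0 x) - f x) - (f (x\<^sub>0 + t *\<^sub>R E\<^sub>0 x\<^sub>0) - f x\<^sub>0)\<bar>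
             \<le> 6 * \<bar>t\<bar> * ((hderiv f E x - hderiv f E\<^sub>0 x\<^sub>0) * Lip_H f) powr (1/4))}"

definition H_linear :: "('n::finite heis \<Rightarrow> real) \<Rightarrow> bool" where
  "H_linear L \<longleftrightarrow>
     (\<forall>x y. L (hmult x y) = L x + L y) \<and> (\<forall>r>0. \<forall>x. L (hdil r x) = r * L x)"

text \<open>
  The Carnot-Caratheodory distance induces the Euclidean topology, so the limit \<open>y \<rightarrow> x\<close> is
  taken in the latter.
\<close>

definition has_pansu_derivative ::
    "('n::finite heis \<Rightarrow> real) \<Rightarrow> ('n heis \<Rightarrow> real) \<Rightarrow> 'n heis \<Rightarrow> bool" where
  "has_pansu_derivative f L x \<longleftrightarrow>
     H_linear L \<and>
     ((\<lambda>y. \<bar>f y - f x - L (hmult (hinv x) y)\<bar> / cc_dist x y) \<longlongrightarrow> 0) (at x)"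

end

theory Submission
  imports Defs
begin

text \<open>
  Write \<open>x0\<close>, \<open>E0\<close>, \<open>D0\<close> for the given point, direction and directional derivative, and \<open>\<lambda>\<close> for
  the Lipschitz constant. Suppose that the first-order expansion with slope \<open>D0\<close> in direction \<open>E0\<close>
  fails by \<open>\<epsilon> \<lambda> r\<close> at points \<open>y\<close> at distance about \<open>r\<close> from \<open>x0\<close>, with \<open>r\<close> arbitrarily small. The
  contradiction comes from a pair \<open>(x, E)\<close> that belongs to the set \<open>M\<close>, has \<open>x\<close> close to \<open>x0\<close>, and has
  a directional derivative exceeding \<open>D0\<close> by an amount that depends on \<open>\<epsilon>\<close> and \<open>\<lambda>\<close> but not on \<open>r\<close>.

  To find it, replace the part \<open>|t| \<le> s\<close>, \<open>s = K r\<close>, of the line \<open>t \<mapsto> x0 + t E0(x0)\<close> by a broken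
  horizontal line \<open>g\<close> through \<open>y\<close>. A detour of relative height \<open>1/K\<close> has to make up a vertical
  displacement of order \<open>s r\<close>, and two segments whose velocities differ from \<open>E0\<close> by \<open>\<eta> \<sim> 1/K\<close>
  enclose an area of order \<open>\<eta> s\<^sup>2\<close>, which is just enough (\<open>rational_two_segment_join\<close>,
  \<open>rational_detour\<close>). The corrections are orthogonal to \<open>E0\<close>, so the speed of \<open>g\<close> is
  \<open>1 + O(\<eta>\<^sup>2)\<close>. Along \<open>g\<close> the function \<open>f\<close> differs from the linear one by \<open>\<epsilon> \<lambda> r \<sim> \<epsilon> \<lambda> \<eta> s\<close>
  in the middle and by almost nothing at the ends, so its slope must exceed \<open>D0\<close> by
  \<open>\<theta> \<sim> \<epsilon> \<lambda> \<eta>\<close> somewhere; normalizing the speed costs only \<open>O(\<lambda> \<eta>\<^sup>2)\<close>, which is negligible once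
  \<open>\<eta>\<close> is small compared with \<open>\<epsilon>\<close>.

  The parameter \<open>\<tau>\<close> must moreover be such that all increments of \<open>f \<circ> g\<close> from \<open>\<tau>\<close> are controlled by the
  slope excess \<open>D\<close> at \<open>\<tau>\<close>. If at almost every point the greatest difference quotient \<open>M\<close> violated
  \<open>M\<^sup>4 \<le> 80 (3 \<lambda>)\<^sup>3 D\<close>, a weak-type maximal inequality would bound the positive variation of
  \<open>f \<circ> g\<close> by a fraction of itself (\<open>lipschitz_point_of_increase\<close>). Since \<open>\<lambda> \<le> 1/2\<close>, this gives
  \<open>M \<le> 5 (\<lambda> D)\<^sup>1\<^sup>/\<^sup>4\<close> up to the normalization. Passing from \<open>g\<close> to the line through \<open>x = g \<tau>\<close> in
  direction \<open>E0\<close> costs \<open>O(\<lambda> \<surd>\<eta> |t|)\<close>, because horizontal curves whose velocities differ by \<open>\<eta>\<close>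
  separate at most like \<open>\<surd>\<eta> |t|\<close> (\<open>broken_line_angle\<close>); the fourth root of \<open>\<lambda> \<theta>\<close> is larger. The
  constant \<open>6\<close> leaves room for both errors, so \<open>(x, E) \<in> M\<close>.

  The inner segments of \<open>g\<close> are taken through rational points, so that \<open>x\<close> lies in \<open>N\<close>. The metric
  enters only through the two-sided comparison of the Carnot-Caratheodory distance with the
  horizontal displacement and the square root of the vertical one (\<open>cc_dist_upper\<close>,
  \<open>hproj_le_cc_dist\<close>, \<open>vdisp_le_cc_dist\<close>).
\<close>

section \<open>Slopes of Lipschitz functions of one variable\<close>

text \<open>
  The function \<open>G x = k x + (L + 1) x\<close> is a bi-Lipschitz homeomorphism of the line. The measure
  \<open>A \<mapsto> |G(A)|\<close> is absolutely continuous because Lipschitz maps preserve null sets; its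
  Radon-Nikodym density is the derivative of \<open>G\<close>, and the differentiation theorem for indefinite
  integrals shows that it is a pointwise derivative almost everywhere.
\<close>

lemma lipschitz_indefinite_integral:
  fixes k :: "real \<Rightarrow> real"
  assumes lip: "\<And>x y. \<bar>k x - k y\<bar> \<le> L * \<bar>x - y\<bar>"
  shows "\<exists>w N. negligible N \<and> (\<forall>x. x \<notin> N \<longrightarrow> (k has_real_derivative w x) (at x)) \<and>
    (\<forall>a b. a \<le> b \<longrightarrow> (w has_integral k b - k a) {a..b}) \<and>
    (\<forall>a b. w absolutely_integrable_on {a..b})"
proof -
  have L0: "L \<ge> 0" using lip[of 1 0] abs_ge_zero[of "k 1 - k 0"] by simp
  define G where "G = (\<lambda>x. k x + (L + 1) * x)"
  have G_lower: "y - x \<le> G y - G x" if "x \<le> y" for x y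
  proof -
    have "- (L * (y - x)) \<le> k y - k x" using lip[of y x] that by (simp add: abs_le_iff)
    then show ?thesis unfolding G_def by (simp add: algebra_simps)
  qed
  have G_upper: "\<bar>G y - G x\<bar> \<le> (2 * L + 1) * \<bar>y - x\<bar>" for x y
  proof -
    have "\<bar>G y - G x\<bar> = \<bar>(k y - k x) + (L + 1) * (y - x)\<bar>" by (simp add: G_def algebra_simps)
    also have "\<dots> \<le> \<bar>k y - k x\<bar> + (L + 1) * \<bar>y - x\<bar>"
      using L0 abs_triangle_ineq[of "k y - k x" "(L + 1) * (y - x)"] by (simp add: abs_mult)
    also have "\<dots> \<le> L * \<bar>y - x\<bar> + (L + 1) * \<bar>y - x\<bar>" using lip[of y x] by linarith
    also have "\<dots> = (2 * L + 1) * \<bar>y - x\<bar>" by (simp only: distrib_right[symmetric]) simp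
    finally show ?thesis .
  qed
  have inj: "inj G"
  proof (rule injI)
    fix x y assume "G x = G y"
    then show "x = y" using G_lower[of x y] G_lower[of y x] by linarith
  qed
  have cont: "continuous_on UNIV G"
    by (rule lipschitz_on_continuous_on[of "2*L+1"], rule lipschitz_onI)
      (use G_upper L0 in \<open>auto simp: dist_real_def abs_minus_commute\<close>)
  have surj: "surj G"
  proof (unfold surj_def, intro allI)
    fix y
    define c where "c = \<bar>y - G 0\<bar>"
    have "G (-c) \<le> y" "y \<le> G c" using G_lower[of 0 c] G_lower[of "-c" 0] by (auto simp: c_def abs_if)
    moreover have "- c \<le> c" by (simp add: c_def)
    moreover have "continuous_on {-c..c} G" using cont continuous_on_subset by blast
    ultimately show "\<exists>x. y = G x" using IVT'[of G "-c" y c] by blast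
  qed
  define H where "H = inv G"
  have GH: "G (H y) = y" for y using surj by (simp add: H_def surj_f_inv_f)
  have HG: "H (G x) = x" for x using inj by (simp add: H_def)
  have H_lip: "\<bar>H y - H x\<bar> \<le> \<bar>y - x\<bar>" for x y
  proof (cases "H x \<le> H y")
    case True then show ?thesis using G_lower[OF True] by (simp add: GH)
  next
    case False then show ?thesis using G_lower[of "H y" "H x"] by (simp add: GH)
  qed
  have Hcont: "continuous_on UNIV H"
    by (rule lipschitz_on_continuous_on[of 1], rule lipschitz_onI)
      (use H_lip in \<open>auto simp: dist_real_def abs_minus_commute\<close>)
  then have Hm: "H \<in> measurable lborel borel" by (simp add: borel_measurable_continuous_onI)
  define \<mu> where "\<mu> = distr lborel borel H"
  have vimage: "H -` A = G ` A" for A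
  proof (intro equalityI subsetI)
    fix y assume "y \<in> H -` A"
    then show "y \<in> G ` A" using GH[of y] by (metis imageI vimageE)
  next
    fix y assume "y \<in> G ` A"
    then show "y \<in> H -` A" using HG by auto
  qed
  have sets_mu: "sets \<mu> = sets lborel" by (simp add: \<mu>_def)
  have em: "emeasure \<mu> A = emeasure lborel (G ` A)" if "A \<in> sets borel" for A
    unfolding \<mu>_def using emeasure_distr[OF Hm that] by (simp add: vimage)
  have ac: "absolutely_continuous lborel \<mu>"
    unfolding absolutely_continuous_def
  proof
    fix A :: "real set" assume A: "A \<in> null_sets lborel"
    then have "negligible A" by (simp add: negligible_iff_null_sets null_sets_completionI)
    then have neg: "negligible (G ` A)"
      by (rule negligible_locally_Lipschitz_image[rotated])
        (use G_upper in \<open>auto intro!: exI[of _ UNIV] exI[of _ "2*L+1"]\<close>)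
    have "H -` A \<inter> space lborel \<in> sets lborel" using Hm A by (intro measurable_sets[of H _ borel]) auto
    then have "G ` A \<in> sets lborel" by (simp add: vimage)
    moreover have "emeasure lebesgue (G ` A) = 0" using neg by (simp add: negligible_iff_null_sets null_setsD1 del: emeasure_completion)
    ultimately have "emeasure lborel (G ` A) = 0" by (simp add: main_part_sets)
    then show "A \<in> null_sets \<mu>" using A em sets_mu by (auto simp: null_sets_def)
  qed
  obtain g where g: "g \<in> borel_measurable lborel" "density lborel g = \<mu>"
    using sigma_finite_measure.Radon_Nikodym[OF sigma_finite_lborel ac sets_mu] by auto
  define w where "w = (\<lambda>x. enn2real (g x) - (L + 1))"
  have G_image: "G ` {a..b} = {G a..G b}" if "a \<le> b" for a b
  proof (intro equalityI subsetI)
    fix y assume "y \<in> G ` {a..b}"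
    then show "y \<in> {G a..G b}" using G_lower by fastforce
  next
    fix y assume y: "y \<in> {G a..G b}"
    have "H y \<in> {a..b}"
    proof (rule ccontr)
      assume "H y \<notin> {a..b}"
      then consider "H y < a" | "b < H y" by force
      then show False using G_lower[of "H y" a] G_lower[of b "H y"] y GH[of y] by cases auto
    qed
    then show "y \<in> G ` {a..b}" using GH by (metis imageI)
  qed
  have g_int: "((\<lambda>x. enn2real (g x)) has_integral G b - G a) {a..b}" if "a \<le> b" for a b
  proof -
    have Gab: "G a \<le> G b" using G_lower[OF that] that by linarith
    have "(\<integral>\<^sup>+x. g x * indicator {a..b} x \<partial>lborel) = emeasure \<mu> {a..b}"
      using g by (metis emeasure_density lborel_def sets_lborel atLeastAtMost_borel)
    also have "\<dots> = ennreal (G b - G a)" using em[of "{a..b}"] G_image[OF that] Gab by simp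
    finally have 1: "(\<integral>\<^sup>+x. g x * indicator {a..b} x \<partial>lborel) = ennreal (G b - G a)" .
    have "AE x in lborel. g x * indicator {a..b} x \<noteq> \<infinity>"
      by (rule nn_integral_PInf_AE) (use 1 g in auto)
    then have "(\<integral>\<^sup>+x. ennreal (enn2real (g x) * indicator {a..b} x) \<partial>lborel) = ennreal (G b - G a)"
      unfolding 1[symmetric]
      by (intro nn_integral_cong_AE) (auto elim!: eventually_mono simp: indicator_def less_top)
    then have "((\<lambda>x. enn2real (g x) * indicator {a..b} x) has_integral G b - G a) UNIV"
      using g Gab by (intro nn_integral_has_integral) auto
    then have "((\<lambda>x. if x \<in> {a..b} then enn2real (g x) else 0) has_integral G b - G a) UNIV"
      by (rule has_integral_eq[rotated]) (auto simp: indicator_def)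
    then show ?thesis by (simp only: has_integral_restrict_UNIV)
  qed
  have w_int: "(w has_integral k b - k a) {a..b}" if "a \<le> b" for a b
  proof -
    have "((\<lambda>x. enn2real (g x) - (L + 1)) has_integral (G b - G a) - (L + 1) * (b - a)) {a..b}"
      using has_integral_const_real[of "L+1" a b] that
      by (intro has_integral_diff g_int) (auto simp: mult.commute)
    then show ?thesis by (simp add: w_def G_def algebra_simps)
  qed
  have wabs: "w absolutely_integrable_on {a..b}" for a b
  proof (cases "a \<le> b")
    case True
    have "(\<lambda>x. enn2real (g x)) absolutely_integrable_on {a..b}"
      using g_int[OF True] by (intro nonnegative_absolutely_integrable_1) auto
    moreover have "(\<lambda>x. L + 1) absolutely_integrable_on {a..b}" by (simp add: absolutely_integrable_on_const)
    ultimately show ?thesis unfolding w_def by (rule set_integral_diff)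
  qed simp
  have int_w: "w integrable_on cbox a b" for a b
    using w_int by (cases "a \<le> b") (auto simp: has_integral_iff)
  obtain N1 where N1: "negligible N1" "\<And>x e. \<lbrakk>x \<notin> N1; 0 < e\<rbrakk> \<Longrightarrow>
        \<exists>d>0. \<forall>h. 0 < h \<and> h < d \<longrightarrow> \<bar>integral {x..x+h} w / h - w x\<bar> < e"
    using integrable_ccontinuous_explicit[OF int_w] by (auto simp: divide_inverse_commute)
  have int_w': "(\<lambda>x. w (-x)) integrable_on cbox a b" for a b
    using int_w[of "-b" "-a"] integrable_reflect[where f=w and a="-b" and b="-a"] by simp
  obtain N2 where N2: "negligible N2" "\<And>x e. \<lbrakk>x \<notin> N2; 0 < e\<rbrakk> \<Longrightarrow>
        \<exists>d>0. \<forall>h. 0 < h \<and> h < d \<longrightarrow> \<bar>integral {x..x+h} (\<lambda>x. w (-x)) / h - w (-x)\<bar> < e"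
    using integrable_ccontinuous_explicit[OF int_w'] by (auto simp: divide_inverse_commute)
  have deriv: "(k has_real_derivative w x) (at x)" if x: "x \<notin> N1 \<union> uminus ` N2" for x
    unfolding DERIV_def
  proof (rule LIM_I)
    fix e :: real assume e: "e > 0"
    obtain d1 where d1: "d1 > 0" "\<And>h. 0 < h \<Longrightarrow> h < d1 \<Longrightarrow> \<bar>integral {x..x+h} w / h - w x\<bar> < e"
      using N1(2)[of x e] x e by auto
    have "-x \<notin> N2" using x by force
    then obtain d2 where d2: "d2 > 0" 
      "\<And>h. 0 < h \<Longrightarrow> h < d2 \<Longrightarrow> \<bar>integral {-x..-x+h} (\<lambda>x. w (-x)) / h - w x\<bar> < e"
      using N2(2)[of "-x" e] e by auto
    show "\<exists>d>0. \<forall>h. h \<noteq> 0 \<and> norm (h - 0) < d \<longrightarrow> norm ((k (x + h) - k x) / h - w x) < e"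
    proof (intro exI[of _ "min d1 d2"] conjI allI impI)
      fix h :: real assume h: "h \<noteq> 0 \<and> norm (h - 0) < min d1 d2"
      show "norm ((k (x + h) - k x) / h - w x) < e"
      proof (cases "h > 0")
        case True
        then show ?thesis using d1(2)[of h] h integral_unique[OF w_int[of x "x+h"]] by auto
      next
        case False
        then have "((\<lambda>x. w (-x)) has_integral k x - k (x+h)) {-x..-(x+h)}"
          using w_int[of "x+h" x] by (subst has_integral_reflect_real) auto
        then have "integral {-x..-x+ - h} (\<lambda>x. w (-x)) = k x - k (x+h)" by (simp add: integral_unique)
        then have "integral {-x..-x+ - h} (\<lambda>x. w (-x)) / - h = (k (x+h) - k x) / h"
          by (metis minus_diff_eq minus_divide_divide)
        moreover have "\<bar>integral {-x..-x+ - h} (\<lambda>x. w (-x)) / - h - w x\<bar> < e"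
          by (rule d2(2)) (use h False in auto)
        ultimately show ?thesis by simp
      qed
    qed (use d1 d2 in auto)
  qed
  have "negligible (uminus ` N2)"
  proof (rule negligible_locally_Lipschitz_image[OF _ N2(1)])
    show "\<exists>T B. open T \<and> x \<in> T \<and> (\<forall>y\<in>N2 \<inter> T. norm (- y - - x) \<le> B * norm (y - x))" for x
      by (rule exI[of _ UNIV], rule exI[of _ 1]) (simp add: abs_minus_commute)
  qed simp
  then have "negligible (N1 \<union> uminus ` N2)" using N1(1) by simp
  then show ?thesis using deriv w_int wabs by blast
qed

text \<open>
  A point of \<open>U\<close> starts an interval on which \<open>|w|\<close> has mean at least \<open>\<alpha>\<close>. A disjoint family of the
  symmetric intervals of the same radii carries enough of \<open>|w|\<close>, and its fivefold enlargements
  cover \<open>U\<close>.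
\<close>

lemma maximal_slope_weak_type:
  fixes k w :: "real \<Rightarrow> real"
  assumes int: "\<And>x y. x \<le> y \<Longrightarrow> (w has_integral k y - k x) {x..y}"
    and abs_int: "w absolutely_integrable_on {a..b}"
    and cont: "continuous_on UNIV k"
    and \<alpha>: "\<alpha> > 0"
  defines "U \<equiv> {x\<in>{a..b}. \<exists>y\<in>{a..b}. \<alpha> * \<bar>y - x\<bar> < \<bar>k y - k x\<bar>}"
  shows "U \<in> lmeasurable" and "\<alpha> * measure lebesgue U \<le> 10 * integral {a..b} (\<lambda>x. \<bar>w x\<bar>)"
proof -
  let ?V = "integral {a..b} (\<lambda>x. \<bar>w x\<bar>)"
  have abs_w: "(\<lambda>x. \<bar>w x\<bar>) integrable_on {a..b}"
    using abs_int by (simp add: absolutely_integrable_on_def)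
  have "open (\<Union>y\<in>{a..b}. {x. \<alpha> * \<bar>y - x\<bar> < \<bar>k y - k x\<bar>})"
    by (intro open_UN ballI open_Collect_less continuous_intros cont)
  moreover have "U = {a..b} \<inter> (\<Union>y\<in>{a..b}. {x. \<alpha> * \<bar>y - x\<bar> < \<bar>k y - k x\<bar>})"
    by (auto simp: U_def)
  ultimately show U: "U \<in> lmeasurable"
    by (simp add: lmeasurable_open bounded_set_imp_lmeasurable bounded_Int fmeasurable_Int_fmeasurable)
  have "\<exists>y. \<forall>x\<in>U. y x \<in> {a..b} \<and> \<alpha> * \<bar>y x - x\<bar> < \<bar>k (y x) - k x\<bar>"
    unfolding U_def by (intro bchoice) auto
  then obtain y where y: "\<And>x. x \<in> U \<Longrightarrow> y x \<in> {a..b}"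
      "\<And>x. x \<in> U \<Longrightarrow> \<alpha> * \<bar>y x - x\<bar> < \<bar>k (y x) - k x\<bar>" by blast
  define r where "r = (\<lambda>x. \<bar>y x - x\<bar>)"
  have Uab: "U \<subseteq> {a..b}" by (auto simp: U_def)
  have r: "0 < r x \<and> r x \<le> b - a" if "x \<in> U" for x
    using y[OF that] Uab that by (auto simp: r_def abs_le_iff)
  have ball_integrable: "(\<lambda>z. indicator (cball x \<rho>) z * \<bar>w z\<bar>) integrable_on {a..b}" for x \<rho>
  proof -
    have "(\<lambda>z. \<bar>w z\<bar>) integrable_on {max a (x - \<rho>)..min b (x + \<rho>)}"
      using integrable_subinterval_real[OF abs_w] by auto
    then have "(\<lambda>z. if z \<in> {max a (x - \<rho>)..min b (x + \<rho>)} then \<bar>w z\<bar> else 0) integrable_on {a..b}"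
      by (simp only: integrable_restrict_Int) (simp add: Int_absorb2)
    then show ?thesis
      by (rule integrable_eq) (auto simp: indicator_def dist_real_def)
  qed
  have slope: "\<alpha> * r x \<le> integral {a..b} (\<lambda>z. indicator (cball x (r x)) z * \<bar>w z\<bar>)" if "x \<in> U" for x
  proof -
    let ?l = "min x (y x)" and ?u = "max x (y x)"
    have lu: "?l \<le> ?u" "{?l..?u} \<subseteq> {a..b}" "{?l..?u} \<subseteq> cball x (r x)"
      using y(1)[OF that] Uab that by (auto simp: r_def dist_real_def)
    have iw: "(\<lambda>x. \<bar>w x\<bar>) integrable_on {?l..?u}"
      using integrable_subinterval_real[OF abs_w lu(2)] .
    have "\<alpha> * r x \<le> \<bar>k ?u - k ?l\<bar>" using y(2)[OF that] by (auto simp: r_def min_def max_def)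
    also have "\<dots> = \<bar>integral {?l..?u} w\<bar>" using int[OF lu(1)] by (simp add: integral_unique)
    also have "\<dots> \<le> integral {?l..?u} (\<lambda>x. \<bar>w x\<bar>)"
      using integral_norm_bound_integral[of w "{?l..?u}" "\<lambda>x. \<bar>w x\<bar>"] int[OF lu(1)] iw
      by (auto simp: has_integral_iff)
    also have "\<dots> = integral {a..b} (\<lambda>z. if z \<in> {?l..?u} then \<bar>w z\<bar> else 0)"
      using lu(2) by (simp only: Henstock_Kurzweil_Integration.integral_restrict_Int Int_absorb2)
    also have "\<dots> \<le> integral {a..b} (\<lambda>z. indicator (cball x (r x)) z * \<bar>w z\<bar>)"
    proof (rule integral_le)
      show "(\<lambda>z. if z \<in> {?l..?u} then \<bar>w z\<bar> else 0) integrable_on {a..b}"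
        using iw lu(2) by (simp only: integrable_restrict_Int Int_absorb2)
      show "(\<lambda>z. indicator (cball x (r x)) z * \<bar>w z\<bar>) integrable_on {a..b}"
        by (rule ball_integrable)
    qed (use lu(3) in \<open>auto simp: indicator_def\<close>)
    finally show ?thesis .
  qed
  obtain C where C: "countable C" "C \<subseteq> U"
     "pairwise (\<lambda>i j. disjnt (cball i (r i)) (cball j (r j))) C"
     "\<And>i. i \<in> U \<Longrightarrow> \<exists>j. j \<in> C \<and> \<not> disjnt (cball i (r i)) (cball j (r j)) \<and>
                        cball i (r i) \<subseteq> ball j (5 * r j)"
    by (rule Vitali_covering_lemma_cballs_balls[of U r "b - a" "\<lambda>x. x"]) (use r in auto)
  have "measure lebesgue (\<Union> ((\<lambda>j. ball j (5 * r j)) ` C)) \<le> 10 * ?V / \<alpha>"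
  proof (rule measure_UN_bound)
    fix F assume F: "F \<subseteq> C" "finite F"
    have FU: "F \<subseteq> U" using F(1) C(2) by blast
    have "measure lebesgue (\<Union>j\<in>F. ball j (5 * r j)) \<le> (\<Sum>j\<in>F. measure lebesgue (ball j (5 * r j)))"
      by (rule measure_UNION_le[OF F(2)]) auto
    also have "\<dots> = (\<Sum>j\<in>F. 10 * r j)"
    proof (rule sum.cong)
      fix j assume "j \<in> F"
      then have "0 < r j" using r FU by auto
      then show "measure lebesgue (ball j (5 * r j)) = 10 * r j"
        by (simp add: ball_eq_greaterThanLessThan)
    qed simp
    also have "\<dots> = 10 / \<alpha> * (\<Sum>j\<in>F. \<alpha> * r j)" using \<alpha> by (simp add: sum_distrib_left)
    also have "\<dots> \<le> 10 / \<alpha> * (\<Sum>j\<in>F. integral {a..b} (\<lambda>z. indicator (cball j (r j)) z * \<bar>w z\<bar>))"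
      using \<alpha> slope FU by (intro mult_left_mono sum_mono) auto
    also have "\<dots> = 10 / \<alpha> * integral {a..b} (\<lambda>z. \<Sum>j\<in>F. indicator (cball j (r j)) z * \<bar>w z\<bar>)"
      using F(2) FU ball_integrable by (subst integral_sum) auto
    also have "\<dots> \<le> 10 / \<alpha> * ?V"
    proof (intro mult_left_mono integral_le)
      fix z
      have "(\<Sum>j\<in>F. indicator (cball j (r j)) z) \<le> (1::real)"
      proof (cases "\<exists>j\<in>F. z \<in> cball j (r j)")
        case True
        then obtain j where j: "j \<in> F" "z \<in> cball j (r j)" by auto
        have "indicator (cball i (r i)) z = (if i = j then 1 else 0::real)" if "i \<in> F" for i
        proof (cases "i = j")
          case False
          then have "disjnt (cball i (r i)) (cball j (r j))"
            using C(3) F(1) j(1) that by (auto simp: pairwise_def)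
          then have "z \<notin> cball i (r i)" using j(2) unfolding disjnt_iff by blast
          then show ?thesis using False by simp
        qed (use j in simp)
        then show ?thesis using j F(2) by simp
      next
        case False
        then show ?thesis by (simp add: indicator_def sum.neutral)
      qed
      then show "(\<Sum>j\<in>F. indicator (cball j (r j)) z * \<bar>w z\<bar>) \<le> \<bar>w z\<bar>"
        by (simp add: sum_distrib_right[symmetric] mult_left_le_one_le sum_nonneg)
    next
      show "(\<lambda>z. \<Sum>j\<in>F. indicator (cball j (r j)) z * \<bar>w z\<bar>) integrable_on {a..b}"
        by (intro integrable_sum F(2) ball_integrable)
    qed (use \<alpha> abs_w in auto)
    finally show "measure lebesgue (\<Union>j\<in>F. ball j (5 * r j)) \<le> 10 * ?V / \<alpha>" by simp
  qed (use C(1) in auto)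
  moreover have "measure lebesgue U \<le> measure lebesgue (\<Union> ((\<lambda>j. ball j (5 * r j)) ` C))"
  proof (rule measure_mono_fmeasurable)
    show "U \<subseteq> \<Union> ((\<lambda>j. ball j (5 * r j)) ` C)"
    proof
      fix x assume x: "x \<in> U"
      then obtain j where "j \<in> C" "cball x (r x) \<subseteq> ball j (5 * r j)" using C(4) by blast
      moreover have "x \<in> cball x (r x)" using r[OF x] by simp
      ultimately show "x \<in> \<Union> ((\<lambda>j. ball j (5 * r j)) ` C)" by blast
    qed
    have "ball j (5 * r j) \<subseteq> cball a (6 * (b - a))" if "j \<in> C" for j
      using that C(2) Uab r[of j] by (fastforce simp: dist_real_def)
    then have "bounded (\<Union> ((\<lambda>j. ball j (5 * r j)) ` C))"
      by (meson UN_least bounded_cball bounded_subset)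
    then show "\<Union> ((\<lambda>j. ball j (5 * r j)) ` C) \<in> fmeasurable lebesgue"
      by (intro lmeasurable_open) auto
  qed (use U in auto)
  ultimately have "measure lebesgue U \<le> 10 * ?V / \<alpha>" by linarith
  then show "\<alpha> * measure lebesgue U \<le> 10 * ?V" using \<alpha> by (simp add: field_simps)
qed

lemma geometric_sum_eighth: "(\<Sum>j<J. (1/8::real) ^ j) \<le> 8/7"
  by (simp add: sum_gp_strict)

text \<open>
  The point \<open>\<tau>\<close> where the slope of \<open>k\<close> is large and yet controls all difference quotients from \<open>\<tau>\<close>.
  If there were none, then almost every point with slope \<open>w > \<theta>\<close> would start a difference quotient
  greater than \<open>M = (80 L\<^sup>3 w)\<^sup>1\<^sup>/\<^sup>4\<close>. Slicing by \<open>L/80/16\<^sup>j\<^sup>+\<^sup>1 \<le> w \<le> L/80/16\<^sup>j\<close> turns this into quotients greater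
  than \<open>L/2\<^sup>j\<^sup>+\<^sup>1\<close>, and the weak-type inequality bounds the measure of such points by \<open>2\<^sup>j 20 V / L\<close>, where
  \<open>V\<close> is the total variation. The sum over \<open>j\<close> is geometric with ratio \<open>1/8\<close>, and the positive
  variation of \<open>k\<close> would be smaller than what the value at \<open>\<zeta>\<close> requires. Points near the ends of the
  interval and points of slope below \<open>\<theta>\<close> contribute little.
\<close>

lemma lipschitz_point_of_increase:
  fixes k :: "real \<Rightarrow> real"
  assumes lip: "\<And>x y. \<bar>k x - k y\<bar> \<le> L * \<bar>x - y\<bar>"
    and pos: "0 < L" "0 < s" "0 < \<omega>"
    and ends: "\<bar>k (-s)\<bar> \<le> \<omega> / 16 * s" "\<bar>k s\<bar> \<le> \<omega> / 16 * s"
    and mid: "\<bar>\<zeta>\<bar> \<le> s" "\<omega> * s \<le> \<bar>k \<zeta>\<bar>"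
    and S: "negligible S"
  obtains \<tau> D M where "\<tau> \<notin> S" "\<bar>\<tau>\<bar> \<le> s - \<omega> / (16 * L) * s" "(k has_real_derivative D) (at \<tau>)"
    "\<omega> / 16 \<le> D" "0 \<le> M" "M ^ 4 \<le> 80 * L ^ 3 * D"
    "\<And>t. t \<in> {-s..s} \<Longrightarrow> \<bar>k t - k \<tau>\<bar> \<le> M * \<bar>t - \<tau>\<bar>"
proof (rule ccontr)
  assume none: "\<not> thesis"
  note found = that
  obtain w N where N: "negligible N" and w: "\<And>x. x \<notin> N \<Longrightarrow> (k has_real_derivative w x) (at x)"
    and wint: "\<And>a b. a \<le> b \<Longrightarrow> (w has_integral k b - k a) {a..b}"
    and wabs: "\<And>a b. w absolutely_integrable_on {a..b}"
    using lipschitz_indefinite_integral[of k L, OF lip] by metis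
  have cont: "continuous_on UNIV k"
    by (rule lipschitz_on_continuous_on[of L], rule lipschitz_onI)
      (use lip pos in \<open>auto simp: dist_real_def\<close>)
  define \<theta> where "\<theta> = \<omega> / 16"
  define \<beta> where "\<beta> = \<omega> / (16 * L) * s"
  define U where "U = (\<lambda>j::nat. {x\<in>{-s..s}. \<exists>y\<in>{-s..s}. (L / 2 ^ j) * \<bar>y - x\<bar> < \<bar>k y - k x\<bar>})"
  define V where "V = integral {-s..s} (\<lambda>x. \<bar>w x\<bar>)"
  define P where "P = integral {-s..s} (\<lambda>x. max (w x) 0)"
  have \<theta>: "0 < \<theta>" using pos by (simp add: \<theta>_def)
  have \<beta>: "0 < \<beta>" "L * \<beta> = \<theta> * s" using pos by (simp_all add: \<beta>_def \<theta>_def)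
  have \<omega>L: "\<omega> \<le> L + \<omega> / 16"
  proof -
    have "\<bar>k \<zeta>\<bar> \<le> L * s + \<omega> / 16 * s"
    proof (cases "\<zeta> \<ge> 0")
      case True
      have "\<bar>k \<zeta> - k s\<bar> \<le> L * \<bar>\<zeta> - s\<bar>" by (rule lip)
      also have "\<dots> \<le> L * s" using True mid pos by (intro mult_left_mono) auto
      finally show ?thesis using ends by linarith
    next
      case False
      have "\<bar>k \<zeta> - k (-s)\<bar> \<le> L * \<bar>\<zeta> - (-s)\<bar>" by (rule lip)
      also have "\<dots> \<le> L * s" using False mid pos by (intro mult_left_mono) auto
      finally show ?thesis using ends by linarith
    qed
    then have "\<omega> * s \<le> (L + \<omega> / 16) * s" using mid(2) by (simp only: distrib_right)
    then show ?thesis using pos by simp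
  qed
  have \<beta>s: "\<beta> \<le> s"
  proof -
    have "\<omega> / (16 * L) \<le> 1" using \<omega>L pos by (simp add: divide_le_eq)
    then show ?thesis using pos mult_right_mono[of "\<omega> / (16 * L)" 1 s] unfolding \<beta>_def by simp
  qed
  have iabs: "(\<lambda>x. \<bar>w x\<bar>) integrable_on {-s..s}"
    using wabs by (simp add: absolutely_integrable_on_def)
  have iw: "w integrable_on {-s..s}"
    using wabs by (simp add: absolutely_integrable_on_def)
  \<comment> \<open>The positive variation \<open>P\<close> is about half of the total variation
    \<open>V\<close> because the net increment is small.\<close>
  have max_eq: "max (w x) 0 = (1/2) * (\<bar>w x\<bar> + w x)" for x by (simp add: max_def)
  have imax: "(\<lambda>x. max (w x) 0) integrable_on {-s..s}"
    unfolding max_eq by (intro integrable_on_mult_right integrable_add iabs iw)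
  have "P = (1/2) * (V + (k s - k (-s)))"
    unfolding P_def V_def max_eq using iabs iw wint[of "-s" s] pos
    by (simp add: integral_add integral_unique)
  then have V_le: "V \<le> 2 * P + \<omega> / 8 * s" using ends by (simp add: abs_le_iff)
  have sub: "integral {c..d} w \<le> P" if "-s \<le> c" "c \<le> d" "d \<le> s" for c d
  proof -
    have cd: "{c..d} \<subseteq> {-s..s}" using that by auto
    have "integral {c..d} w \<le> integral {c..d} (\<lambda>x. max (w x) 0)"
      using integrable_subinterval_real[OF iw cd] integrable_subinterval_real[OF imax cd]
      by (intro integral_le) auto
    also have "\<dots> \<le> P" unfolding P_def
      by (rule integral_subset_le[OF cd integrable_subinterval_real[OF imax cd] imax]) auto
    finally show ?thesis .
  qed
  have P_ge: "15 / 16 * \<omega> * s \<le> P"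
  proof (cases "k \<zeta> \<ge> 0")
    case True
    have "k \<zeta> - k (-s) \<le> P"
      using sub[of "-s" \<zeta>] wint[of "-s" \<zeta>] mid by (simp add: integral_unique abs_le_iff)
    then show ?thesis using True mid ends by (simp add: abs_le_iff)
  next
    case False
    have "k s - k \<zeta> \<le> P"
      using sub[of \<zeta> s] wint[of \<zeta> s] mid by (simp add: integral_unique abs_le_iff)
    then show ?thesis using False mid ends by (simp add: abs_le_iff)
  qed
  \<comment> \<open>Slopes above \<open>\<theta>\<close> meet only finitely many slices.\<close>
  obtain J :: nat where J: "L / 80 / 16 ^ J < \<theta>"
  proof -
    obtain J :: nat where "(1/16::real) ^ J < \<theta> / (L / 80)"
      using real_arch_pow_inv[of "\<theta> / (L / 80)" "1/16"] \<theta> pos by auto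
    then show thesis using that[of J] pos by (simp add: field_simps power_divide)
  qed
  have pointwise: "max (w x) 0 \<le> \<theta> + L * indicator {-s..-(s - \<beta>)} x + L * indicator {s - \<beta>..s} x
        + (\<Sum>j<J. L / 80 / 16 ^ j * indicator (U (Suc j)) x)" (is "_ \<le> ?R x")
    if x: "x \<in> {-s..s}" "x \<notin> N \<union> S" for x
  proof -
    have sum0: "0 \<le> (\<Sum>j<J. L / 80 / 16 ^ j * indicator (U (Suc j)) x)"
      using pos by (intro sum_nonneg) auto
    have wL: "\<bar>w x\<bar> \<le> L"
    proof (rule tendsto_upperbound)
      show "((\<lambda>y. \<bar>(k y - k x) / (y - x)\<bar>) \<longlongrightarrow> \<bar>w x\<bar>) (at x)"
        using w[of x] x by (intro tendsto_rabs) (simp add: has_field_derivative_iff)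
      show "\<forall>\<^sub>F y in at x. \<bar>(k y - k x) / (y - x)\<bar> \<le> L"
        unfolding eventually_at using lip
        by (intro exI[of _ 1]) (auto simp: abs_divide divide_le_eq)
    qed simp
    consider "w x \<le> \<theta>" | "x \<in> {-s..-(s - \<beta>)} \<union> {s - \<beta>..s}" | "\<theta> < w x" "\<bar>x\<bar> \<le> s - \<beta>"
      using x by fastforce
    then show ?thesis
    proof cases
      case 1
      moreover have "0 \<le> L * indicator {-s..-(s - \<beta>)} x" "0 \<le> L * indicator {s - \<beta>..s} x"
        using pos by auto
      ultimately show ?thesis using sum0 \<theta> by linarith
    next
      case 2
      then have "L \<le> L * indicator {-s..-(s - \<beta>)} x + L * indicator {s - \<beta>..s} x"
        using pos by (auto simp: indicator_def)
      then show ?thesis using sum0 \<theta> wL pos by (simp add: max_def abs_le_iff)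
    next
      case 3
      define M where "M = root 4 (80 * L ^ 3 * w x)"
      have M4: "M ^ 4 = 80 * L ^ 3 * w x" and M0: "0 \<le> M"
        using 3 \<theta> pos by (auto simp: M_def)
      have "\<exists>t\<in>{-s..s}. M * \<bar>t - x\<bar> < \<bar>k t - k x\<bar>"
      proof (rule ccontr)
        assume "\<not> ?thesis"
        then have "\<bar>k t - k x\<bar> \<le> M * \<bar>t - x\<bar>" if "t \<in> {-s..s}" for t using that by force
        then have thesis
          using found[of x "w x" M] x w[of x] 3 M4 M0 by (auto simp: \<theta>_def \<beta>_def)
        then show False using none by blast
      qed
      then obtain t where t: "t \<in> {-s..s}" "M * \<bar>t - x\<bar> < \<bar>k t - k x\<bar>" by auto
      have "M * \<bar>t - x\<bar> < L * \<bar>t - x\<bar>" using t(2) lip[of t x] by linarith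
      then have M_lt: "M < L" using abs_ge_zero[of "t - x"] by (simp add: mult_less_cancel_right)
      have "M ^ 4 < L ^ 4" using M_lt M0 by (intro power_strict_mono) auto
      then have "L ^ 3 * (80 * w x) < L ^ 3 * L" unfolding M4 by (simp add: power_numeral_reduce)
      then have wlt: "w x < L / 80" using pos by (simp add: mult_less_cancel_left_pos)
      define j where "j = (LEAST i. L / 80 / 16 ^ i \<le> w x)"
      have exJ: "L / 80 / 16 ^ J \<le> w x" using J 3 by linarith
      have j1: "L / 80 / 16 ^ j \<le> w x" unfolding j_def by (rule LeastI[of _ J]) (rule exJ)
      have "j \<le> J" unfolding j_def by (rule Least_le) (rule exJ)
      moreover have "j \<noteq> 0" using j1 wlt by (cases j) auto
      ultimately obtain i where i: "j = Suc i" "i < J" by (cases j) auto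
      have j2: "w x \<le> L / 80 / 16 ^ i"
      proof -
        have "i < (LEAST i. L / 80 / 16 ^ i \<le> w x)" using i by (simp add: j_def)
        then show ?thesis using not_less_Least by fastforce
      qed
      have "(16::real) ^ Suc i = (2 ^ Suc i) ^ 4"
        using power_mult[of "2::real" 4 "Suc i"] by (simp only: mult.commute[of 4] power_mult) simp
      then have "(L / 2 ^ Suc i) ^ 4 = L ^ 3 * (80 * (L / 80 / 16 ^ Suc i))"
        by (simp only: power_divide) (simp add: power_numeral_reduce)
      also have "\<dots> \<le> L ^ 3 * (80 * w x)" using j1 pos i by (intro mult_left_mono) auto
      also have "\<dots> = M ^ 4" using M4 by simp
      finally have "L / 2 ^ Suc i \<le> M" using M0 by (meson power_less_imp_less_base not_le power_mono_iff less_le_trans linorder_not_less power_strict_mono zero_less_numeral)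
      then have "L / 2 ^ Suc i * \<bar>t - x\<bar> < \<bar>k t - k x\<bar>"
        using t(2) by (meson abs_ge_zero mult_right_mono le_less_trans)
      then have "x \<in> U (Suc i)" unfolding U_def using x t(1) by blast
      then have "w x \<le> L / 80 / 16 ^ i * indicator (U (Suc i)) x" using j2 by simp
      also have "\<dots> \<le> (\<Sum>j<J. L / 80 / 16 ^ j * indicator (U (Suc j)) x)"
        using i(2) pos by (intro member_le_sum) auto
      finally have "w x \<le> (\<Sum>j<J. L / 80 / 16 ^ j * indicator (U (Suc j)) x)" .
      moreover have "0 \<le> L * indicator {-s..-(s - \<beta>)} x" "0 \<le> L * indicator {s - \<beta>..s} x"
        using pos by auto
      ultimately show ?thesis using \<theta> 3 by linarith
    qed
  qed
  have U_meas: "U (Suc j) \<in> lmeasurable" and U_le: "measure lebesgue (U (Suc j)) \<le> 20 * 2 ^ j / L * V" for j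
  proof -
    have \<alpha>: "0 < L / 2 ^ Suc j" using pos by simp
    note weak = maximal_slope_weak_type[OF wint wabs cont \<alpha>, of "-s" s, folded V_def]
    show "U (Suc j) \<in> lmeasurable" unfolding U_def using weak(1) by simp
    have "L / 2 ^ Suc j * measure lebesgue (U (Suc j)) \<le> 10 * V" unfolding U_def using weak(2) by simp
    then show "measure lebesgue (U (Suc j)) \<le> 20 * 2 ^ j / L * V"
      using pos by (simp add: field_simps)
  qed
  have ind: "(indicator A has_integral measure lebesgue A) {-s..s}"
    if "A \<in> lmeasurable" "A \<subseteq> {-s..s}" for A :: "real set"
  proof -
    have "(indicator A has_integral measure lebesgue A) UNIV"
      using that lmeasurable_iff_has_integral by blast
    then have "((\<lambda>x. if x \<in> {-s..s} then indicator A x else 0) has_integral measure lebesgue A) UNIV"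
      by (rule has_integral_eq[rotated]) (use that(2) in \<open>auto simp: indicator_def\<close>)
    then show ?thesis by (simp only: has_integral_restrict_UNIV)
  qed
  have V0: "0 \<le> V" unfolding V_def by (intro integral_nonneg iabs) auto
  have "(?R has_integral \<theta> * (2 * s) + L * \<beta> + L * \<beta>
       + (\<Sum>j<J. L / 80 / 16 ^ j * measure lebesgue (U (Suc j)))) {-s..s}"
  proof (intro has_integral_add has_integral_sum has_integral_mult_right)
    show "((\<lambda>x. \<theta>) has_integral \<theta> * (2 * s)) {-s..s}"
      using has_integral_const_real[of \<theta> "-s" s] pos by (simp add: mult.commute)
    show "(indicator {-s..-(s - \<beta>)} has_integral \<beta>) {-s..s}"
      using ind[of "{-s..-(s - \<beta>)}"] \<beta> \<beta>s by auto
    show "(indicator {s - \<beta>..s} has_integral \<beta>) {-s..s}"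
      using ind[of "{s - \<beta>..s}"] \<beta> \<beta>s by auto
    show "(indicator (U (Suc j)) has_integral measure lebesgue (U (Suc j))) {-s..s}" for j
      by (rule ind[OF U_meas]) (auto simp: U_def)
  qed simp
  then have "P \<le> \<theta> * (2 * s) + L * \<beta> + L * \<beta> + (\<Sum>j<J. L / 80 / 16 ^ j * measure lebesgue (U (Suc j)))"
  proof (rule has_integral_le[rotated])
    show "((\<lambda>x. if x \<in> N \<union> S then ?R x else max (w x) 0) has_integral P) {-s..s}"
      unfolding P_def
      by (rule has_integral_spike[OF _ _ integrable_integral[OF imax], of "N \<union> S"]) (use N S in auto)
    show "(if x \<in> N \<union> S then ?R x else max (w x) 0) \<le> ?R x" if "x \<in> {-s..s}" for x
      using pointwise[OF that] by auto
  qed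
  also have "\<dots> \<le> \<theta> * (2 * s) + L * \<beta> + L * \<beta> + (\<Sum>j<J. V / 4 * (1 / 8) ^ j)"
  proof (intro add_left_mono sum_mono)
    fix j
    have "L / 80 / 16 ^ j * measure lebesgue (U (Suc j)) \<le> L / 80 / 16 ^ j * (20 * 2 ^ j / L * V)"
      using pos by (intro mult_left_mono U_le) auto
    also have "\<dots> = V / 4 * (2 ^ j / 16 ^ j)" using pos by simp
    also have "\<dots> = V / 4 * (1 / 8) ^ j" by (simp add: power_divide[symmetric])
    finally show "L / 80 / 16 ^ j * measure lebesgue (U (Suc j)) \<le> V / 4 * (1 / 8) ^ j" .
  qed
  also have "(\<Sum>j<J. V / 4 * (1 / 8) ^ j) \<le> V / 4 * (8 / 7)"
    unfolding sum_distrib_left[symmetric] using V0 by (intro mult_left_mono geometric_sum_eighth) auto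
  finally have "P \<le> \<omega> / 4 * s + 2 / 7 * V" using \<beta>(2) by (simp add: \<theta>_def)
  moreover have "0 < \<omega> * s" using pos by simp
  ultimately show False using V_le P_ge by simp
qed

section \<open>Absolutely continuous curves\<close>

text \<open>
  Absolute continuity in the language of divisions, the one used by the gauge integral. Degenerate
  intervals do no harm because their interiors are empty.
\<close>

lemma abs_cont_division:
  fixes \<gamma> :: "real \<Rightarrow> 'a::euclidean_space"
  assumes ac: "abs_cont_curve_on I \<gamma>" and \<epsilon>: "\<epsilon> > 0"
  shows "\<exists>\<delta>>0. \<forall>D T. D division_of T \<longrightarrow> T \<subseteq> I \<longrightarrow> (\<Sum>K\<in>D. measure lborel K) < \<delta> \<longrightarrow>
           (\<Sum>K\<in>D. norm (\<gamma> (Sup K) - \<gamma> (Inf K))) < \<epsilon>"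
proof -
  obtain \<delta> where \<delta>: "\<delta> > 0" and ac': "\<And>P :: (real \<times> real) set.
        finite P \<Longrightarrow> (\<forall>(u, v)\<in>P. u \<le> v \<and> {u..v} \<subseteq> I) \<Longrightarrow>
        disjoint_family_on (\<lambda>(u, v). {u<..<v}) P \<Longrightarrow> (\<Sum>(u, v)\<in>P. v - u) < \<delta> \<Longrightarrow>
        (\<Sum>(u, v)\<in>P. norm (\<gamma> v - \<gamma> u)) < \<epsilon>"
    using ac \<epsilon> unfolding abs_cont_curve_on_def by meson
  show ?thesis
  proof (intro exI[of _ \<delta>] conjI allI impI)
    fix D :: "real set set" and T
    assume D: "D division_of T" and T: "T \<subseteq> I" and small: "(\<Sum>K\<in>D. measure lborel K) < \<delta>"
    have D_form: "\<exists>u v. K = {u..v} \<and> u \<le> v" if "K \<in> D" for K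
      using division_ofD(3,4)[OF D that] by (metis atLeastatMost_empty_iff2 box_real(2) not_le)
    define q where "q = (\<lambda>K::real set. (Inf K, Sup K))"
    have inj: "inj_on q D"
    proof (rule inj_onI)
      fix K K' assume K: "K \<in> D" "K' \<in> D" "q K = q K'"
      obtain u v u' v' where "K = {u..v}" "u \<le> v" "K' = {u'..v'}" "u' \<le> v'"
        using D_form[OF K(1)] D_form[OF K(2)] by blast
      then show "K = K'" using K(3) by (simp add: q_def)
    qed
    have "(\<Sum>(u, v)\<in>q ` D. norm (\<gamma> v - \<gamma> u)) < \<epsilon>"
    proof (rule ac')
      show "finite (q ` D)" using D by auto
      show "\<forall>(u, v)\<in>q ` D. u \<le> v \<and> {u..v} \<subseteq> I"
      proof safe
        fix u v K assume "(u, v) = q K" "K \<in> D"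
        moreover obtain u' v' where "K = {u'..v'}" "u' \<le> v'" using D_form[OF \<open>K \<in> D\<close>] by blast
        moreover have "K \<subseteq> I" using division_ofD(2)[OF D \<open>K \<in> D\<close>] T by blast
        ultimately show "u \<le> v" and "\<And>x. x \<in> {u..v} \<Longrightarrow> x \<in> I" by (auto simp: q_def)
      qed
      show "disjoint_family_on (\<lambda>(u, v). {u<..<v}) (q ` D)"
        unfolding disjoint_family_on_def
      proof (intro ballI impI)
        fix m n assume "m \<in> q ` D" "n \<in> q ` D" and mn: "m \<noteq> n"
        then obtain K K' where K: "K \<in> D" "m = q K" "K' \<in> D" "n = q K'" by blast
        then have "K \<noteq> K'" using mn by blast
        then have "interior K \<inter> interior K' = {}" using division_ofD(5)[OF D] K by blast
        moreover obtain u v where "K = {u..v}" "u \<le> v" using D_form[OF K(1)] by blast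
        moreover obtain u' v' where "K' = {u'..v'}" "u' \<le> v'" using D_form[OF K(3)] by blast
        ultimately show "(case m of (u, v) \<Rightarrow> {u<..<v}) \<inter> (case n of (u, v) \<Rightarrow> {u<..<v}) = {}"
          using K by (simp add: q_def interior_atLeastAtMost_real)
      qed
      have "(\<Sum>(u, v)\<in>q ` D. v - u) = (\<Sum>K\<in>D. Sup K - Inf K)"
        unfolding sum.reindex[OF inj] by (simp add: q_def)
      also have "\<dots> = (\<Sum>K\<in>D. measure lborel K)"
        by (rule sum.cong) (use D_form in \<open>force+\<close>)
      finally show "(\<Sum>(u, v)\<in>q ` D. v - u) < \<delta>" using small by simp
    qed
    then show "(\<Sum>K\<in>D. norm (\<gamma> (Sup K) - \<gamma> (Inf K))) < \<epsilon>"
      unfolding sum.reindex[OF inj] by (simp add: q_def)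
  qed (rule \<delta>)
qed

lemma sum_content_division_le:
  fixes T U :: "real set"
  assumes D: "D division_of T" and "T \<subseteq> U" "U \<in> lmeasurable"
  shows "(\<Sum>K\<in>D. measure lborel K) \<le> measure lebesgue U"
proof -
  have "((\<lambda>x. 1) has_integral (\<Sum>K\<in>D. measure lborel K)) T"
  proof (rule has_integral_combine_division[OF D])
    fix K assume "K \<in> D"
    then obtain u v where "K = cbox u v" using division_ofD(4)[OF D] by blast
    then show "((\<lambda>x. 1::real) has_integral measure lborel K) K" using has_integral_const[of "1::real" u v] by simp
  qed
  moreover have "T \<in> lmeasurable"
    unfolding division_ofD(6)[OF D, symmetric]
    by (rule fmeasurable.finite_Union) (use division_ofD(1,4)[OF D] in force)+
  ultimately have "(\<Sum>K\<in>D. measure lborel K) = measure lebesgue T"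
    by (simp add: lmeasure_integral integral_unique)
  then show ?thesis using assms \<open>T \<in> lmeasurable\<close> by (simp add: measure_mono_fmeasurable fmeasurableD)
qed

text \<open>
  In a fine tagged division the tags outside \<open>S\<close> contribute a small error because of the derivative.
  The intervals with tags in \<open>S\<close> lie in an open set of small measure, so that absolute continuity makes
  the sum of their increments small.
\<close>

lemma abs_cont_fundamental_theorem:
  fixes \<gamma> :: "real \<Rightarrow> 'a::euclidean_space"
  assumes ab: "a \<le> b" and ac: "abs_cont_curve_on {a..b} \<gamma>" and S: "negligible S"
    and deriv: "\<And>t. t \<in> {a..b} - S \<Longrightarrow> (\<gamma> has_vector_derivative g t) (at t within {a..b})"
  shows "(g has_integral \<gamma> b - \<gamma> a) {a..b}"
proof -
  define g' where "g' = (\<lambda>t. if t \<in> S then 0 else g t)"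
  have "(g' has_integral \<gamma> b - \<gamma> a) (cbox a b)"
    unfolding has_integral
  proof (intro allI impI)
    fix e :: real assume e: "e > 0"
    \<comment> \<open>The summand \<open>1\<close> avoids a division by zero when \<open>a =
      b\<close>.\<close>
    define e1 where "e1 = e / (2 * (b - a + 1))"
    have e1: "e1 > 0" "e1 * (b - a) < e / 2"
      using e ab by (auto simp: e1_def field_simps)
    obtain \<delta> where \<delta>: "\<delta> > 0" and small: "\<And>D T. D division_of T \<Longrightarrow> T \<subseteq> {a..b} \<Longrightarrow>
        (\<Sum>K\<in>D. measure lborel K) < \<delta> \<Longrightarrow> (\<Sum>K\<in>D. norm (\<gamma> (Sup K) - \<gamma> (Inf K))) < e / 2"
      using abs_cont_division[OF ac, of "e/2"] e by auto
    obtain U where U: "open U" "S \<subseteq> U" "U - S \<in> lmeasurable" "emeasure lebesgue (U - S) < ennreal \<delta>"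
      using sets_lebesgue_outer_open[OF negligible_imp_sets[OF S] \<delta>] by blast
    have U_meas: "U \<in> lmeasurable"
      using U(1,3) S by (metis borel_open measurable_Diff_null_set negligible_iff_null_sets sets_completionI_sets sets_lborel)
    have "measure lebesgue (U - S) < \<delta>"
      using U(3,4) \<delta> by (simp add: emeasure_eq_measure2 ennreal_less_iff)
    then have U_small: "measure lebesgue U < \<delta>"
      using S U(1) by (simp add: measure_Diff_null_set negligible_iff_null_sets)
    have "\<exists>r>0. (t \<in> S \<longrightarrow> ball t r \<subseteq> U) \<and> (t \<in> {a..b} - S \<longrightarrow>
        (\<forall>y\<in>{a..b}. \<bar>y - t\<bar> < r \<longrightarrow> norm (\<gamma> y - \<gamma> t - (y - t) *\<^sub>R g t) \<le> e1 * \<bar>y - t\<bar>))" for t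
    proof (cases "t \<in> S")
      case True
      then obtain r where "r > 0" "ball t r \<subseteq> U" using U(1,2) open_contains_ball by blast
      then show ?thesis using True by auto
    next
      case False
      show ?thesis
      proof (cases "t \<in> {a..b}")
        case True
        then show ?thesis using deriv[of t] False e1(1)
          unfolding has_vector_derivative_def has_derivative_within_alt by auto
      qed (use False in \<open>auto intro: exI[of _ 1]\<close>)
    qed
    then obtain r where r: "\<And>t. r t > 0" "\<And>t. t \<in> S \<Longrightarrow> ball t (r t) \<subseteq> U"
      "\<And>t y. t \<in> {a..b} - S \<Longrightarrow> y \<in> {a..b} \<Longrightarrow> \<bar>y - t\<bar> < r t \<Longrightarrow>
          norm (\<gamma> y - \<gamma> t - (y - t) *\<^sub>R g t) \<le> e1 * \<bar>y - t\<bar>"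
      by metis
    show "\<exists>\<rho>. gauge \<rho> \<and> (\<forall>\<D>. \<D> tagged_division_of cbox a b \<and> \<rho> fine \<D> \<longrightarrow>
        norm ((\<Sum>(x, K)\<in>\<D>. measure lborel K *\<^sub>R g' x) - (\<gamma> b - \<gamma> a)) < e)"
    proof (intro exI[of _ "\<lambda>t. ball t (r t)"] conjI allI impI)
      show "gauge (\<lambda>t. ball t (r t))" using r(1) by (simp add: gauge_def)
      fix D assume "D tagged_division_of cbox a b \<and> (\<lambda>t. ball t (r t)) fine D"
      then have D: "D tagged_division_of {a..b}" and fine: "(\<lambda>t. ball t (r t)) fine D" by auto
      let ?inc = "\<lambda>K. \<gamma> (Sup K) - \<gamma> (Inf K)"
      let ?DS = "{p \<in> D. fst p \<in> S}"
      have finD: "finite D" using D by auto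
      have D_form: "\<exists>u v. K = {u..v} \<and> u \<le> x \<and> x \<le> v \<and> {u..v} \<subseteq> {a..b} \<and> {u..v} \<subseteq> ball x (r x)"
        if "(x, K) \<in> D" for x K
        using tagged_division_ofD(2,3,4)[OF D that] fineD[OF fine that] by auto
      have good: "norm (measure lborel K *\<^sub>R g' x - ?inc K) \<le> e1 * measure lborel K" if xK: "(x, K) \<in> D" "x \<notin> S" for x K
      proof -
        obtain u v where K: "K = {u..v}" "u \<le> x" "x \<le> v" "{u..v} \<subseteq> {a..b}" "{u..v} \<subseteq> ball x (r x)"
          using D_form[OF xK(1)] by blast
        have mem: "u \<in> {a..b}" "v \<in> {a..b}" "x \<in> {a..b} - S" "u \<in> ball x (r x)" "v \<in> ball x (r x)"
          using K(1-4) xK(2) subsetD[OF K(5), of u] subsetD[OF K(5), of v] by auto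
        have v: "norm (\<gamma> v - \<gamma> x - (v - x) *\<^sub>R g x) \<le> e1 * \<bar>v - x\<bar>"
          by (rule r(3)) (use mem in \<open>auto simp: dist_real_def\<close>)
        have u: "norm (\<gamma> u - \<gamma> x - (u - x) *\<^sub>R g x) \<le> e1 * \<bar>u - x\<bar>"
          by (rule r(3)) (use mem in \<open>auto simp: dist_real_def\<close>)
        have "measure lborel K *\<^sub>R g' x - ?inc K =
            (\<gamma> u - \<gamma> x - (u - x) *\<^sub>R g x) - (\<gamma> v - \<gamma> x - (v - x) *\<^sub>R g x)"
          using K that by (simp add: g'_def algebra_simps)
        also have "norm \<dots> \<le> e1 * \<bar>u - x\<bar> + e1 * \<bar>v - x\<bar>"
          using u v norm_triangle_ineq4 by (smt (verit))
        also have "\<dots> = e1 * measure lborel K" using K by (simp add: algebra_simps)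
        finally show ?thesis .
      qed
      have DS_part: "?DS tagged_partial_division_of {a..b}"
        using D tagged_partial_division_subset[of D _ ?DS] by (auto simp: tagged_division_of_def)
      note DS = tagged_partial_division_of_Union_self[OF DS_part]
      have bad: "(\<Sum>(x, K)\<in>?DS. norm (?inc K)) < e / 2"
      proof -
        let ?d = "\<lambda>K. if measure lborel K = 0 then 0 else norm (?inc K)"
        have "(\<Sum>(x, K)\<in>?DS. norm (?inc K)) = (\<Sum>(x, K)\<in>?DS. ?d K)"
        proof (rule sum.cong, simp, clarify)
          fix x K assume "(x, K) \<in> D"
          then obtain u v where "K = {u..v}" "u \<le> x" "x \<le> v" using D_form by blast
          then show "norm (?inc K) = ?d K" by auto
        qed
        also have "\<dots> = (\<Sum>K\<in>snd ` ?DS. ?d K)"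
          by (rule sum.over_tagged_division_lemma[OF DS]) (simp add: content_eq_0_interior)
        also have "\<dots> \<le> (\<Sum>K\<in>snd ` ?DS. norm (?inc K))"
          by (intro sum_mono) auto
        also have "\<dots> < e / 2"
        proof (rule small[OF division_of_tagged_division[OF DS]])
          show "\<Union> (snd ` ?DS) \<subseteq> {a..b}" using D_form by fastforce
          have "\<Union> (snd ` ?DS) \<subseteq> U" using D_form r(2) by fastforce
          then show "(\<Sum>K\<in>snd ` ?DS. measure lborel K) < \<delta>"
            using sum_content_division_le[OF division_of_tagged_division[OF DS] _ U_meas] U_small by linarith
        qed
        finally show ?thesis .
      qed
      have "(\<Sum>(x, K)\<in>D. measure lborel K *\<^sub>R g' x) - (\<gamma> b - \<gamma> a) =
          (\<Sum>(x, K)\<in>D. measure lborel K *\<^sub>R g' x) - (\<Sum>(x, K)\<in>D. ?inc K)"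
        by (simp only: additive_tagged_division_1[OF ab D])
      also have "\<dots> = (\<Sum>(x, K)\<in>D. measure lborel K *\<^sub>R g' x - ?inc K)"
        by (simp add: sum_subtractf case_prod_beta)
      also have "norm \<dots> \<le> (\<Sum>(x, K)\<in>D. e1 * measure lborel K + (if x \<in> S then norm (?inc K) else 0))"
      proof (rule sum_norm_le, clarify)
        fix x K assume xK: "(x, K) \<in> D"
        show "norm (measure lborel K *\<^sub>R g' x - ?inc K) \<le> e1 * measure lborel K + (if x \<in> S then norm (?inc K) else 0)"
        proof (cases "x \<in> S")
          case True
          then show ?thesis using e1 by (simp add: g'_def norm_minus_commute)
        qed (use good[OF xK] in simp)
      qed
      also have "\<dots> = e1 * (\<Sum>(x, K)\<in>D. measure lborel K) + (\<Sum>(x, K)\<in>D. if x \<in> S then norm (?inc K) else 0)"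
        by (simp add: case_prod_beta sum.distrib sum_distrib_left)
      also have "(\<Sum>(x, K)\<in>D. measure lborel K) = b - a"
        using additive_content_tagged_division[of D a b] D ab by simp
      also have "(\<Sum>(x, K)\<in>D. if x \<in> S then norm (?inc K) else 0) = (\<Sum>(x, K)\<in>?DS. norm (?inc K))"
        using finD by (simp add: case_prod_beta sum.inter_filter)
      finally show "norm ((\<Sum>(x, K)\<in>D. measure lborel K *\<^sub>R g' x) - (\<gamma> b - \<gamma> a)) < e"
        using bad e1(2) by linarith
    qed
  qed
  then show ?thesis
    by (intro has_integral_spike[OF S, of _ g g']) (auto simp: g'_def)
qed

lemma abs_cont_curve_on_subset:
  assumes "abs_cont_curve_on I \<gamma>" "J \<subseteq> I"
  shows "abs_cont_curve_on J \<gamma>"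
proof -
  have "(\<forall>(u, v)\<in>P. u \<le> v \<and> {u..v} \<subseteq> J) \<Longrightarrow> (\<forall>(u, v)\<in>P. u \<le> v \<and> {u..v} \<subseteq> I)" for P
    using assms(2) by fastforce
  then show ?thesis using assms(1) unfolding abs_cont_curve_on_def by meson
qed

lemma abs_cont_fundamental_theorem_sub:
  fixes \<gamma> :: "real \<Rightarrow> 'a::euclidean_space"
  assumes ac: "abs_cont_curve_on {a..b} \<gamma>" and S: "negligible S"
    and deriv: "\<And>t. t \<in> {a..b} - S \<Longrightarrow> (\<gamma> has_vector_derivative g t) (at t within {a..b})"
    and cd: "a \<le> c" "c \<le> d" "d \<le> b"
  shows "(g has_integral \<gamma> d - \<gamma> c) {c..d}"
proof (rule abs_cont_fundamental_theorem[OF cd(2) _ S])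
  have sub: "{c..d} \<subseteq> {a..b}" using cd by auto
  show "abs_cont_curve_on {c..d} \<gamma>" using abs_cont_curve_on_subset[OF ac sub] .
  show "(\<gamma> has_vector_derivative g t) (at t within {c..d})" if "t \<in> {c..d} - S" for t
    using deriv[of t] that sub has_vector_derivative_within_subset by blast
qed

text \<open>
  On an interval that is shorter than the \<open>\<delta>\<close> for \<open>\<epsilon> = 1\<close>, the indefinite integral has variation at
  most \<open>1\<close>; finitely many such intervals suffice. Without this, the length integral of a horizontal
  curve could be the junk value \<open>0\<close>, and the distance could degenerate.
\<close>

lemma abs_cont_derivative_absolutely_integrable:
  fixes \<gamma> :: "real \<Rightarrow> 'a::euclidean_space"
  assumes ac: "abs_cont_curve_on {a..b} \<gamma>" and S: "negligible S"
    and deriv: "\<And>t. t \<in> {a..b} - S \<Longrightarrow> (\<gamma> has_vector_derivative g t) (at t within {a..b})"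
  shows "g absolutely_integrable_on {a..b}"
proof -
  have ftc: "(g has_integral \<gamma> d - \<gamma> c) {c..d}" if "a \<le> c" "c \<le> d" "d \<le> b" for c d
    by (rule abs_cont_fundamental_theorem_sub[OF ac S deriv that])
  obtain \<delta> where \<delta>: "\<delta> > 0" and small: "\<And>D T. D division_of T \<Longrightarrow> T \<subseteq> {a..b} \<Longrightarrow>
        (\<Sum>K\<in>D. measure lborel K) < \<delta> \<Longrightarrow> (\<Sum>K\<in>D. norm (\<gamma> (Sup K) - \<gamma> (Inf K))) < 1"
    using abs_cont_division[OF ac, of 1] by auto
  have short: "g absolutely_integrable_on {c..d}" if cd: "a \<le> c" "c \<le> d" "d \<le> b" "d - c < \<delta>" for c d
  proof -
    have "g absolutely_integrable_on cbox c d"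
    proof (rule bounded_variation_absolutely_integrable_interval)
      show "g integrable_on cbox c d" using ftc[OF cd(1-3)] by (auto simp: has_integral_iff)
      fix D assume D: "D division_of cbox c d"
      have sub: "cbox c d \<subseteq> {a..b}" using cd by auto
      have "(\<Sum>K\<in>D. norm (integral K g)) = (\<Sum>K\<in>D. norm (\<gamma> (Sup K) - \<gamma> (Inf K)))"
      proof (rule sum.cong)
        fix K assume K: "K \<in> D"
        then obtain u v where uv: "K = {u..v}" "u \<le> v"
          using division_ofD(3,4)[OF D K] by (metis atLeastatMost_empty_iff2 box_real(2) not_le)
        then have "a \<le> u" "v \<le> b" using division_ofD(2)[OF D K] sub by auto
        then show "norm (integral K g) = norm (\<gamma> (Sup K) - \<gamma> (Inf K))"
          using ftc[of u v] uv by (simp add: integral_unique)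
      qed simp
      moreover have "(\<Sum>K\<in>D. measure lborel K) < \<delta>"
        using sum_content_division_le[OF D subset_refl] cd by simp
      ultimately show "(\<Sum>K\<in>D. norm (integral K g)) \<le> 1" using small[OF D sub] by simp
    qed
    then show ?thesis by simp
  qed
  have long: "g absolutely_integrable_on {c..d}"
    if "a \<le> c" "c \<le> d" "d \<le> b" "d - c \<le> real n * (\<delta> / 2)" for n c d
    using that
  proof (induction n arbitrary: d)
    case 0
    then show ?case using short[of c d] \<delta> by simp
  next
    case (Suc n)
    show ?case
    proof (cases "d - c \<le> \<delta> / 2")
      case True
      then show ?thesis using short[of c d] Suc.prems \<delta> by simp
    next
      case False
      have "g absolutely_integrable_on {c..d - \<delta> / 2}"
        using Suc.prems False \<delta> by (intro Suc.IH) (auto simp: algebra_simps)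
      moreover have "g absolutely_integrable_on {d - \<delta> / 2..d}"
        using Suc.prems False \<delta> by (intro short) auto
      moreover have "{c..d} = {c..d - \<delta> / 2} \<union> {d - \<delta> / 2..d}" using False \<delta> by auto
      ultimately show ?thesis by (simp add: absolutely_integrable_Un)
    qed
  qed
  show ?thesis
  proof (cases "a \<le> b")
    case True
    obtain n where "b - a \<le> real n * (\<delta> / 2)" using \<delta> by (metis half_gt_zero ex_less_of_nat_mult less_imp_le)
    then show ?thesis using long[of a b n] True by simp
  qed simp
qed

section \<open>The symplectic form and the group coordinates\<close>

definition sympl :: "'n::finite hvec \<Rightarrow> 'n hvec \<Rightarrow> real" where
  "sympl u v = fst u \<bullet> snd v - snd u \<bullet> fst v"

text \<open>Pairing with \<open>hrot v\<close> in the Euclidean inner product is the symplectic form with \<open>v\<close>.\<close>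

definition hrot :: "'n::finite hvec \<Rightarrow> 'n hvec" where
  "hrot v = (snd v, - fst v)"

text \<open>The last coordinate of \<open>hmult (hinv x) y\<close>.\<close>

definition vdisp :: "'n::finite heis \<Rightarrow> 'n heis \<Rightarrow> real" where
  "vdisp x y = snd (snd y) - snd (snd x) + 2 * sympl (hproj x) (hproj y)"

text \<open>The integral curve of the field \<open>hfield u\<close> through \<open>q\<close>: such a field is constant along its own
  integral curves, which are therefore straight.\<close>

definition hline :: "'n::finite heis \<Rightarrow> 'n hvec \<Rightarrow> real \<Rightarrow> 'n heis" where
  "hline q u t = q + t *\<^sub>R hfield u q"

lemma sympl_hrot: "sympl u v = u \<bullet> hrot v"
  by (simp add: sympl_def hrot_def inner_prod_def)

lemma norm_hrot: "norm (hrot v) = norm v"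
  by (simp add: hrot_def norm_prod_def add.commute)

lemma abs_sympl_le: "\<bar>sympl u v\<bar> \<le> norm u * norm v"
  using Cauchy_Schwarz_ineq2[of u "hrot v"] by (simp add: sympl_hrot norm_hrot)

lemma sympl_self [simp]: "sympl u u = 0"
  by (simp add: sympl_def inner_commute)

lemma sympl_antisym: "sympl u v = - sympl v u"
  by (simp add: sympl_def inner_commute)

lemma sympl_hrot_self: "sympl u (hrot u) = - (norm u)\<^sup>2"
  by (simp add: sympl_def hrot_def power2_norm_eq_inner inner_prod_def)

lemma bounded_bilinear_sympl: "bounded_bilinear (sympl :: 'n::finite hvec \<Rightarrow> 'n hvec \<Rightarrow> real)"
proof
  show "\<exists>K. \<forall>a b :: 'n hvec. norm (sympl a b) \<le> norm a * norm b * K"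
    using abs_sympl_le by (intro exI[of _ 1]) auto
qed (simp_all add: sympl_def algebra_simps inner_add_left inner_add_right)

interpretation sympl: bounded_bilinear "sympl :: 'n::finite hvec \<Rightarrow> 'n hvec \<Rightarrow> real"
  by (rule bounded_bilinear_sympl)

lemmas sympl_simps = sympl.add_left sympl.add_right sympl.diff_left sympl.diff_right sympl.scaleR_left
  sympl.scaleR_right sympl.minus_left sympl.minus_right sympl.zero_left sympl.zero_right

lemma hproj_eq: "hproj x = (fst x, fst (snd x))"
  by (cases x) auto

lemma heis_eqI: "hproj x = hproj y \<Longrightarrow> snd (snd x) = snd (snd y) \<Longrightarrow> x = y"
  by (simp add: hproj_eq prod_eq_iff)

lemma bounded_linear_hproj: "bounded_linear (hproj :: 'n::finite heis \<Rightarrow> 'n hvec)"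
  unfolding hproj_eq
  by (intro bounded_linear_Pair bounded_linear_fst bounded_linear_compose[OF bounded_linear_fst bounded_linear_snd])

lemma hproj_add: "hproj (x + y) = hproj x + hproj y"
  and hproj_diff: "hproj (x - y) = hproj x - hproj y"
  and hproj_scaleR: "hproj (r *\<^sub>R x) = r *\<^sub>R hproj x"
  and hproj_zero [simp]: "hproj 0 = 0"
  by (simp_all add: hproj_eq zero_prod_def)

lemma bounded_linear_height: "bounded_linear (\<lambda>x :: 'n::finite heis. snd (snd x))"
  by (rule bounded_linear_compose[OF bounded_linear_snd bounded_linear_snd])

lemma hfield_eq: "hfield h x = (fst h, snd h, - 2 * sympl (hproj x) h)"
proof -
  have X: "X_field i x = (axis i 1, 0, 2 * fst (snd x) $ i)" for i by (cases x) auto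
  have Y: "Y_field i x = (0, axis i 1, - 2 * fst x $ i)" for i by (cases x) auto
  have expand: "(\<Sum>i\<in>UNIV. (v $ i) *\<^sub>R axis i 1) = v" for v :: "real^'n"
    using basis_expansion[of v] by (simp add: scalar_mult_eq_scaleR)
  have "snd (snd (hfield h x)) = (\<Sum>i\<in>UNIV. fst h $ i * (2 * fst (snd x) $ i) + snd h $ i * (- 2 * fst x $ i))"
    unfolding hfield_def X Y by (simp add: snd_sum)
  also have "\<dots> = - 2 * sympl (hproj x) h"
    unfolding sympl_def hproj_eq inner_vec_def
    by (simp add: sum.distrib sum_distrib_left algebra_simps sum_subtractf sum_negf)
  finally have "snd (snd (hfield h x)) = - 2 * sympl (hproj x) h" .
  moreover have "fst (hfield h x) = fst h" "fst (snd (hfield h x)) = snd h"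
    unfolding hfield_def X Y by (simp_all add: fst_sum snd_sum expand)
  ultimately show ?thesis by (simp add: prod_eq_iff)
qed

lemma hproj_hfield [simp]: "hproj (hfield h x) = h"
  by (simp add: hfield_eq)

lemma height_hfield: "snd (snd (hfield h x)) = - 2 * sympl (hproj x) h"
  by (simp add: hfield_eq)

lemma hproj_hline [simp]: "hproj (hline q u t) = hproj q + t *\<^sub>R u"
  by (simp add: hline_def hproj_add hproj_scaleR)

lemma height_hline: "snd (snd (hline q u t)) = snd (snd q) - 2 * t * sympl (hproj q) u"
  by (simp add: hline_def height_hfield)

lemma hline_hline: "hline (hline q u s) u t = hline q u (s + t)"
  by (rule heis_eqI) (simp_all add: height_hline sympl_simps algebra_simps)

lemma hline_0 [simp]: "hline q u 0 = q"
  by (simp add: hline_def)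

lemma vdisp_self [simp]: "vdisp x x = 0"
  by (simp add: vdisp_def)

lemma vdisp_hline [simp]: "vdisp q (hline q u t) = 0"
  by (simp add: vdisp_def height_hline sympl_simps)

lemma vdisp_swap: "vdisp y x = - vdisp x y"
  using sympl_antisym[of "hproj x" "hproj y"] by (simp add: vdisp_def)

text \<open>
  How vertical displacements add up: the correction is the symplectic area spanned by the two
  horizontal displacements.
\<close>

lemma vdisp_chain:
  "vdisp x z = vdisp x y + vdisp y z - 2 * sympl (hproj y - hproj x) (hproj z - hproj y)"
  using sympl_antisym[of "hproj y" "hproj x"] by (simp add: vdisp_def sympl_simps)

lemma hproj_displacement: "hproj (hmult (hinv x) y) = hproj y - hproj x"
  by (cases x; cases y) auto

lemma vdisp_along_hline: "vdisp (hline q u s) (hline q u t) = 0"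
  using vdisp_hline[of "hline q u s" u "t - s"] by (simp add: hline_hline)

section \<open>Estimates for the Carnot-Caratheodory distance\<close>

lemma hlength_nonneg: "0 \<le> hlength I \<gamma>"
  unfolding hlength_def set_lebesgue_integral_def by (intro integral_nonneg_AE) (auto simp: indicator_def)

text \<open>
  Both bounds integrate the derivative of a linear function of \<open>\<gamma>\<close>. The vertical displacement from the
  fixed point \<open>\<gamma> a\<close> has derivative \<open>- 2 sympl (p - p a) h\<close>, whose first argument never exceeds the
  length.
\<close>

lemma horizontal_curve_lower_bounds:
  fixes \<gamma> :: "real \<Rightarrow> 'n::finite heis"
  assumes ab: "a \<le> b" and \<gamma>: "horizontal_curve_on {a..b} \<gamma>"
  shows "norm (hproj (\<gamma> b) - hproj (\<gamma> a)) \<le> hlength {a..b} \<gamma>"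
    and "\<bar>vdisp (\<gamma> a) (\<gamma> b)\<bar> \<le> 2 * (hlength {a..b} \<gamma>)\<^sup>2"
proof -
  define h where "h = (SOME h. horizontal_coeffs {a..b} \<gamma> h)"
  have ac: "abs_cont_curve_on {a..b} \<gamma>" using \<gamma> by (simp add: horizontal_curve_on_def)
  have "horizontal_coeffs {a..b} \<gamma> h"
    using \<gamma> unfolding horizontal_curve_on_def h_def by (metis someI_ex)
  then have "AE t in lebesgue. t \<in> {a..b} \<longrightarrow> (\<gamma> has_vector_derivative hfield (h t) (\<gamma> t)) (at t within {a..b})"
    by (simp add: horizontal_coeffs_def)
  then obtain S where S: "S \<in> null_sets lebesgue"
    "{t \<in> space lebesgue. \<not> (t \<in> {a..b} \<longrightarrow> (\<gamma> has_vector_derivative hfield (h t) (\<gamma> t)) (at t within {a..b}))} \<subseteq> S"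
    by (auto simp: eventually_ae_filter)
  have neg: "negligible S" using S(1) by (simp add: negligible_iff_null_sets)
  have deriv: "(\<gamma> has_vector_derivative hfield (h t) (\<gamma> t)) (at t within {a..b})" if "t \<in> {a..b} - S" for t
    using S(2) that by auto
  have "(\<lambda>t. hfield (h t) (\<gamma> t)) absolutely_integrable_on {a..b}"
    by (rule abs_cont_derivative_absolutely_integrable[OF ac neg deriv])
  from absolutely_integrable_linear[OF this bounded_linear_hproj]
  have h_abs: "h absolutely_integrable_on {a..b}" by (simp add: o_def)
  then have int_norm: "(\<lambda>t. norm (h t)) integrable_on {a..b}"
    by (simp add: absolutely_integrable_on_def)
  have len: "hlength {a..b} \<gamma> = integral {a..b} (\<lambda>t. norm (h t))"
    unfolding hlength_def h_def[symmetric]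
    by (rule set_lebesgue_integral_eq_integral(2)[OF absolutely_integrable_norm[OF h_abs, unfolded o_def]])
  have h_int: "(h has_integral hproj (\<gamma> d) - hproj (\<gamma> c)) {c..d}" if "a \<le> c" "c \<le> d" "d \<le> b" for c d
    using has_integral_linear[OF abs_cont_fundamental_theorem_sub[OF ac neg deriv that] bounded_linear_hproj]
    by (simp add: o_def hproj_diff)
  have disp: "norm (hproj (\<gamma> t) - hproj (\<gamma> a)) \<le> hlength {a..b} \<gamma>" if t: "t \<in> {a..b}" for t
  proof -
    have sub: "{a..t} \<subseteq> {a..b}" using t by auto
    have hi: "(h has_integral hproj (\<gamma> t) - hproj (\<gamma> a)) {a..t}" using h_int[of a t] t by auto
    have "norm (hproj (\<gamma> t) - hproj (\<gamma> a)) = norm (integral {a..t} h)"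
      using hi by (simp add: integral_unique)
    also have "\<dots> \<le> integral {a..t} (\<lambda>s. norm (h s))"
      using hi integrable_subinterval_real[OF int_norm sub]
      by (intro Henstock_Kurzweil_Integration.integral_norm_bound_integral) (auto simp: has_integral_iff)
    also have "\<dots> \<le> integral {a..b} (\<lambda>s. norm (h s))"
      using integrable_subinterval_real[OF int_norm sub] int_norm by (intro integral_subset_le[OF sub]) auto
    finally show ?thesis by (simp add: len)
  qed
  show "norm (hproj (\<gamma> b) - hproj (\<gamma> a)) \<le> hlength {a..b} \<gamma>" using disp[of b] ab by simp
  define ell where "ell = (\<lambda>x :: 'n heis. snd (snd x) + 2 * sympl (hproj (\<gamma> a)) (hproj x))"
  have "bounded_linear ell"
    unfolding ell_def
    by (intro bounded_linear_add bounded_linear_height bounded_linear_const_mult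
      bounded_linear_compose[OF sympl.bounded_linear_right bounded_linear_hproj])
  from has_integral_linear[OF abs_cont_fundamental_theorem_sub[OF ac neg deriv order_refl ab order_refl] this]
  have "((\<lambda>t. ell (hfield (h t) (\<gamma> t))) has_integral ell (\<gamma> b - \<gamma> a)) {a..b}" by (simp add: o_def)
  moreover have "ell (hfield (h t) (\<gamma> t)) = - 2 * sympl (hproj (\<gamma> t) - hproj (\<gamma> a)) (h t)" for t
    by (simp add: ell_def height_hfield sympl_simps)
  moreover have "ell (\<gamma> b - \<gamma> a) = vdisp (\<gamma> a) (\<gamma> b)"
    by (simp add: ell_def vdisp_def hproj_diff sympl_simps)
  ultimately have vint: "((\<lambda>t. - 2 * sympl (hproj (\<gamma> t) - hproj (\<gamma> a)) (h t)) has_integral vdisp (\<gamma> a) (\<gamma> b)) {a..b}"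
    by simp
  let ?L = "hlength {a..b} \<gamma>"
  have "norm (integral {a..b} (\<lambda>t. - 2 * sympl (hproj (\<gamma> t) - hproj (\<gamma> a)) (h t))) \<le>
      integral {a..b} (\<lambda>t. 2 * ?L * norm (h t))"
  proof (rule Henstock_Kurzweil_Integration.integral_norm_bound_integral)
    show "(\<lambda>t. - 2 * sympl (hproj (\<gamma> t) - hproj (\<gamma> a)) (h t)) integrable_on {a..b}"
      using vint by (auto simp: has_integral_iff)
    show "(\<lambda>t. 2 * ?L * norm (h t)) integrable_on {a..b}"
      using int_norm by (rule integrable_on_mult_right)
    fix t assume t: "t \<in> {a..b}"
    have "\<bar>sympl (hproj (\<gamma> t) - hproj (\<gamma> a)) (h t)\<bar> \<le> ?L * norm (h t)"
      by (rule order_trans[OF abs_sympl_le mult_right_mono[OF disp[OF t]]]) simp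
    then show "norm (- 2 * sympl (hproj (\<gamma> t) - hproj (\<gamma> a)) (h t)) \<le> 2 * ?L * norm (h t)"
      by (simp add: abs_mult)
  qed
  then have "\<bar>vdisp (\<gamma> a) (\<gamma> b)\<bar> \<le> integral {a..b} (\<lambda>t. 2 * ?L * norm (h t))"
    unfolding integral_unique[OF vint] by simp
  also have "\<dots> = 2 * ?L * ?L"
    by (simp only: Henstock_Kurzweil_Integration.integral_mult_right len[symmetric])
  finally show "\<bar>vdisp (\<gamma> a) (\<gamma> b)\<bar> \<le> 2 * ?L\<^sup>2"
    by (simp add: power2_eq_square mult.assoc)
qed

lemma abs_cont_curve_on_lipschitz:
  assumes "\<And>s t. s \<in> I \<Longrightarrow> t \<in> I \<Longrightarrow> norm (\<gamma> t - \<gamma> s) \<le> K * \<bar>t - s\<bar>" and K: "0 \<le> K"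
  shows "abs_cont_curve_on I \<gamma>"
  unfolding abs_cont_curve_on_def
proof (intro allI impI)
  fix \<epsilon> :: real assume \<epsilon>: "\<epsilon> > 0"
  show "\<exists>\<delta>>0. \<forall>P :: (real \<times> real) set. finite P \<longrightarrow> (\<forall>(u, v)\<in>P. u \<le> v \<and> {u..v} \<subseteq> I) \<longrightarrow>
      disjoint_family_on (\<lambda>(u, v). {u<..<v}) P \<longrightarrow> (\<Sum>(u, v)\<in>P. v - u) < \<delta> \<longrightarrow>
      (\<Sum>(u, v)\<in>P. norm (\<gamma> v - \<gamma> u)) < \<epsilon>"
  proof (intro exI[of _ "\<epsilon> / (K + 1)"] conjI allI impI)
    show "0 < \<epsilon> / (K + 1)" using \<epsilon> K by simp
    fix P :: "(real \<times> real) set"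
    assume P: "finite P" "\<forall>(u, v)\<in>P. u \<le> v \<and> {u..v} \<subseteq> I" "(\<Sum>(u, v)\<in>P. v - u) < \<epsilon> / (K + 1)"
    have "(\<Sum>(u, v)\<in>P. norm (\<gamma> v - \<gamma> u)) \<le> (\<Sum>(u, v)\<in>P. K * (v - u))"
    proof (rule sum_mono, clarify)
      fix u v assume "(u, v) \<in> P"
      then have "u \<le> v" "{u..v} \<subseteq> I" using P(2) by auto
      moreover from this have "u \<in> I" "v \<in> I" by auto
      ultimately show "norm (\<gamma> v - \<gamma> u) \<le> K * (v - u)" using assms(1)[of u v] by auto
    qed
    also have "\<dots> = K * (\<Sum>(u, v)\<in>P. v - u)" by (simp add: case_prod_beta sum_distrib_left)
    also have "\<dots> \<le> K * (\<epsilon> / (K + 1))" using P(3) K by (intro mult_left_mono) auto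
    also have "\<dots> < \<epsilon>" using \<epsilon> K by (simp add: field_simps)
    finally show "(\<Sum>(u, v)\<in>P. norm (\<gamma> v - \<gamma> u)) < \<epsilon>" .
  qed
qed

lemma cc_dist_le_hlength:
  assumes "a \<le> b" "horizontal_curve_on {a..b} \<gamma>" "\<gamma> a = x" "\<gamma> b = y"
  shows "cc_dist x y \<le> hlength {a..b} \<gamma>"
  unfolding cc_dist_def
proof (rule cInf_lower)
  show "bdd_below {hlength {a..b} \<gamma> |a b \<gamma>. a \<le> b \<and> horizontal_curve_on {a..b} \<gamma> \<and> \<gamma> a = x \<and> \<gamma> b = y}"
    using hlength_nonneg by (intro bdd_belowI[of _ 0]) blast
qed (use assms in blast)

text \<open>
  The definition of length uses an unspecified choice of coefficients; by uniqueness of derivatives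
  every choice agrees with \<open>h\<close> on the interval almost everywhere.
\<close>

lemma smooth_curve_horizontal:
  fixes \<gamma> :: "real \<Rightarrow> 'n::finite heis"
  assumes deriv: "\<And>t. t \<in> {0..1} \<Longrightarrow> (\<gamma> has_vector_derivative hfield (h t) (\<gamma> t)) (at t within {0..1})"
    and bound: "\<And>t. t \<in> {0..1} \<Longrightarrow> norm (h t) \<le> B"
  shows "horizontal_curve_on {0..1} \<gamma>" "cc_dist (\<gamma> 0) (\<gamma> 1) \<le> B"
proof -
  have B0: "0 \<le> B" using bound[of 0] norm_ge_zero[of "h 0"] by (meson atLeastAtMost_iff order_refl order_trans zero_le_one)
  have cont: "continuous_on {0..1} \<gamma>"
    by (rule continuous_on_vector_derivative[OF deriv])
  then have "compact (\<gamma> ` {0..1})" by (intro compact_continuous_image) auto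
  then obtain R where R: "\<And>t. t \<in> {0..1} \<Longrightarrow> norm (\<gamma> t) \<le> R"
    using compact_imp_bounded bounded_iff by (metis imageI)
  obtain C where C: "\<And>x :: 'n heis. norm (hproj x) \<le> norm x * C" "C > 0"
    using bounded_linear.pos_bounded[OF bounded_linear_hproj[where 'n='n]] by blast
  define K where "K = B + (B + 2 * (R * C * B))"
  have R0: "0 \<le> R" using R[of 0] norm_ge_zero[of "\<gamma> 0"] by (meson atLeastAtMost_iff order_refl order_trans zero_le_one)
  have K0: "0 \<le> K" using B0 R0 C by (simp add: K_def)
  have speed: "norm (hfield (h t) (\<gamma> t)) \<le> K" if t: "t \<in> {0..1}" for t
  proof -
    have "norm (hproj (\<gamma> t)) \<le> R * C"
      using C(1)[of "\<gamma> t"] R[OF t] C(2) by (meson less_imp_le mult_right_mono order_trans)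
    then have "norm (hproj (\<gamma> t)) * norm (h t) \<le> R * C * B"
      using bound[OF t] R0 C(2) by (intro mult_mono) auto
    then have "\<bar>sympl (hproj (\<gamma> t)) (h t)\<bar> \<le> R * C * B"
      using abs_sympl_le[of "hproj (\<gamma> t)" "h t"] by linarith
    moreover have "norm (fst (h t)) \<le> B" "norm (snd (h t)) \<le> B"
      using bound[OF t] norm_fst_le[of "fst (h t)" "snd (h t)"] norm_snd_le[of "snd (h t)" "fst (h t)"]
      by simp_all
    moreover have "norm (hfield (h t) (\<gamma> t)) \<le> norm (fst (h t)) + (norm (snd (h t)) + norm (- 2 * sympl (hproj (\<gamma> t)) (h t)))"
      unfolding hfield_eq by (meson add_left_mono norm_Pair_le order_trans)
    ultimately show ?thesis by (simp add: K_def abs_mult)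
  qed
  have lip: "norm (\<gamma> t - \<gamma> s) \<le> K * \<bar>t - s\<bar>" if "s \<in> {0..1}" "t \<in> {0..1}" for s t
  proof -
    have "norm (\<gamma> t - \<gamma> s) \<le> K * norm (t - s)"
    proof (rule differentiable_bound[of "{0..1}" \<gamma> "\<lambda>t v. v *\<^sub>R hfield (h t) (\<gamma> t)"])
      show "(\<gamma> has_derivative (\<lambda>v. v *\<^sub>R hfield (h x) (\<gamma> x))) (at x within {0..1})" if "x \<in> {0..1}" for x
        using deriv[OF that] by (simp add: has_vector_derivative_def)
      show "onorm (\<lambda>v. v *\<^sub>R hfield (h x) (\<gamma> x)) \<le> K" if "x \<in> {0..1}" for x
      proof (rule onorm_le)
        show "norm (v *\<^sub>R hfield (h x) (\<gamma> x)) \<le> K * norm v" for v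
          using mult_right_mono[OF speed[OF that], of "norm v"] by (simp add: mult.commute)
      qed
    qed (use that in auto)
    then show ?thesis by simp
  qed
  have coeffs: "horizontal_coeffs {0..1} \<gamma> h"
    unfolding horizontal_coeffs_def using deriv by simp
  show hor: "horizontal_curve_on {0..1} \<gamma>"
    unfolding horizontal_curve_on_def
    by (intro conjI exI[of _ h] coeffs is_interval_cc abs_cont_curve_on_lipschitz[OF lip K0])
  define h' where "h' = (SOME h. horizontal_coeffs {0..1} \<gamma> h)"
  have "horizontal_coeffs {0..1} \<gamma> h'" unfolding h'_def using coeffs by (metis someI)
  then have ae: "AE t in lebesgue. norm (indicator {0..1} t *\<^sub>R norm (h' t)) \<le> indicator {0..1} t *\<^sub>R B"
    unfolding horizontal_coeffs_def
  proof (rule eventually_mono)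
    fix t assume t: "t \<in> {0..1} \<longrightarrow> (\<gamma> has_vector_derivative hfield (h' t) (\<gamma> t)) (at t within {0..1})"
    show "norm (indicator {0..1} t *\<^sub>R norm (h' t)) \<le> indicator {0..1} t *\<^sub>R B"
    proof (cases "t \<in> {0..1}")
      case True
      have "at t within {0..1::real} \<noteq> bot"
        using True by (simp add: trivial_limit_within islimpt_Icc)
      then have "hfield (h' t) (\<gamma> t) = hfield (h t) (\<gamma> t)"
        using vector_derivative_unique_within t deriv[OF True] True by blast
      then have "h' t = h t" by (metis hproj_hfield)
      then show ?thesis using bound[OF True] True by simp
    qed simp
  qed
  have int_B: "integrable lebesgue (\<lambda>t. indicat_real {0..1::real} t *\<^sub>R B)"
    by (intro integrable_scaleR_left integrable_real_indicator) auto
  have ae': "AE t in lebesgue. indicator {0..1::real} t *\<^sub>R norm (h' t) \<le> indicator {0..1::real} t *\<^sub>R B"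
    using ae by (rule eventually_mono) simp
  have "hlength {0..1} \<gamma> \<le> (LINT t:{0..1::real}|lebesgue. B)"
    unfolding hlength_def h'_def[symmetric] set_lebesgue_integral_def
  proof (cases "integrable lebesgue (\<lambda>t. indicat_real {0..1::real} t *\<^sub>R norm (h' t))")
    case True
    then show "(LINT t|lebesgue. indicat_real {0..1::real} t *\<^sub>R norm (h' t)) \<le> (LINT t|lebesgue. indicat_real {0..1::real} t *\<^sub>R B)"
      using int_B ae' by (rule Bochner_Integration.integral_mono_AE)
  next
    case False
    then show "(LINT t|lebesgue. indicat_real {0..1::real} t *\<^sub>R norm (h' t)) \<le> (LINT t|lebesgue. indicat_real {0..1::real} t *\<^sub>R B)"
      by (simp add: not_integrable_integral_eq B0)
  qed
  also have "(LINT t:{0..1::real}|lebesgue. B) = B"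
    unfolding set_lebesgue_integral_def by (simp add: measure_completion)
  finally show "cc_dist (\<gamma> 0) (\<gamma> 1) \<le> B"
    using cc_dist_le_hlength[OF _ hor, of "\<gamma> 0" "\<gamma> 1"] by simp
qed

lemma curve_lift_derivative:
  fixes P :: "real \<Rightarrow> 'n::finite hvec"
  assumes P: "(P has_vector_derivative P') (at t within T)"
    and z: "(z has_real_derivative - 2 * sympl (P t) P') (at t within T)"
  shows "((\<lambda>t. (fst (P t), snd (P t), z t)) has_vector_derivative hfield P' (fst (P t), snd (P t), z t)) (at t within T)"
proof -
  have z': "(z has_vector_derivative - 2 * sympl (P t) P') (at t within T)"
    using z by (simp add: has_real_derivative_iff_has_vector_derivative)
  show ?thesis
    unfolding hfield_eq
    using has_vector_derivative_Pair[OF bounded_linear.has_vector_derivative[OF bounded_linear_fst P]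
        has_vector_derivative_Pair[OF bounded_linear.has_vector_derivative[OF bounded_linear_snd P] z']]
    by simp
qed

text \<open>
  Any two points are joined by one polynomial curve: the horizontal displacement \<open>v\<close> is covered at
  constant speed, while a loop \<open>(\<rho> q1, \<rho>' q2)\<close> in a symplectic plane provides the vertical displacement.
  Both \<open>q1\<close> and \<open>q2\<close> vanish at \<open>0\<close> and \<open>1\<close> and have mean zero, so that the loop does not interact
  with the linear motion. Their primitives are \<open>Q1\<close> and \<open>Q2\<close>, and \<open>W\<close> is the primitive of
  \<open>q1 q2' - q2 q1'\<close>, with \<open>W 1 = - 1/35\<close>.
\<close>

lemma cc_dist_upper_curve:
  fixes x y :: "'n::finite heis"
  shows "\<exists>\<gamma>. horizontal_curve_on {0..1} \<gamma> \<and> \<gamma> 0 = x \<and> \<gamma> 1 = y \<and>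
    cc_dist x y \<le> norm (hproj y - hproj x) + 76 * sqrt (35 / 2) * sqrt \<bar>vdisp x y\<bar>"
proof -
  define i :: 'n where "i = undefined"
  define e :: "'n hvec" where "e = (axis i 1, 0)"
  define f :: "'n hvec" where "f = (0, axis i 1)"
  have ef: "sympl e f = 1" "sympl f e = -1" by (simp_all add: sympl_def e_def f_def inner_axis_axis)
  have norms: "norm e = 1" "norm f = 1" by (simp_all add: e_def f_def norm_axis_1)
  define v where "v = hproj y - hproj x"
  define c where "c = vdisp x y"
  \<comment> \<open>Chosen so that the loop accounts for the vertical displacement \<open>2 \<rho>
    \<rho>' / 35 = c\<close>.\<close>
  define \<rho> where "\<rho> = sqrt (35 / 2) * sqrt \<bar>c\<bar>"
  define \<rho>' where "\<rho>' = sgn c * \<rho>"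
  have \<rho>: "0 \<le> \<rho>" "\<bar>\<rho>'\<bar> \<le> \<rho>" by (auto simp: \<rho>_def \<rho>'_def abs_mult sgn_if)
  have \<rho>\<rho>': "2 * \<rho> * \<rho>' / 35 = c"
  proof -
    have "\<rho> * \<rho> = 35 / 2 * \<bar>c\<bar>" by (simp add: \<rho>_def algebra_simps flip: real_sqrt_mult)
    then have "2 * (\<rho> * \<rho>) * sgn c / 35 = \<bar>c\<bar> * sgn c" by simp
    then show ?thesis by (simp add: \<rho>'_def abs_mult_sgn algebra_simps)
  qed
  let ?q1 = "\<lambda>t::real. t - 3 * t^2 + 2 * t^3" and ?q2 = "\<lambda>t::real. t - 6 * t^2 + 10 * t^3 - 5 * t^4"
  let ?q1' = "\<lambda>t::real. 1 - 6 * t + 6 * t^2" and ?q2' = "\<lambda>t::real. 1 - 12 * t + 30 * t^2 - 20 * t^3"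
  let ?Q1 = "\<lambda>t::real. t^2 / 2 - t^3 + t^4 / 2" and ?Q2 = "\<lambda>t::real. t^2 / 2 - 2 * t^3 + 5 / 2 * t^4 - t^5"
  let ?W = "\<lambda>t::real. - (t^3) + 4 * t^4 - 33 / 5 * t^5 + 5 * t^6 - 10 / 7 * t^7"
  define P where "P = (\<lambda>t. hproj x + (t *\<^sub>R v + ((\<rho> * ?q1 t) *\<^sub>R e + (\<rho>' * ?q2 t) *\<^sub>R f)))"
  define P' where "P' = (\<lambda>t. v + ((\<rho> * ?q1' t) *\<^sub>R e + (\<rho>' * ?q2' t) *\<^sub>R f))"
  define z where "z = (\<lambda>t. snd (snd x)
      - 2 * (t * sympl (hproj x) v + \<rho> * ?q1 t * sympl (hproj x) e + \<rho>' * ?q2 t * sympl (hproj x) f)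
      - 2 * (\<rho> * sympl v e * (t * ?q1 t - 2 * ?Q1 t) + \<rho>' * sympl v f * (t * ?q2 t - 2 * ?Q2 t) + \<rho> * \<rho>' * ?W t))"
  define \<gamma> where "\<gamma> = (\<lambda>t. (fst (P t), snd (P t), z t))"
  have P_deriv: "(P has_vector_derivative P' t) (at t within T)" for t T
    unfolding P_def P'_def
    by (rule derivative_eq_intros refl | simp)+ (simp add: algebra_simps)
  have z_deriv: "(z has_real_derivative - 2 * sympl (P t) (P' t)) (at t within T)" for t T
    unfolding z_def P_def P'_def
    apply (rule derivative_eq_intros refl | simp)+
    apply (simp add: sympl_simps ef sympl_antisym[of e v] sympl_antisym[of f v])
    apply (simp add: algebra_simps power2_eq_square power3_eq_cube power4_eq_xxxx eval_nat_numeral)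
    done
  have \<gamma>_deriv: "(\<gamma> has_vector_derivative hfield (P' t) (\<gamma> t)) (at t within {0..1})" for t
    unfolding \<gamma>_def by (rule curve_lift_derivative[OF P_deriv z_deriv])
  have speed: "norm (P' t) \<le> norm v + 76 * \<rho>" if t: "t \<in> {0..1}" for t
  proof -
    have pw: "0 \<le> t ^ n" "t ^ n \<le> 1" for n using t by (auto simp: power_le_one)
    have t01: "0 \<le> t" "t \<le> 1" using t by auto
    have q: "\<bar>?q1' t\<bar> \<le> 13" "\<bar>?q2' t\<bar> \<le> 63"
      using t01 pw(1)[of 2] pw(2)[of 2] pw(1)[of 3] pw(2)[of 3] by linarith+
    have "norm (P' t) \<le> norm v + (norm ((\<rho> * ?q1' t) *\<^sub>R e) + norm ((\<rho>' * ?q2' t) *\<^sub>R f))"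
      unfolding P'_def by (intro norm_triangle_mono order_refl)
    also have "\<dots> = norm v + (\<rho> * \<bar>?q1' t\<bar> + \<bar>\<rho>'\<bar> * \<bar>?q2' t\<bar>)"
      using \<rho> by (simp add: norms abs_mult)
    also have "\<dots> \<le> norm v + (\<rho> * 13 + \<rho> * 63)"
      using \<rho> q by (intro add_left_mono add_mono mult_mono) auto
    finally show ?thesis by simp
  qed
  have "\<gamma> 0 = x"
    by (rule heis_eqI) (simp_all add: \<gamma>_def P_def z_def)
  moreover have "\<gamma> 1 = y"
  proof (rule heis_eqI)
    show "hproj (\<gamma> 1) = hproj y" by (simp add: \<gamma>_def P_def v_def)
    have "snd (snd (\<gamma> 1)) = snd (snd x) - 2 * sympl (hproj x) v + 2 * \<rho> * \<rho>' / 35"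
      by (simp add: \<gamma>_def z_def)
    also have "\<dots> = snd (snd y)"
      unfolding \<rho>\<rho>' by (simp add: c_def v_def vdisp_def sympl_simps)
    finally show "snd (snd (\<gamma> 1)) = snd (snd y)" .
  qed
  ultimately show ?thesis
    using smooth_curve_horizontal[of \<gamma> P' "norm v + 76 * \<rho>", OF \<gamma>_deriv speed]
    by (intro exI[of _ \<gamma>]) (auto simp: v_def \<rho>_def c_def)
qed

lemma cc_dist_upper:
  "\<exists>C\<ge>1. \<forall>x y :: 'n::finite heis. cc_dist x y \<le> norm (hproj y - hproj x) + C * sqrt \<bar>vdisp x y\<bar>"
proof (intro exI[of _ "76 * sqrt (35 / 2)"] conjI allI)
  have "(1::real) \<le> sqrt (35 / 2)" by simp
  then show "1 \<le> 76 * sqrt (35 / 2)" by linarith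
  show "cc_dist x y \<le> norm (hproj y - hproj x) + 76 * sqrt (35 / 2) * sqrt \<bar>vdisp x y\<bar>" for x y :: "'n heis"
    using cc_dist_upper_curve[of x y] by blast
qed

lemma cc_dist_greatest:
  fixes x y :: "'n::finite heis"
  assumes "\<And>a b \<gamma>. a \<le> b \<Longrightarrow> horizontal_curve_on {a..b} \<gamma> \<Longrightarrow> \<gamma> a = x \<Longrightarrow> \<gamma> b = y \<Longrightarrow> r \<le> hlength {a..b} \<gamma>"
  shows "r \<le> cc_dist x y"
  unfolding cc_dist_def
proof (rule cInf_greatest)
  obtain \<gamma> where "horizontal_curve_on {0..1} \<gamma>" "\<gamma> 0 = x" "\<gamma> 1 = y"
    using cc_dist_upper_curve[of x y] by blast
  moreover have "(0::real) \<le> 1" by simp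
  ultimately show "{hlength {a..b} \<gamma> |a b \<gamma>. a \<le> b \<and> horizontal_curve_on {a..b} \<gamma> \<and> \<gamma> a = x \<and> \<gamma> b = y} \<noteq> {}"
    by blast
qed (use assms in blast)

lemma cc_dist_nonneg: "0 \<le> cc_dist x y"
  by (rule cc_dist_greatest) (rule hlength_nonneg)

lemma hproj_le_cc_dist: "norm (hproj y - hproj x) \<le> cc_dist x y"
  by (rule cc_dist_greatest) (use horizontal_curve_lower_bounds(1) in blast)

lemma vdisp_le_cc_dist: "\<bar>vdisp x y\<bar> \<le> 2 * (cc_dist x y)\<^sup>2"
proof -
  have "sqrt (\<bar>vdisp x y\<bar> / 2) \<le> cc_dist x y"
  proof (rule cc_dist_greatest)
    fix a b \<gamma> assume *: "a \<le> b" "horizontal_curve_on {a..b} \<gamma>" "\<gamma> a = x" "\<gamma> b = y"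
    have "\<bar>vdisp x y\<bar> / 2 \<le> (hlength {a..b} \<gamma>)\<^sup>2"
      using horizontal_curve_lower_bounds(2)[OF *(1,2)] *(3,4) by simp
    then show "sqrt (\<bar>vdisp x y\<bar> / 2) \<le> hlength {a..b} \<gamma>"
      by (rule real_le_lsqrt[OF hlength_nonneg])
  qed
  then have "(sqrt (\<bar>vdisp x y\<bar> / 2))\<^sup>2 \<le> (cc_dist x y)\<^sup>2" by (intro power_mono) auto
  then show ?thesis by simp
qed

lemma Lip_H_bound:
  assumes "hLipschitz f"
  shows "0 \<le> Lip_H f" "\<bar>f x - f y\<bar> \<le> Lip_H f * cc_dist x y"
proof -
  have ne: "hLipschitz_bounds f \<noteq> {}" using assms by (simp add: hLipschitz_def)
  show "0 \<le> Lip_H f" unfolding Lip_H_def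
    by (rule cInf_greatest[OF ne]) (simp add: hLipschitz_bounds_def)
  show "\<bar>f x - f y\<bar> \<le> Lip_H f * cc_dist x y"
  proof (cases "cc_dist x y = 0")
    case True
    obtain K where "K \<in> hLipschitz_bounds f" using ne by blast
    then have "\<bar>f x - f y\<bar> \<le> K * cc_dist x y" unfolding hLipschitz_bounds_def by blast
    then show ?thesis using True by simp
  next
    case False
    then have pos: "0 < cc_dist x y" using cc_dist_nonneg[of x y] by simp
    have "\<bar>f x - f y\<bar> / cc_dist x y \<le> Lip_H f" unfolding Lip_H_def
    proof (rule cInf_greatest[OF ne])
      fix K assume "K \<in> hLipschitz_bounds f"
      then have "\<bar>f x - f y\<bar> \<le> K * cc_dist x y" unfolding hLipschitz_bounds_def by blast
      then show "\<bar>f x - f y\<bar> / cc_dist x y \<le> K" using pos by (simp add: divide_le_eq)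
    qed
    then show ?thesis using pos by (simp add: divide_le_eq)
  qed
qed

section \<open>Directional derivatives along lines\<close>

lemma cc_dist_hline: "cc_dist (hline q u s) (hline q u t) \<le> \<bar>t - s\<bar> * norm u"
proof -
  obtain C where "1 \<le> C" and C: "\<And>x y. cc_dist (x :: 'a heis) y \<le> norm (hproj y - hproj x) + C * sqrt \<bar>vdisp x y\<bar>"
    using cc_dist_upper by blast
  have "hproj (hline q u t) - hproj (hline q u s) = (t - s) *\<^sub>R u" by (simp add: algebra_simps)
  then show ?thesis using C[of "hline q u s" "hline q u t"] vdisp_along_hline[of q u s t] by simp
qed

lemma hline_has_vector_derivative:
  "(hline q u has_vector_derivative hfield u (hline q u t)) (at t within T)"
proof -
  have "hfield u (hline q u t) = hfield u q" by (simp add: hfield_eq sympl_simps)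
  then show ?thesis unfolding hline_def by (auto intro!: derivative_eq_intros)
qed

lemma horizontal_curve_hline:
  assumes "is_interval I"
  shows "horizontal_curve_on I (hline q u)"
  unfolding horizontal_curve_on_def
proof (intro conjI exI)
  show "abs_cont_curve_on I (hline q u)"
  proof (rule abs_cont_curve_on_lipschitz)
    have "hline q u t - hline q u s = (t - s) *\<^sub>R hfield u q" for s t
      by (simp add: hline_def algebra_simps)
    then show "norm (hline q u t - hline q u s) \<le> norm (hfield u q) * \<bar>t - s\<bar>" for s t
      by simp
  qed simp
  show "horizontal_coeffs I (hline q u) (\<lambda>t. u)"
    unfolding horizontal_coeffs_def by (intro AE_I2 impI hline_has_vector_derivative)
qed (rule assms)

lemma hLipschitz_curve_hline: "hLipschitz_curve_on I (hline q u)"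
  unfolding hLipschitz_curve_on_def
  using cc_dist_hline[of q u] by (intro exI[of _ "norm u"]) (auto simp: mult.commute abs_minus_commute)

text \<open>
  Cut the interval into \<open>n\<close> equal parts and let \<open>n\<close> tend to infinity.
\<close>

lemma quadratic_increments_bound:
  fixes v :: "real \<Rightarrow> real"
  assumes inc: "\<And>s s'. a \<le> s \<Longrightarrow> s \<le> s' \<Longrightarrow> s' \<le> b \<Longrightarrow> \<bar>v s' - v s\<bar> \<le> A * (s' - s) + C * (s' - s)\<^sup>2"
    and ab: "a \<le> b"
  shows "\<bar>v b - v a\<bar> \<le> A * (b - a)"
proof -
  have step: "\<bar>v b - v a\<bar> \<le> A * (b - a) + C * (b - a)\<^sup>2 * inverse (real (Suc n))" for n
  proof -
    define \<delta> where "\<delta> = (b - a) / real (Suc n)"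
    have \<delta>: "0 \<le> \<delta>" "real (Suc n) * \<delta> = b - a" using ab by (simp_all add: \<delta>_def)
    have "\<bar>v (a + real i * \<delta>) - v a\<bar> \<le> real i * (A * \<delta> + C * \<delta>\<^sup>2)" if "i \<le> Suc n" for i
      using that
    proof (induction i)
      case (Suc i)
      have "a + real (Suc i) * \<delta> \<le> b"
        using mult_right_mono[of "real (Suc i)" "real (Suc n)" \<delta>] Suc.prems \<delta> by linarith
      then have "\<bar>v (a + real (Suc i) * \<delta>) - v (a + real i * \<delta>)\<bar> \<le> A * \<delta> + C * \<delta>\<^sup>2"
        using inc[of "a + real i * \<delta>" "a + real (Suc i) * \<delta>"] \<delta>(1) by (simp add: algebra_simps)
      then show ?case using Suc by (simp add: algebra_simps)
    qed simp
    from this[of "Suc n"] have "\<bar>v b - v a\<bar> \<le> real (Suc n) * (A * \<delta> + C * \<delta>\<^sup>2)"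
      by (simp only: \<delta>(2) order_refl) simp
    also have "\<dots> = A * (real (Suc n) * \<delta>) + C * ((real (Suc n) * \<delta>) * \<delta>)"
      by (simp add: algebra_simps power2_eq_square)
    also have "\<dots> = A * (b - a) + C * (b - a)\<^sup>2 * inverse (real (Suc n))"
      unfolding \<delta>(2) by (simp add: \<delta>_def power2_eq_square divide_inverse mult_ac del: of_nat_Suc)
    finally show ?thesis .
  qed
  have "(\<lambda>n. A * (b - a) + C * (b - a)\<^sup>2 * inverse (real (Suc n))) \<longlonglongrightarrow> A * (b - a) + C * (b - a)\<^sup>2 * 0"
    by (intro tendsto_intros LIMSEQ_inverse_real_of_nat)
  then show ?thesis using step by (intro LIMSEQ_le_const) auto
qed

text \<open>
  The vertical deviation from the tangent line is \<open>o(s\<^sup>2)\<close>, although the curve has only a first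
  derivative at \<open>t\<close>: vertical displacements over a time \<open>\<delta>\<close> are \<open>O(\<delta>\<^sup>2)\<close> on a Lipschitz curve, hence
  the deviation grows at a rate proportional to the horizontal deviation, which is \<open>o(s)\<close>.
\<close>

lemma lipschitz_curve_near_tangent_line:
  fixes \<gamma> :: "real \<Rightarrow> 'n::finite heis"
  assumes lip: "hLipschitz_curve_on I \<gamma>" and t: "t \<in> interior I"
    and deriv: "(\<gamma> has_vector_derivative hfield u (\<gamma> t)) (at t)" and \<epsilon>: "0 < \<epsilon>"
  shows "\<forall>\<^sub>F s in at 0. norm (hproj (\<gamma> (t + s)) - hproj (hline (\<gamma> t) u s)) \<le> \<epsilon> * \<bar>s\<bar> \<and>
      \<bar>vdisp (hline (\<gamma> t) u s) (\<gamma> (t + s))\<bar> \<le> \<epsilon> * s\<^sup>2"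
proof -
  obtain K where K: "0 \<le> K" "\<And>s s'. s \<in> I \<Longrightarrow> s' \<in> I \<Longrightarrow> cc_dist (\<gamma> s) (\<gamma> s') \<le> K * \<bar>s - s'\<bar>"
    using lip unfolding hLipschitz_curve_on_def by blast
  obtain r where r: "0 < r" "ball t r \<subseteq> I" using t by (meson mem_interior)
  define \<epsilon>' where "\<epsilon>' = min \<epsilon> (\<epsilon> / (2 * (K + norm u + 1)))"
  have \<epsilon>': "0 < \<epsilon>'" "\<epsilon>' \<le> \<epsilon>" "2 * \<epsilon>' * (K + norm u) \<le> \<epsilon>"
  proof -
    have d: "0 < 2 * (K + norm u + 1)" using K(1) by (simp add: add_nonneg_pos)
    then show "0 < \<epsilon>'" "\<epsilon>' \<le> \<epsilon>" using \<epsilon> by (auto simp: \<epsilon>'_def)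
    have "\<epsilon>' \<le> \<epsilon> / (2 * (K + norm u + 1))" by (simp add: \<epsilon>'_def)
    then have "\<epsilon>' * (2 * (K + norm u + 1)) \<le> \<epsilon>" by (simp only: pos_le_divide_eq[OF d])
    moreover have "0 < \<epsilon>'" using \<epsilon> d by (auto simp: \<epsilon>'_def)
    ultimately show "2 * \<epsilon>' * (K + norm u) \<le> \<epsilon>" by (simp add: algebra_simps)
  qed
  define d where "d = (\<lambda>s. hproj (\<gamma> (t + s)) - hproj (hline (\<gamma> t) u s))"
  have "((\<lambda>s. hproj (\<gamma> s)) has_vector_derivative u) (at t)"
    using bounded_linear.has_vector_derivative[OF bounded_linear_hproj deriv] by simp
  then obtain r' where r': "0 < r'" "\<And>s. \<bar>s - t\<bar> < r' \<Longrightarrow>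
      norm (hproj (\<gamma> s) - hproj (\<gamma> t) - (s - t) *\<^sub>R u) \<le> \<epsilon>' * \<bar>s - t\<bar>"
    unfolding has_vector_derivative_def has_derivative_within_alt using \<epsilon>'(1) by auto
  have d_le: "norm (d s) \<le> \<epsilon>' * \<bar>s\<bar>" if "\<bar>s\<bar> < r'" for s
    using r'(2)[of "t + s"] that by (simp add: d_def algebra_simps)
  define V where "V = (\<lambda>s. vdisp (hline (\<gamma> t) u s) (\<gamma> (t + s)))"
  have "norm (d s) \<le> \<epsilon> * \<bar>s\<bar> \<and> \<bar>V s\<bar> \<le> \<epsilon> * s\<^sup>2" if s: "\<bar>s\<bar> < min r r'" for s
  proof
    show "norm (d s) \<le> \<epsilon> * \<bar>s\<bar>"
      using d_le[of s] s mult_right_mono[OF \<epsilon>'(2), of "\<bar>s\<bar>"] by simp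
    define a where "a = min 0 s"
    define b where "b = max 0 s"
    have "\<bar>V b - V a\<bar> \<le> (2 * \<epsilon>' * \<bar>s\<bar> * (K + norm u)) * (b - a)"
    proof (rule quadratic_increments_bound[where C="2 * K\<^sup>2"])
      fix s1 s2 assume s12: "a \<le> s1" "s1 \<le> s2" "s2 \<le> b"
      then have abs12: "\<bar>s1\<bar> \<le> \<bar>s\<bar>" "\<bar>s2\<bar> \<le> \<bar>s\<bar>" by (auto simp: a_def b_def)
      let ?G1 = "\<gamma> (t + s1)" and ?G2 = "\<gamma> (t + s2)" and ?X1 = "hline (\<gamma> t) u s1" and ?X2 = "hline (\<gamma> t) u s2"
      have in_I: "t + s1 \<in> I" "t + s2 \<in> I"
        using abs12 s r(2) by (auto simp: subset_iff dist_real_def)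
      have cc: "cc_dist ?G1 ?G2 \<le> K * (s2 - s1)"
        using K(2)[OF in_I] s12(2) by simp
      have small_d: "norm (d s1) \<le> \<epsilon>' * \<bar>s\<bar>" "norm (d s2) \<le> \<epsilon>' * \<bar>s\<bar>"
        using d_le[of s1] d_le[of s2] abs12 s \<epsilon>'(1) by (smt (verit) mult_left_mono)+
      have "vdisp ?X1 ?G2 = V s1 + vdisp ?G1 ?G2 - 2 * sympl (d s1) (hproj ?G2 - hproj ?G1)"
        unfolding V_def d_def by (rule vdisp_chain)
      moreover have "vdisp ?X1 ?G2 = V s2 - 2 * sympl ((s2 - s1) *\<^sub>R u) (d s2)"
        using vdisp_chain[of ?X1 ?G2 ?X2] vdisp_along_hline[of "\<gamma> t" u s1 s2]
        by (simp add: V_def d_def algebra_simps)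
      ultimately have "V s2 - V s1 = vdisp ?G1 ?G2 - 2 * sympl (d s1) (hproj ?G2 - hproj ?G1)
          + 2 * ((s2 - s1) * sympl u (d s2))"
        by (simp add: sympl.scaleR_left)
      moreover have "\<bar>vdisp ?G1 ?G2\<bar> \<le> 2 * (K * (s2 - s1))\<^sup>2"
        using vdisp_le_cc_dist[of ?G1 ?G2] power_mono[OF cc cc_dist_nonneg, of 2] by linarith
      moreover have "\<bar>sympl (d s1) (hproj ?G2 - hproj ?G1)\<bar> \<le> \<epsilon>' * \<bar>s\<bar> * (K * (s2 - s1))"
      proof (rule order_trans[OF abs_sympl_le mult_mono])
        show "norm (hproj ?G2 - hproj ?G1) \<le> K * (s2 - s1)" using hproj_le_cc_dist cc by (rule order_trans)
      qed (use small_d \<epsilon>'(1) in auto)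
      moreover have "\<bar>(s2 - s1) * sympl u (d s2)\<bar> \<le> (s2 - s1) * (norm u * (\<epsilon>' * \<bar>s\<bar>))"
        unfolding abs_mult using s12(2) small_d
        by (intro mult_mono order_trans[OF abs_sympl_le] mult_left_mono) auto
      ultimately have "\<bar>V s2 - V s1\<bar> \<le> 2 * (K * (s2 - s1))\<^sup>2 + 2 * (\<epsilon>' * \<bar>s\<bar> * (K * (s2 - s1)))
          + 2 * ((s2 - s1) * (norm u * (\<epsilon>' * \<bar>s\<bar>)))" by linarith
      then show "\<bar>V s2 - V s1\<bar> \<le> 2 * \<epsilon>' * \<bar>s\<bar> * (K + norm u) * (s2 - s1) + 2 * K\<^sup>2 * (s2 - s1)\<^sup>2"
        unfolding power_mult_distrib by (simp add: algebra_simps)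
    qed (simp add: a_def b_def)
    moreover have "V 0 = 0" by (simp add: V_def)
    moreover have "b - a = \<bar>s\<bar>" by (simp add: a_def b_def)
    ultimately have "\<bar>V s\<bar> \<le> (2 * \<epsilon>' * \<bar>s\<bar> * (K + norm u)) * \<bar>s\<bar>"
      by (cases "s \<ge> 0") (auto simp: a_def b_def min_def max_def)
    also have "\<dots> = (2 * \<epsilon>' * (K + norm u)) * (\<bar>s\<bar> * \<bar>s\<bar>)" by (simp only: mult_ac)
    also have "\<dots> = (2 * \<epsilon>' * (K + norm u)) * s\<^sup>2" by (simp add: power2_eq_square)
    also have "\<dots> \<le> \<epsilon> * s\<^sup>2" using \<epsilon>'(3) by (intro mult_right_mono) auto
    finally show "\<bar>V s\<bar> \<le> \<epsilon> * s\<^sup>2" .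
  qed
  then show ?thesis
    unfolding eventually_at d_def V_def using r(1) r'(1)
    by (intro exI[of _ "min r r'"]) auto
qed

text \<open>
  Lipschitz curves with a common velocity at a point separate at distance \<open>o(s)\<close> only, so the straight
  line decides for all of them.
\<close>

lemma has_hderiv_iff_line:
  fixes f :: "'n::finite heis \<Rightarrow> real"
  assumes f: "hLipschitz f"
  shows "has_hderiv f (hfield u) x D \<longleftrightarrow> ((\<lambda>s. f (hline x u s)) has_real_derivative D) (at 0)"
proof
  assume "has_hderiv f (hfield u) x D"
  then have "((f \<circ> hline x u) has_real_derivative D) (at 0)"
    unfolding has_hderiv_def
    using horizontal_curve_hline[of UNIV x u] hLipschitz_curve_hline[of UNIV x u]
      hline_has_vector_derivative[of x u 0 UNIV] by (auto simp: is_interval_univ)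
  then show "((\<lambda>s. f (hline x u s)) has_real_derivative D) (at 0)" by (simp add: o_def)
next
  assume line: "((\<lambda>s. f (hline x u s)) has_real_derivative D) (at 0)"
  obtain C where "1 \<le> C" and C: "\<And>x y. cc_dist (x :: 'n heis) y \<le> norm (hproj y - hproj x) + C * sqrt \<bar>vdisp x y\<bar>"
    using cc_dist_upper by blast
  show "has_hderiv f (hfield u) x D"
    unfolding has_hderiv_def
  proof (intro allI impI)
    fix I \<gamma> t assume \<gamma>: "horizontal_curve_on I \<gamma>" "hLipschitz_curve_on I \<gamma>" "t \<in> interior I" "\<gamma> t = x"
      "(\<gamma> has_vector_derivative hfield u x) (at t)"
    have "((\<lambda>s. (f (\<gamma> (t + s)) - f (hline x u s)) / s) \<longlongrightarrow> 0) (at 0)"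
    proof (rule tendstoI)
      fix e :: real assume e: "0 < e"
      define lam where "lam = Lip_H f + 1"
      have lam: "0 < lam" using Lip_H_bound(1)[OF f] by (simp add: lam_def)
      define \<eta> where "\<eta> = e / (2 * lam * (1 + C))"
      have pos: "0 < 2 * lam * (1 + C)" using lam \<open>1 \<le> C\<close> by (intro mult_pos_pos) auto
      have \<eta>: "0 < \<eta>" "lam * (\<eta> * (1 + C)) < e"
      proof -
        show "0 < \<eta>" using e pos by (simp only: \<eta>_def divide_pos_pos)
        have "\<eta> * (2 * lam * (1 + C)) = e" unfolding \<eta>_def by (rule nonzero_divide_eq_eq[THEN iffD1, OF _ refl, symmetric]) (use pos in linarith)
        then have "2 * (lam * (\<eta> * (1 + C))) = e" by (simp only: mult_ac)
        then show "lam * (\<eta> * (1 + C)) < e" using e by linarith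
      qed
      have "\<forall>\<^sub>F s in at 0. norm (hproj (\<gamma> (t + s)) - hproj (hline x u s)) \<le> min \<eta> (\<eta>\<^sup>2) * \<bar>s\<bar> \<and>
          \<bar>vdisp (hline x u s) (\<gamma> (t + s))\<bar> \<le> min \<eta> (\<eta>\<^sup>2) * s\<^sup>2"
        using lipschitz_curve_near_tangent_line[OF \<gamma>(2,3), of u "min \<eta> (\<eta>\<^sup>2)"] \<gamma>(4,5) \<eta>(1) by simp
      moreover have "\<forall>\<^sub>F s in at (0::real). s \<noteq> 0" by (simp add: eventually_at_filter)
      ultimately show "\<forall>\<^sub>F s in at 0. dist ((f (\<gamma> (t + s)) - f (hline x u s)) / s) 0 < e"
      proof eventually_elim
        case (elim s)
        have "norm (hproj (\<gamma> (t + s)) - hproj (hline x u s)) \<le> \<eta> * \<bar>s\<bar>"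
          using elim(1) mult_right_mono[OF min.cobounded1[of \<eta> "\<eta>\<^sup>2"], of "\<bar>s\<bar>"] by linarith
        moreover have "sqrt \<bar>vdisp (hline x u s) (\<gamma> (t + s))\<bar> \<le> \<eta> * \<bar>s\<bar>"
        proof (rule real_le_lsqrt)
          show "\<bar>vdisp (hline x u s) (\<gamma> (t + s))\<bar> \<le> (\<eta> * \<bar>s\<bar>)\<^sup>2"
            using elim(1) mult_right_mono[OF min.cobounded2[of \<eta> "\<eta>\<^sup>2"], of "s\<^sup>2"]
            by (simp add: power_mult_distrib)
        qed (use \<eta> in simp)
        ultimately have "cc_dist (hline x u s) (\<gamma> (t + s)) \<le> \<eta> * \<bar>s\<bar> + C * (\<eta> * \<bar>s\<bar>)"
          using C[of "hline x u s" "\<gamma> (t + s)"] \<open>1 \<le> C\<close> by (smt (verit) mult_left_mono)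
        also have "\<dots> = \<eta> * (1 + C) * \<bar>s\<bar>" by (simp add: algebra_simps)
        finally have cc: "cc_dist (hline x u s) (\<gamma> (t + s)) \<le> \<eta> * (1 + C) * \<bar>s\<bar>" .
        have "\<bar>f (hline x u s) - f (\<gamma> (t + s))\<bar> \<le> Lip_H f * cc_dist (hline x u s) (\<gamma> (t + s))"
          by (rule Lip_H_bound(2)[OF f])
        also have "\<dots> \<le> lam * (\<eta> * (1 + C) * \<bar>s\<bar>)"
          using cc lam cc_dist_nonneg[of "hline x u s" "\<gamma> (t + s)"] by (intro mult_mono) (simp_all add: lam_def)
        also have "\<dots> < e * \<bar>s\<bar>" using \<eta>(2) elim(2) by (simp add: mult.assoc[symmetric])
        finally show ?case using elim(2) by (simp add: abs_minus_commute divide_less_eq)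
      qed
    qed
    moreover have "((\<lambda>s. (f (hline x u s) - f x) / s) \<longlongrightarrow> D) (at 0)"
      using line by (simp add: DERIV_def)
    ultimately have "((\<lambda>s. (f (\<gamma> (t + s)) - f (hline x u s)) / s + (f (hline x u s) - f x) / s) \<longlongrightarrow> 0 + D) (at 0)"
      by (rule tendsto_add)
    moreover have "(f (\<gamma> (t + s)) - f (hline x u s)) / s + (f (hline x u s) - f x) / s = ((f \<circ> \<gamma>) (t + s) - (f \<circ> \<gamma>) t) / s" for s
      using \<gamma>(4) by (simp add: diff_divide_distrib)
    ultimately show "((f \<circ> \<gamma>) has_real_derivative D) (at t)"
      by (simp add: DERIV_def)
  qed
qed

lemma has_hderiv_unique:
  assumes "hLipschitz f" "has_hderiv f (hfield u) x D" "has_hderiv f (hfield u) x D'"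
  shows "D = D'"
  using assms DERIV_unique by (auto simp: has_hderiv_iff_line)

lemma hderiv_eqI:
  assumes "hLipschitz f" "has_hderiv f (hfield u) x D"
  shows "hderiv f (hfield u) x = D"
  unfolding hderiv_def using assms has_hderiv_unique by (intro the_equality) blast+

lemma omega_hfield: "omega (hfield u) = norm u"
proof -
  have "u = h" if "hfield u = hfield h" for h
    using that by (metis hproj_hfield)
  moreover have "\<exists>h. hfield u = hfield h \<and> norm u = norm h" by blast
  ultimately show ?thesis unfolding omega_def by (intro the_equality) blast+
qed

section \<open>Broken lines through rational points\<close>

definition rational_hvec :: "'n::finite hvec \<Rightarrow> bool" where
  "rational_hvec v \<longleftrightarrow> (\<forall>i. fst v $ i \<in> \<rat>) \<and> (\<forall>i. snd v $ i \<in> \<rat>)"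

lemma rational_points_iff: "x \<in> rational_points \<longleftrightarrow> rational_hvec (hproj x) \<and> snd (snd x) \<in> \<rat>"
  by (cases x) (auto simp: rational_points_def rational_hvec_def)

lemma rational_hvec_add: "rational_hvec u \<Longrightarrow> rational_hvec v \<Longrightarrow> rational_hvec (u + v)"
  and rational_hvec_diff: "rational_hvec u \<Longrightarrow> rational_hvec v \<Longrightarrow> rational_hvec (u - v)"
  and rational_hvec_scaleR: "r \<in> \<rat> \<Longrightarrow> rational_hvec v \<Longrightarrow> rational_hvec (r *\<^sub>R v)"
  and rational_hvec_hrot: "rational_hvec v \<Longrightarrow> rational_hvec (hrot v)"
  by (auto simp: rational_hvec_def hrot_def)

lemma rational_inner:
  fixes a b :: "real^'n::finite"
  assumes "\<forall>i. a $ i \<in> \<rat>" "\<forall>i. b $ i \<in> \<rat>"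
  shows "a \<bullet> b \<in> \<rat>"
  using assms by (auto simp: inner_vec_def intro!: Rats_sum)

lemma rational_sympl: "rational_hvec u \<Longrightarrow> rational_hvec v \<Longrightarrow> sympl u v \<in> \<rat>"
  by (auto simp: rational_hvec_def sympl_def intro!: Rats_diff rational_inner)

lemma rational_norm_square: "rational_hvec v \<Longrightarrow> (norm v)\<^sup>2 \<in> \<rat>"
  by (auto simp: rational_hvec_def power2_norm_eq_inner inner_prod_def intro!: Rats_add rational_inner)

lemma rational_points_approx:
  fixes x :: "'n::finite heis"
  shows "\<exists>X. (\<forall>n. X n \<in> rational_points) \<and> X \<longlonglongrightarrow> x"
proof -
  have "(\<Union>f \<in> Basis \<rightarrow> \<rat>. { \<Sum>i :: 'n heis \<in> Basis. f i *\<^sub>R i }) \<subseteq> rational_points"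
  proof
    fix z :: "'n heis" assume "z \<in> (\<Union>f \<in> Basis \<rightarrow> \<rat>. { \<Sum>i \<in> Basis. f i *\<^sub>R i })"
    then obtain f where f: "f \<in> Basis \<rightarrow> \<rat>" and z_def: "z = (\<Sum>i\<in>Basis. f i *\<^sub>R i)" by auto
    have z: "z \<bullet> b \<in> \<rat>" if "b \<in> Basis" for b
      using that f by (auto simp: z_def)
    have "fst z $ i = z \<bullet> (axis i 1, 0, 0)" "fst (snd z) $ i = z \<bullet> (0, axis i 1, 0)" "snd (snd z) = z \<bullet> (0, 0, 1)" for i
      by (simp_all add: inner_prod_def inner_axis)
    moreover have "axis i 1 \<in> (Basis :: (real^'n) set)" for i
      by (auto simp: Basis_vec_def)
    then have "(axis i 1, 0, 0) \<in> (Basis :: 'n heis set)" "(0, axis i 1, 0) \<in> (Basis :: 'n heis set)"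
      "(0, 0, 1) \<in> (Basis :: 'n heis set)" for i
      unfolding Basis_prod_def zero_prod_def by (blast, blast, simp)
    ultimately show "z \<in> rational_points"
      using z by (simp add: rational_points_iff rational_hvec_def hproj_eq)
  qed
  then have "closure rational_points = (UNIV :: 'n heis set)"
    using closure_mono closure_rational_coordinates[where 'a="'n heis"] by blast
  then have "x \<in> closure rational_points" by simp
  then show ?thesis by (simp only: closure_sequential)
qed

lemma hfield_scaleR: "hfield (r *\<^sub>R u) q = r *\<^sub>R hfield u q"
  by (simp add: hfield_eq sympl_simps)

lemma rational_line_subset:
  assumes N: "contains_rational_horizontal_lines N" and q: "q \<in> rational_points"
    and q': "hline q u T \<in> rational_points" and "u \<noteq> 0" "T \<noteq> 0"
  shows "hline q u t \<in> N"
proof -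
  let ?q' = "hline q u T"
  have line: "q + s *\<^sub>R (?q' - q) = hline q u (s * T)" for s
    by (simp add: hline_def)
  have line': "hline q u (s * T) = hline q (T *\<^sub>R u) s" for s
    by (simp add: hline_def hfield_scaleR)
  have "hproj ?q' \<noteq> hproj q" using assms(4,5) by simp
  then have "q \<noteq> ?q'" by metis
  moreover have "horizontal_curve_on UNIV (\<lambda>s. q + s *\<^sub>R (?q' - q))"
    unfolding line line' by (rule horizontal_curve_hline[OF is_interval_univ])
  ultimately have "range (\<lambda>s. q + s *\<^sub>R (?q' - q)) \<subseteq> N"
    using N q q' unfolding contains_rational_horizontal_lines_def by blast
  then have "hline q u ((t / T) * T) \<in> N" unfolding line by blast
  then show ?thesis using assms(5) by simp
qed

text \<open>Bounds the deviation from \<open>h\<close> of the velocities of the two-segment join from \<open>A\<close> to \<open>Y\<close> in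
  time \<open>T\<close>: the deviation of the mean velocity, plus that of either segment from the mean.\<close>

definition join_tilt :: "'n::finite hvec \<Rightarrow> real \<Rightarrow> 'n heis \<Rightarrow> 'n heis \<Rightarrow> real" where
  "join_tilt h T A Y =
     norm ((1 / T) *\<^sub>R (hproj Y - hproj A) - h) + \<bar>vdisp A Y\<bar> / (T * norm (hproj Y - hproj A))"

definition join_speed_square :: "real \<Rightarrow> 'n::finite heis \<Rightarrow> 'n heis \<Rightarrow> real" where
  "join_speed_square T A Y =
     (norm (hproj Y - hproj A) / T)\<^sup>2 + (vdisp A Y / (T * norm (hproj Y - hproj A)))\<^sup>2"

text \<open>
  The velocities are \<open>(P + w)/T\<close> and \<open>(P - w)/T\<close> with \<open>w\<close> the multiple of \<open>hrot P\<close> for which the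
  triangle encloses the prescribed area. The displacement along either segment does not depend on
  \<open>T\<close> and is a rational expression in the endpoints. Since \<open>w\<close> is orthogonal to \<open>P\<close>, it enters the
  speed only through its square.
\<close>

lemma rational_two_segment_join:
  fixes A Y :: "'n::finite heis"
  assumes A: "A \<in> rational_points" and Y: "Y \<in> rational_points" and T: "0 < T"
    and ne: "hproj Y \<noteq> hproj A"

  obtains u1 u2 where "hline A u1 (T / 2) \<in> rational_points" "hline (hline A u1 (T / 2)) u2 (T / 2) = Y"
    "\<And>u h. u \<in> {u1, u2} \<Longrightarrow> norm (u - h) \<le> join_tilt h T A Y"
    "\<And>u. u \<in> {u1, u2} \<Longrightarrow> (norm u)\<^sup>2 = join_speed_square T A Y"
proof -
  define P where "P = hproj Y - hproj A"
  define c where "c = vdisp A Y"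
  have P0: "0 < norm P" using ne by (simp add: P_def)
  \<comment> \<open>By \<open>sympl_hrot_self\<close>, this is the multiple with \<open>sympl P w
    = c\<close>.\<close>
  define w where "w = (- (c / (norm P)\<^sup>2)) *\<^sub>R hrot P"
  define u where "u = (\<lambda>\<sigma>. (1 / T) *\<^sub>R (P + \<sigma> *\<^sub>R w))"
  have norm_w: "norm w = \<bar>c\<bar> / norm P"
    using P0 by (simp add: w_def norm_hrot power2_eq_square)
  have orth: "P \<bullet> w = 0"
    using sympl_hrot[of P P] by (simp add: w_def)
  have sympl_w: "2 * sympl P w = 2 * c"
    using P0 by (simp add: w_def sympl_simps sympl_hrot_self)
  define Q where "Q = hline A (u 1) (T / 2)"
  have half: "(T / 2) *\<^sub>R u \<sigma> = (1 / 2) *\<^sub>R (P + \<sigma> *\<^sub>R w)" for \<sigma>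
    using T by (simp add: u_def)
  have Qp: "hproj Q = hproj A + (1 / 2) *\<^sub>R (P + w)"
    using half[of 1] by (simp add: Q_def)
  have Qz: "snd (snd Q) = snd (snd A) - sympl (hproj A) (P + w)"
  proof -
    have "2 * (T / 2) * sympl (hproj A) (u 1) = 2 * sympl (hproj A) ((T / 2) *\<^sub>R u 1)" by (simp add: sympl_simps)
    then show ?thesis unfolding Q_def height_hline half by (simp add: sympl_simps)
  qed
  have rP: "rational_hvec P" and rA: "rational_hvec (hproj A)" and rz: "snd (snd A) \<in> \<rat>"
    using A Y by (auto simp: P_def rational_points_iff intro: rational_hvec_diff)
  have "c \<in> \<rat>"
    using A Y by (auto simp: c_def vdisp_def rational_points_iff intro!: Rats_add Rats_diff Rats_mult rational_sympl)
  then have rw: "rational_hvec w"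
    unfolding w_def using rP by (intro rational_hvec_scaleR rational_hvec_hrot) (auto intro: Rats_divide rational_norm_square)
  have "Q \<in> rational_points"
    unfolding rational_points_iff Qp Qz
    using rP rA rz rw by (auto intro!: rational_hvec_add rational_hvec_scaleR Rats_diff rational_sympl)
  moreover have "hline Q (u (-1)) (T / 2) = Y"
  proof (rule heis_eqI)
    have "hproj (hline Q (u (-1)) (T / 2)) = hproj A + ((1 / 2) *\<^sub>R (P + w) + (1 / 2) *\<^sub>R (P - w))"
      using half[of "-1"] by (simp add: Qp)
    also have "(1 / 2) *\<^sub>R (P + w) + (1 / 2) *\<^sub>R (P - w) = P"
      by (simp add: scaleR_add_right scaleR_diff_right flip: scaleR_add_left)
    finally show "hproj (hline Q (u (-1)) (T / 2)) = hproj Y" by (simp add: P_def)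
    have "2 * (T / 2) * sympl (hproj Q) (u (-1)) = 2 * sympl (hproj Q) ((T / 2) *\<^sub>R u (-1))" by (simp add: sympl_simps)
    then have "snd (snd (hline Q (u (-1)) (T / 2))) = snd (snd Q) - sympl (hproj Q) (P - w)"
      unfolding height_hline half by (simp add: sympl_simps)
    also have "\<dots> = snd (snd A) - 2 * sympl (hproj A) P + sympl P w"
      unfolding Qp Qz using sympl_antisym[of w P] by (simp add: sympl_simps field_simps)
    also have "\<dots> = snd (snd Y)"
      using sympl_w by (simp add: c_def vdisp_def P_def sympl_simps)
    finally show "snd (snd (hline Q (u (-1)) (T / 2))) = snd (snd Y)" .
  qed
  moreover have "norm (v - h) \<le> join_tilt h T A Y" if "v \<in> {u 1, u (-1)}" for v h
  proof -
    have "norm (v - (1 / T) *\<^sub>R P) = \<bar>c\<bar> / (T * norm P)"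
      using that T by (auto simp: u_def scaleR_add_right norm_w)
    then show ?thesis
      using norm_triangle_ineq[of "v - (1 / T) *\<^sub>R P" "(1 / T) *\<^sub>R P - h"]
      by (simp add: join_tilt_def P_def c_def)
  qed
  moreover have "(norm v)\<^sup>2 = join_speed_square T A Y" if "v \<in> {u 1, u (-1)}" for v
  proof -
    have "(norm (P + \<sigma> *\<^sub>R w))\<^sup>2 = (norm P)\<^sup>2 + \<sigma>\<^sup>2 * (norm w)\<^sup>2" for \<sigma>
      unfolding power2_norm_eq_inner
      by (simp add: inner_add_left inner_add_right inner_commute[of w P] orth power2_eq_square)
    from this[of 1] this[of "-1"] show ?thesis using that T
      unfolding join_speed_square_def P_def[symmetric] c_def[symmetric]
      by (auto simp: u_def norm_w power_divide power_mult_distrib add_divide_distrib)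
  qed
  ultimately show thesis using that[of "u 1" "u (-1)"] unfolding Q_def by blast
qed

text \<open>A curve \<open>g\<close> that is a horizontal line with velocity \<open>u t\<close> near every \<open>t\<close> outside the finite set \<open>S\<close>.
  The last clause says that its speed is at most \<open>K\<close> in the only form that is used, and in which it
  passes to concatenations by the triangle inequality in the reals.\<close>

definition broken_line ::
    "real \<Rightarrow> (real \<Rightarrow> 'n::finite heis) \<Rightarrow> (real \<Rightarrow> 'n hvec) \<Rightarrow> real set \<Rightarrow> bool" where
  "broken_line K g u S \<longleftrightarrow> finite S \<and> continuous_on UNIV g \<and>
     (\<forall>t. t \<notin> S \<longrightarrow> (\<exists>e>0. \<forall>t'. \<bar>t' - t\<bar> < e \<longrightarrow> g t' = hline (g t) (u t) (t' - t))) \<and>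
     (\<forall>f s t. hLipschitz f \<longrightarrow> \<bar>f (g s) - f (g t)\<bar> \<le> Lip_H f * (K * \<bar>s - t\<bar>))"

lemma continuous_hline: "continuous_on T (\<lambda>t. hline q u (t - c))"
  unfolding hline_def by (intro continuous_intros)

lemma broken_line_hline:
  assumes "norm v \<le> K"
  shows "broken_line K (\<lambda>t. hline q v (t - c)) (\<lambda>t. v) {}"
proof -
  have "\<bar>f (hline q v (s - c)) - f (hline q v (t - c))\<bar> \<le> Lip_H f * (K * \<bar>s - t\<bar>)" if f: "hLipschitz f" for f s t
  proof -
    have "cc_dist (hline q v (s - c)) (hline q v (t - c)) \<le> K * \<bar>s - t\<bar>"
      using cc_dist_hline[of q v "s - c" "t - c"] mult_left_mono[OF assms, of "\<bar>s - t\<bar>"]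
      by (simp add: abs_minus_commute mult.commute)
    then show ?thesis
      using Lip_H_bound[OF f] by (meson mult_left_mono order_trans)
  qed
  then show ?thesis
    unfolding broken_line_def
  proof (intro conjI allI impI)
    show "\<exists>e>0. \<forall>t'. \<bar>t' - t\<bar> < e \<longrightarrow> hline q v (t' - c) = hline (hline q v (t - c)) v (t' - t)" for t
      by (intro exI[of _ 1]) (simp add: hline_hline)
  qed (simp_all add: continuous_hline)
qed

lemma broken_line_glue:
  assumes 1: "broken_line K g1 u1 S1" and 2: "broken_line K g2 u2 S2" and eq: "g1 c = g2 c"
  shows "broken_line K (\<lambda>t. if t \<le> c then g1 t else g2 t) (\<lambda>t. if t \<le> c then u1 t else u2 t) (insert c (S1 \<union> S2))"
  unfolding broken_line_def
proof (intro conjI allI impI)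
  show "finite (insert c (S1 \<union> S2))" using 1 2 by (auto simp: broken_line_def)
  have "continuous_on ({..c} \<union> {c..}) (\<lambda>t. if t \<le> c then g1 t else g2 t)"
  proof (rule continuous_on_If)
    show "continuous_on {..c} g1" "continuous_on {c..} g2"
      using 1 2 unfolding broken_line_def by (meson continuous_on_subset subset_UNIV)+
    show "g1 t = g2 t" if "t \<in> {..c}" "\<not> t \<le> c" for t using that by simp
    show "g1 t = g2 t" if "t \<in> {c..}" "t \<le> c" for t
    proof -
      have "t = c" using that by simp
      then show ?thesis using eq by simp
    qed
  qed simp_all
  moreover have "{..c} \<union> {c..} = (UNIV :: real set)" by auto
  ultimately show "continuous_on UNIV (\<lambda>t. if t \<le> c then g1 t else g2 t)" by simp
next
  fix t assume t: "t \<notin> insert c (S1 \<union> S2)"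
  show "\<exists>e>0. \<forall>t'. \<bar>t' - t\<bar> < e \<longrightarrow> (if t' \<le> c then g1 t' else g2 t') =
      hline (if t \<le> c then g1 t else g2 t) (if t \<le> c then u1 t else u2 t) (t' - t)"
  proof (cases "t < c")
    case True
    obtain e where e: "e > 0" "\<forall>t'. \<bar>t' - t\<bar> < e \<longrightarrow> g1 t' = hline (g1 t) (u1 t) (t' - t)"
      using 1 t unfolding broken_line_def by blast
    show ?thesis
    proof (intro exI[of _ "min e (c - t)"] conjI allI impI)
      fix t' assume t': "\<bar>t' - t\<bar> < min e (c - t)"
      then have t'c: "t' \<le> c" "t \<le> c" using True by linarith+
      moreover have "g1 t' = hline (g1 t) (u1 t) (t' - t)" using e(2) t' by auto
      ultimately show "(if t' \<le> c then g1 t' else g2 t') =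
          hline (if t \<le> c then g1 t else g2 t) (if t \<le> c then u1 t else u2 t) (t' - t)"
        unfolding if_P[OF t'c(1)] if_P[OF t'c(2)] by blast
    qed (use e(1) True in simp)
  next
    case False
    then have "c < t" using t by auto
    obtain e where e: "e > 0" "\<forall>t'. \<bar>t' - t\<bar> < e \<longrightarrow> g2 t' = hline (g2 t) (u2 t) (t' - t)"
      using 2 t unfolding broken_line_def by blast
    show ?thesis
    proof (intro exI[of _ "min e (t - c)"] conjI allI impI)
      fix t' assume t': "\<bar>t' - t\<bar> < min e (t - c)"
      then have "\<not> t' \<le> c" "\<not> t \<le> c" using \<open>c < t\<close> by linarith+
      moreover have "g2 t' = hline (g2 t) (u2 t) (t' - t)" using e(2) t' by auto
      ultimately show "(if t' \<le> c then g1 t' else g2 t') =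
          hline (if t \<le> c then g1 t else g2 t) (if t \<le> c then u1 t else u2 t) (t' - t)"
        unfolding if_not_P[OF \<open>\<not> t' \<le> c\<close>] if_not_P[OF \<open>\<not> t \<le> c\<close>] by blast
    qed (use e(1) \<open>c < t\<close> in simp)
  qed
next
  fix f s t assume f: "hLipschitz (f :: 'a heis \<Rightarrow> real)"
  have l1: "\<bar>f (g1 s) - f (g1 t)\<bar> \<le> Lip_H f * (K * \<bar>s - t\<bar>)" for s t using 1 f by (auto simp: broken_line_def)
  have l2: "\<bar>f (g2 s) - f (g2 t)\<bar> \<le> Lip_H f * (K * \<bar>s - t\<bar>)" for s t using 2 f by (auto simp: broken_line_def)
  have mixed: "\<bar>f (g1 s) - f (g2 t)\<bar> \<le> Lip_H f * (K * \<bar>s - t\<bar>)" if "s \<le> c" "c < t" for s t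
  proof -
    have "\<bar>f (g1 s) - f (g2 t)\<bar> \<le> Lip_H f * (K * \<bar>s - c\<bar>) + Lip_H f * (K * \<bar>c - t\<bar>)"
      using l1[of s c] l2[of c t, folded eq] by linarith
    also have "\<dots> = Lip_H f * (K * (\<bar>s - c\<bar> + \<bar>c - t\<bar>))" by (simp only: distrib_left)
    also have "\<bar>s - c\<bar> + \<bar>c - t\<bar> = \<bar>s - t\<bar>" using that by linarith
    finally show ?thesis .
  qed
  show "\<bar>f (if s \<le> c then g1 s else g2 s) - f (if t \<le> c then g1 t else g2 t)\<bar> \<le> Lip_H f * (K * \<bar>s - t\<bar>)"
  proof (cases "s \<le> c"; cases "t \<le> c")
    assume "\<not> s \<le> c" "t \<le> c"
    then show ?thesis using mixed[of t s] abs_minus_commute[of t s] abs_minus_commute[of "f (g1 t)"] by simp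
  qed (use l1[of s t] l2[of s t] mixed[of s t] in simp_all)
qed

lemma bounded_derivative_finite_exceptions:
  fixes F :: "real \<Rightarrow> 'a::euclidean_space"
  assumes S: "finite S" and cont: "continuous_on UNIV F"
    and deriv: "\<And>t. t \<notin> S \<Longrightarrow> (F has_vector_derivative F' t) (at t)"
    and bound: "\<And>t. min a b \<le> t \<Longrightarrow> t \<le> max a b \<Longrightarrow> t \<notin> S \<Longrightarrow> norm (F' t) \<le> B"
    and B: "0 \<le> B"
  shows "norm (F b - F a) \<le> B * \<bar>b - a\<bar>"
proof -
  define l where "l = min a b"
  define r where "r = max a b"
  have lr: "l \<le> r" by (simp add: l_def r_def)
  have int: "(F' has_integral F r - F l) {l..r}"
  proof (rule fundamental_theorem_of_calculus_interior_strong[OF S lr])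
    show "continuous_on {l..r} F" using cont continuous_on_subset by blast
  qed (use deriv in auto)
  have "norm (F r - F l) \<le> B * measure lborel {l..r}"
    by (rule has_integral_bound_real[OF B S int]) (use bound in \<open>auto simp: l_def r_def\<close>)
  then show ?thesis using lr
    by (cases "a \<le> b") (auto simp: l_def r_def norm_minus_commute)
qed

lemma broken_line_derivative:
  assumes g: "broken_line K g u S" and t: "t \<notin> S"
  shows "(g has_vector_derivative hfield (u t) (g t)) (at t)"
proof -
  obtain e where e: "e > 0" "\<forall>t'. \<bar>t' - t\<bar> < e \<longrightarrow> g t' = hline (g t) (u t) (t' - t)"
    using g t unfolding broken_line_def by blast
  have "((\<lambda>t'. hline (g t) (u t) (t' - t)) has_vector_derivative hfield (u t) (g t)) (at t)"
    unfolding hline_def by (auto intro!: derivative_eq_intros)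
  then show ?thesis
  proof (rule has_vector_derivative_transform_within[OF _ e(1)])
    show "hline (g t) (u t) (t' - t) = g t'" if "dist t' t < e" for t'
      using e(2) that unfolding dist_real_def by metis
  qed simp
qed

text \<open>
  Horizontal curves with velocities \<open>\<eta>\<close>-close to \<open>h\<close> stay at distance \<open>O(\<surd>\<eta> |t|)\<close> from a line in
  direction \<open>h\<close>: the vertical deviation has derivative \<open>- 2 sympl d u + 2 sympl h d\<close>, where the
  horizontal deviation \<open>d\<close> is at most \<open>\<eta> |t|\<close>.
\<close>

lemma broken_line_angle:
  fixes h :: "'n::finite hvec"
  assumes g: "broken_line K g u S" and u: "\<And>t. norm (u t - h) \<le> \<eta>" and h: "norm h = 1" and \<eta>: "\<eta> \<le> 1"
  shows "norm (hproj (g (\<tau> + t)) - hproj (hline (g \<tau>) h t)) \<le> \<eta> * \<bar>t\<bar>"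
    and "\<bar>vdisp (hline (g \<tau>) h t) (g (\<tau> + t))\<bar> \<le> 6 * \<eta> * t\<^sup>2"
proof -
  have \<eta>0: "0 \<le> \<eta>" using u[of 0] norm_ge_zero[of "u 0 - h"] by linarith
  have finS: "finite S" and cont: "continuous_on UNIV g" using g by (auto simp: broken_line_def)
  \<comment> \<open>The exceptional parameters, measured from \<open>\<tau>\<close>.\<close>
  define S' where "S' = (\<lambda>s. s - \<tau>) ` S"
  have S': "finite S'" "\<And>s. s \<notin> S' \<Longrightarrow> \<tau> + s \<notin> S"
    using finS by (auto simp: S'_def image_iff)
  define G where "G = (\<lambda>s. g (\<tau> + s))"
  define X where "X = (\<lambda>s. hline (g \<tau>) h s)"
  have contG: "continuous_on UNIV G"
    unfolding G_def by (rule continuous_on_compose2[OF cont]) (auto intro!: continuous_intros)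
  have G: "(G has_vector_derivative hfield (u (\<tau> + s)) (G s)) (at s)" if "s \<notin> S'" for s
  proof -
    have "((g \<circ> (\<lambda>s. \<tau> + s)) has_vector_derivative (1 *\<^sub>R hfield (u (\<tau> + s)) (g (\<tau> + s)))) (at s)"
      by (rule vector_diff_chain_at) (use broken_line_derivative[OF g S'(2)[OF that]] in \<open>auto intro!: derivative_eq_intros\<close>)
    then show ?thesis by (simp add: G_def o_def)
  qed
  have Gp: "((\<lambda>s. hproj (G s)) has_vector_derivative u (\<tau> + s)) (at s)" if "s \<notin> S'" for s
    using bounded_linear.has_vector_derivative[OF bounded_linear_hproj G[OF that]] by simp
  have Gz: "((\<lambda>s. snd (snd (G s))) has_vector_derivative - 2 * sympl (hproj (G s)) (u (\<tau> + s))) (at s)" if "s \<notin> S'" for s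
    using bounded_linear.has_vector_derivative[OF bounded_linear_height G[OF that]] by (simp add: height_hfield)
  have contGp: "continuous_on UNIV (\<lambda>s. hproj (G s))"
    using contG by (intro bounded_linear.continuous_on[OF bounded_linear_hproj])
  have Xp: "((\<lambda>s. hproj (X s)) has_vector_derivative h) (at s)" for s
    unfolding X_def hproj_hline by (auto intro!: derivative_eq_intros)
  have contX: "continuous_on UNIV X" unfolding X_def hline_def by (intro continuous_intros)
  have contXp: "continuous_on UNIV (\<lambda>s. hproj (X s))"
    using contX by (intro bounded_linear.continuous_on[OF bounded_linear_hproj])
  define d where "d = (\<lambda>s. hproj (G s) - hproj (X s))"
  have d_le: "norm (d s) \<le> \<eta> * \<bar>s\<bar>" for s
  proof -
    have "norm (d s - d 0) \<le> \<eta> * \<bar>s - 0\<bar>"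
    proof (rule bounded_derivative_finite_exceptions[OF S'(1)])
      show "continuous_on UNIV d" unfolding d_def by (intro continuous_intros contGp contXp)
      show "(d has_vector_derivative u (\<tau> + s) - h) (at s)" if "s \<notin> S'" for s
        unfolding d_def by (intro has_vector_derivative_diff Gp[OF that] Xp)
    qed (use u \<eta>0 in auto)
    then show ?thesis by (simp add: d_def G_def X_def)
  qed
  show "norm (hproj (g (\<tau> + t)) - hproj (hline (g \<tau>) h t)) \<le> \<eta> * \<bar>t\<bar>"
    using d_le[of t] by (simp add: d_def G_def X_def)
  define V where "V = (\<lambda>s. vdisp (X s) (G s))"
  have V_eq: "V s = snd (snd (G s)) - (snd (snd (g \<tau>)) - 2 * s * sympl (hproj (g \<tau>)) h) + 2 * sympl (hproj (X s)) (hproj (G s))" for s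
    by (simp add: V_def vdisp_def X_def height_hline)
  have V_deriv: "(V has_vector_derivative - 2 * sympl (d s) (u (\<tau> + s)) + 2 * sympl h (d s)) (at s)" if s: "s \<notin> S'" for s
  proof -
    have "((\<lambda>s. sympl (hproj (X s)) (hproj (G s))) has_vector_derivative
        sympl (hproj (X s)) (u (\<tau> + s)) + sympl h (hproj (G s))) (at s)"
      by (rule sympl.has_vector_derivative[OF Xp Gp[OF s]])
    then have "((\<lambda>s. 2 * sympl (hproj (X s)) (hproj (G s))) has_vector_derivative
        2 * (sympl (hproj (X s)) (u (\<tau> + s)) + sympl h (hproj (G s)))) (at s)"
      by (rule bounded_linear.has_vector_derivative[OF bounded_linear_mult_right])
    moreover have "((\<lambda>s. snd (snd (g \<tau>)) - 2 * s * sympl (hproj (g \<tau>)) h) has_vector_derivative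
        (- 2 * sympl (hproj (g \<tau>)) h)) (at s)"
      by (auto intro!: derivative_eq_intros)
    ultimately have "(V has_vector_derivative - 2 * sympl (hproj (G s)) (u (\<tau> + s)) - (- 2 * sympl (hproj (g \<tau>)) h)
        + 2 * (sympl (hproj (X s)) (u (\<tau> + s)) + sympl h (hproj (G s)))) (at s)"
      unfolding V_eq by (intro has_vector_derivative_add has_vector_derivative_diff Gz[OF s])
    moreover have "sympl (hproj (g \<tau>)) h = - sympl h (hproj (X s))"
      using sympl_antisym[of "hproj (g \<tau>)" h] by (simp add: X_def sympl_simps)
    ultimately show ?thesis by (simp add: d_def sympl_simps algebra_simps)
  qed
  have "norm (V t - V 0) \<le> (6 * \<eta> * \<bar>t\<bar>) * \<bar>t - 0\<bar>"
  proof (rule bounded_derivative_finite_exceptions[OF S'(1) _ V_deriv])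
    show "continuous_on UNIV V"
      unfolding V_eq
      by (intro continuous_intros sympl.continuous_on contGp contXp
          bounded_linear.continuous_on[OF bounded_linear_height] contG)
    fix s assume s: "min 0 t \<le> s" "s \<le> max 0 t" "s \<notin> S'"
    have ds: "norm (d s) \<le> \<eta> * \<bar>t\<bar>"
    proof -
      have "\<bar>s\<bar> \<le> \<bar>t\<bar>" using s by (auto simp: min_def max_def split: if_splits)
      then show ?thesis using d_le[of s] mult_left_mono[of "\<bar>s\<bar>" "\<bar>t\<bar>" \<eta>] \<eta>0 by linarith
    qed
    have "norm (u (\<tau> + s)) \<le> 2"
      using u[of "\<tau> + s"] norm_triangle_ineq2[of "u (\<tau> + s)" h] h \<eta> by linarith
    then have "norm (d s) * norm (u (\<tau> + s)) \<le> \<eta> * \<bar>t\<bar> * 2"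
      using ds \<eta>0 by (intro mult_mono) auto
    then have "\<bar>sympl (d s) (u (\<tau> + s))\<bar> \<le> 2 * (\<eta> * \<bar>t\<bar>)"
      using abs_sympl_le[of "d s" "u (\<tau> + s)"] by linarith
    moreover have "\<bar>sympl h (d s)\<bar> \<le> \<eta> * \<bar>t\<bar>"
      using abs_sympl_le[of h "d s"] ds h by simp
    ultimately show "norm (- 2 * sympl (d s) (u (\<tau> + s)) + 2 * sympl h (d s)) \<le> 6 * \<eta> * \<bar>t\<bar>"
      by simp
  qed (use \<eta>0 in auto)
  moreover have "V 0 = 0" by (simp add: V_def G_def X_def)
  ultimately have "\<bar>V t\<bar> \<le> 6 * \<eta> * (\<bar>t\<bar> * \<bar>t\<bar>)" by simp
  then show "\<bar>vdisp (hline (g \<tau>) h t) (g (\<tau> + t))\<bar> \<le> 6 * \<eta> * t\<^sup>2"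
    by (simp add: V_def G_def X_def power2_eq_square)
qed

section \<open>Detours through a nearby point\<close>

lemma vdisp_parallel_hlines:
  "vdisp (hline x h t) (hline y h t) = vdisp x y - 4 * t * sympl (hproj y - hproj x) h"
  using sympl_antisym[of h "hproj y"] by (simp add: vdisp_def height_hline sympl_simps algebra_simps)

text \<open>
  The two-segment join from \<open>A\<close> to \<open>Y\<close> has mean velocity \<open>h + w/T\<close>, and its velocities differ from the
  mean by \<open>|vdisp A Y| / (T |P|)\<close>. The term \<open>w/T\<close> is orthogonal to \<open>h\<close>, and the
  deviation from the mean is orthogonal to the mean, so both change the squared speed only to second
  order in \<open>1/K\<close>.
\<close>

lemma detour_estimates:
  fixes A Y :: "'n::finite heis"
  assumes h: "norm h = 1" and K: "10 \<le> K" and r: "0 < r" and T: "(K - 1) * r \<le> T"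
    and P: "hproj Y - hproj A = T *\<^sub>R h + w" and w: "w \<bullet> h = 0" "norm w \<le> r"
    and c: "\<bar>vdisp A Y\<bar> \<le> (1 + 2 * K) * r\<^sup>2"
  shows "join_tilt h T A Y < 4 / K"
    and "\<bar>join_speed_square T A Y - 1\<bar> < (4 / K)\<^sup>2"
    and "hproj Y \<noteq> hproj A"
proof -
  let ?P = "hproj Y - hproj A"
  have "0 < (K - 1) * r" using K r by simp
  then have T0: "0 < T" using T by linarith
  have "9 / 10 * K * r \<le> (K - 1) * r" using K r by (intro mult_right_mono) auto
  then have T9: "9 / 10 * K * r \<le> T" using T by linarith
  have Kr: "0 < 9 / 10 * K * r" using K r by simp
  have nP: "(norm ?P)\<^sup>2 = T\<^sup>2 + (norm w)\<^sup>2"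
  proof -
    have "h \<bullet> h = 1" using h by (simp add: norm_eq_1)
    then show ?thesis
      unfolding P power2_norm_eq_inner inner_add_left inner_add_right inner_commute[of h w]
      by (simp add: w(1) inner_commute[of h w] power2_eq_square)
  qed
  then have "T\<^sup>2 \<le> (norm ?P)\<^sup>2" by simp
  then have TP: "T \<le> norm ?P" by (rule power2_le_imp_le) simp
  show "hproj Y \<noteq> hproj A" using TP T0 by auto
  define e1 where "e1 = norm w / T"
  define e2 where "e2 = \<bar>vdisp A Y\<bar> / (T * norm ?P)"
  have e1: "0 \<le> e1" "e1 \<le> (10 / 9) / K"
  proof -
    show "0 \<le> e1" using T0 by (simp add: e1_def)
    have "e1 \<le> r / (9 / 10 * K * r)" unfolding e1_def using w(2) T9 Kr r by (intro frac_le) auto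
    also have "\<dots> = (10 / 9) / K" using r K by (simp add: field_simps)
    finally show "e1 \<le> (10 / 9) / K" .
  qed
  have e2: "0 \<le> e2" "e2 \<le> (13 / 5) / K"
  proof -
    show "0 \<le> e2" using T0 by (simp add: e2_def)
    have "(9 / 10 * K * r) * (9 / 10 * K * r) \<le> T * norm ?P"
      using T9 TP Kr T0 by (intro mult_mono) auto
    then have "e2 \<le> (1 + 2 * K) * r\<^sup>2 / ((9 / 10 * K * r) * (9 / 10 * K * r))"
      unfolding e2_def using c K mult_pos_pos[OF Kr Kr] by (intro frac_le) auto
    also have "\<dots> = ((1 + 2 * K) * (100 / 81)) / (K * K)" using r K by (simp add: field_simps power2_eq_square)
    also have "\<dots> \<le> ((13 / 5) * K) / (K * K)" using K by (intro divide_right_mono) auto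
    also have "\<dots> = (13 / 5) / K" using K by simp
    finally show "e2 \<le> (13 / 5) / K" .
  qed
  have "(1 / T) *\<^sub>R ?P - h = (1 / T) *\<^sub>R w" using T0 by (simp add: P scaleR_add_right)
  then have "norm ((1 / T) *\<^sub>R ?P - h) = e1" using T0 by (simp add: e1_def)
  moreover have "e1 + e2 < 4 / K"
  proof -
    have "e1 + e2 \<le> (10 / 9 + 13 / 5) / K" using e1(2) e2(2) by (simp only: add_divide_distrib)
    also have "\<dots> < 4 / K" using K by (intro divide_strict_right_mono) auto
    finally show ?thesis .
  qed
  ultimately show "join_tilt h T A Y < 4 / K"
    by (simp add: join_tilt_def e2_def)
  have "(norm ?P / T)\<^sup>2 = 1 + e1\<^sup>2" using nP T0 by (simp add: e1_def power_divide field_simps)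
  moreover have "(vdisp A Y / (T * norm ?P))\<^sup>2 = e2\<^sup>2" by (simp add: e2_def power_divide)
  moreover have "e1\<^sup>2 + e2\<^sup>2 < (4 / K)\<^sup>2"
  proof -
    have "e1\<^sup>2 + e2\<^sup>2 \<le> ((10 / 9) / K)\<^sup>2 + ((13 / 5) / K)\<^sup>2"
      using e1 e2 by (intro add_mono power_mono) auto
    also have "\<dots> = ((10 / 9)\<^sup>2 + (13 / 5)\<^sup>2) / K\<^sup>2" by (simp only: power_divide add_divide_distrib)
    also have "\<dots> < 4\<^sup>2 / K\<^sup>2" using K by (intro divide_strict_right_mono) (auto simp: power2_eq_square)
    finally show ?thesis by (simp only: power_divide)
  qed
  ultimately show "\<bar>join_speed_square T A Y - 1\<bar> < (4 / K)\<^sup>2"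
    by (simp add: join_speed_square_def)
qed

lemma tendsto_vdisp:
  assumes "(X \<longlongrightarrow> x) F" "(Y \<longlongrightarrow> y) F"
  shows "((\<lambda>n. vdisp (X n) (Y n)) \<longlongrightarrow> vdisp x y) F"
  unfolding vdisp_def using assms
  by (intro tendsto_intros sympl.tendsto bounded_linear.tendsto[OF bounded_linear_hproj]) 

lemmas tendsto_hproj = bounded_linear.tendsto[OF bounded_linear_hproj]

lemma norm_near_1:
  assumes "\<bar>(norm u)\<^sup>2 - 1\<bar> \<le> e"
  shows "\<bar>norm u - 1\<bar> \<le> e"
proof -
  have "\<bar>norm u - 1\<bar> * 1 \<le> \<bar>norm u - 1\<bar> * (norm u + 1)" by (intro mult_left_mono) auto
  also have "\<dots> = \<bar>(norm u - 1) * (norm u + 1)\<bar>" by (simp add: abs_mult)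
  also have "(norm u - 1) * (norm u + 1) = (norm u)\<^sup>2 - 1" by (simp add: power2_eq_square algebra_simps)
  finally show ?thesis using assms by simp
qed

text \<open>
  The hypotheses are strict inequalities in the endpoints, so they survive the passage from the
  exact endpoints to rational approximations.
\<close>

lemma rational_detour_pieces:
  assumes N: "contains_rational_horizontal_lines N" and h: "norm h = 1" and \<eta>: "\<eta> < 1"
    and A: "A \<in> rational_points" and Y: "Y \<in> rational_points" and T: "0 < T" and ne: "hproj Y \<noteq> hproj A"
    and E: "join_tilt h T A Y < \<eta>"
    and Q: "\<bar>join_speed_square T A Y - 1\<bar> < \<eta>\<^sup>2"
  obtains u1 u2 where "hline (hline A u1 (T / 2)) u2 (T / 2) = Y"
    "\<And>t. hline A u1 t \<in> N" "\<And>t. hline (hline A u1 (T / 2)) u2 t \<in> N"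
    "\<And>u. u \<in> {u1, u2} \<Longrightarrow> norm (u - h) \<le> \<eta> \<and> \<bar>norm u - 1\<bar> \<le> \<eta>\<^sup>2"
proof -
  obtain u1 u2 where mid: "hline A u1 (T / 2) \<in> rational_points" and last: "hline (hline A u1 (T / 2)) u2 (T / 2) = Y"
    and dev: "\<And>u h. u \<in> {u1, u2} \<Longrightarrow> norm (u - h) \<le> join_tilt h T A Y"
    and sq: "\<And>u. u \<in> {u1, u2} \<Longrightarrow> (norm u)\<^sup>2 = join_speed_square T A Y"
    using rational_two_segment_join[OF A Y T ne] by metis
  have near: "norm (u - h) < \<eta>" if "u \<in> {u1, u2}" for u
    using dev[OF that, of h] E by linarith
  have nz: "u \<noteq> 0" if "u \<in> {u1, u2}" for u
    using near[OF that] h \<eta> by auto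
  have T2: "T / 2 \<noteq> 0" using T by simp
  show thesis
  proof (rule that[OF last])
    show "hline A u1 t \<in> N" for t
      by (rule rational_line_subset[OF N A mid nz T2]) simp
    show "hline (hline A u1 (T / 2)) u2 t \<in> N" for t
      by (rule rational_line_subset[OF N mid _ nz T2]) (use last Y in simp_all)
    show "norm (u - h) \<le> \<eta> \<and> \<bar>norm u - 1\<bar> \<le> \<eta>\<^sup>2" if "u \<in> {u1, u2}" for u
      using near[OF that] norm_near_1[of u "\<eta>\<^sup>2"] Q sq[OF that] by simp
  qed
qed

text \<open>
  The broken line goes along direction \<open>h\<close> up to a rational point near \<open>x - s h\<close>, with two rational
  segments to a rational point near \<open>y\<close>, with two more to a rational point near \<open>x + s h\<close>, and continues
  in direction \<open>h\<close>. Only the four inner segments are rational, and only they have to be in \<open>N\<close>.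
\<close>

lemma rational_detour:
  fixes x y :: "'n::finite heis" and h :: "'n hvec" and f :: "'n heis \<Rightarrow> real"
  assumes N: "contains_rational_horizontal_lines N" and f: "hLipschitz f" and h: "norm h = 1"
    and r: "0 < r" and K: "10 \<le> K" and v: "norm (hproj y - hproj x) \<le> r" and z: "\<bar>vdisp x y\<bar> \<le> r\<^sup>2"
    and \<sigma>: "0 < \<sigma>"
  defines "s \<equiv> K * r" and "\<zeta> \<equiv> (hproj y - hproj x) \<bullet> h" and "\<eta> \<equiv> 4 / K"
  obtains g u S where "broken_line 2 g u S" "\<And>t. norm (u t - h) \<le> \<eta>" "\<And>t. \<bar>norm (u t) - 1\<bar> \<le> \<eta>\<^sup>2"
    "\<And>t. \<bar>t\<bar> < s \<Longrightarrow> g t \<in> N" "\<bar>f (g \<zeta>) - f y\<bar> \<le> \<sigma>"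
    "\<And>t. s \<le> \<bar>t\<bar> \<Longrightarrow> \<bar>t\<bar> \<le> 2 \<Longrightarrow> \<bar>f (g t) - f (hline x h t)\<bar> \<le> \<sigma>"
    "norm (hproj (g s) - hproj (hline x h s)) \<le> s" "\<bar>vdisp (hline x h s) (g s)\<bar> \<le> s\<^sup>2"
proof -
  define p where "p = hproj y - hproj x"
  define w where "w = p - \<zeta> *\<^sub>R h"
  define A0 where "A0 = hline x h (- s)"
  define B0 where "B0 = hline x h s"
  define T1 where "T1 = s + \<zeta>"
  define T2 where "T2 = s - \<zeta>"
  have hh: "h \<bullet> h = 1" using h by (simp add: norm_eq_1)
  have \<zeta>: "\<bar>\<zeta>\<bar> \<le> r"
    using Cauchy_Schwarz_ineq2[of p h] h v by (simp add: \<zeta>_def p_def)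
  have wh: "w \<bullet> h = 0" by (simp add: w_def inner_diff_left hh \<zeta>_def p_def)
  have w_le: "norm w \<le> r"
  proof -
    have "(norm p)\<^sup>2 = (norm w)\<^sup>2 + \<zeta>\<^sup>2"
    proof -
      have "p = w + \<zeta> *\<^sub>R h" by (simp add: w_def)
      then have "(norm p)\<^sup>2 = (w + \<zeta> *\<^sub>R h) \<bullet> (w + \<zeta> *\<^sub>R h)" by (simp only: power2_norm_eq_inner)
      also have "\<dots> = w \<bullet> w + \<zeta>\<^sup>2"
        using wh hh by (simp add: inner_add_left inner_add_right inner_commute[of h w] power2_eq_square)
      finally show ?thesis by (simp only: power2_norm_eq_inner)
    qed
    then have "(norm w)\<^sup>2 \<le> (norm p)\<^sup>2" by simp
    then have "norm w \<le> norm p" by (rule power2_le_imp_le) simp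
    then show ?thesis using v by (simp add: p_def)
  qed
  have T_ge: "(K - 1) * r \<le> T1" "(K - 1) * r \<le> T2"
    using \<zeta> by (auto simp: T1_def T2_def s_def algebra_simps abs_le_iff)
  have "0 < (K - 1) * r" using K r by simp
  then have T_pos: "0 < T1" "0 < T2" using T_ge by linarith+
  have s0: "0 < s" using K r by (simp add: s_def)
  have sympl_bound: "2 * \<bar>sympl (s *\<^sub>R h) p\<bar> \<le> 2 * K * r\<^sup>2"
  proof -
    have "\<bar>sympl (s *\<^sub>R h) p\<bar> \<le> norm (s *\<^sub>R h) * norm p" by (rule abs_sympl_le)
    also have "\<dots> \<le> s * r" using h s0 v by (intro mult_mono) (auto simp: p_def)
    finally show ?thesis by (simp add: s_def power2_eq_square)
  qed
  have P1: "hproj y - hproj A0 = T1 *\<^sub>R h + w"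
    by (simp add: A0_def T1_def w_def p_def scaleR_add_left)
  have c1: "\<bar>vdisp A0 y\<bar> \<le> (1 + 2 * K) * r\<^sup>2"
  proof -
    have "vdisp A0 x = 0" using vdisp_swap[of A0 x] by (simp add: A0_def)
    then have "vdisp A0 y = vdisp x y - 2 * sympl (s *\<^sub>R h) p"
      using vdisp_chain[of A0 y x] by (simp add: A0_def p_def)
    then have "\<bar>vdisp A0 y\<bar> \<le> r\<^sup>2 + 2 * K * r\<^sup>2" using z sympl_bound by linarith
    then show ?thesis by (simp add: algebra_simps)
  qed
  note est1 = detour_estimates[OF h K r T_ge(1) P1 wh w_le c1]
  have P2: "hproj B0 - hproj y = T2 *\<^sub>R h + (- w)"
    by (simp add: B0_def T2_def w_def p_def scaleR_diff_left)
  have c2: "\<bar>vdisp y B0\<bar> \<le> (1 + 2 * K) * r\<^sup>2"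
  proof -
    have "vdisp y B0 = - vdisp x y - 2 * sympl (- p) (s *\<^sub>R h)"
      using vdisp_chain[of y B0 x] vdisp_swap[of y x] by (simp add: B0_def p_def)
    moreover have "sympl (- p) (s *\<^sub>R h) = sympl (s *\<^sub>R h) p"
      using sympl_antisym[of p "s *\<^sub>R h"] by (simp add: sympl.minus_left)
    ultimately have "\<bar>vdisp y B0\<bar> \<le> r\<^sup>2 + 2 * K * r\<^sup>2" using z sympl_bound by linarith
    then show ?thesis by (simp add: algebra_simps)
  qed
  have wh': "- w \<bullet> h = 0" "norm (- w) \<le> r" using wh w_le by simp_all
  note est2 = detour_estimates[OF h K r T_ge(2) P2 wh' c2]
  obtain X where X: "\<And>n. X n \<in> rational_points" "X \<longlonglongrightarrow> A0" using rational_points_approx[of A0] by blast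
  obtain Y where Y: "\<And>n. Y n \<in> rational_points" "Y \<longlonglongrightarrow> y" using rational_points_approx[of y] by blast
  obtain Z where Z: "\<And>n. Z n \<in> rational_points" "Z \<longlonglongrightarrow> B0" using rational_points_approx[of B0] by blast
  obtain C where C: "1 \<le> C" "\<And>x y. cc_dist (x :: 'n heis) y \<le> norm (hproj y - hproj x) + C * sqrt \<bar>vdisp x y\<bar>"
    using cc_dist_upper by blast
  define err where "err = (\<lambda>(q :: 'n heis) W. Lip_H f * (norm (hproj W - hproj q) + C * sqrt (\<bar>vdisp q W\<bar> + 8 * norm (hproj W - hproj q))))"
  have cont_f: "(\<lambda>n. err q (W n)) \<longlonglongrightarrow> 0" if W: "W \<longlonglongrightarrow> q" for W q
  proof -
    have "(\<lambda>n. err q (W n)) \<longlonglongrightarrow> err q q"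
      unfolding err_def by (intro tendsto_intros tendsto_vdisp tendsto_hproj W)
    then show ?thesis by (simp add: err_def)
  qed
  have close: "\<bar>f (hline W h t) - f (hline q h t)\<bar> \<le> err q W"
    if t: "\<bar>t\<bar> \<le> 2" for W q t
  proof -
    have "\<bar>t\<bar> * \<bar>sympl (hproj W - hproj q) h\<bar> \<le> 2 * norm (hproj W - hproj q)"
      using abs_sympl_le[of "hproj W - hproj q" h] h t by (intro mult_mono) auto
    then have "\<bar>4 * t * sympl (hproj W - hproj q) h\<bar> \<le> 8 * norm (hproj W - hproj q)"
      by (simp add: abs_mult)
    then have "\<bar>vdisp (hline q h t) (hline W h t)\<bar> \<le> \<bar>vdisp q W\<bar> + 8 * norm (hproj W - hproj q)"
      unfolding vdisp_parallel_hlines by linarith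
    then have "C * sqrt \<bar>vdisp (hline q h t) (hline W h t)\<bar> \<le> C * sqrt (\<bar>vdisp q W\<bar> + 8 * norm (hproj W - hproj q))"
      using C(1) by (intro mult_left_mono) auto
    then have "cc_dist (hline q h t) (hline W h t) \<le> norm (hproj W - hproj q) + C * sqrt (\<bar>vdisp q W\<bar> + 8 * norm (hproj W - hproj q))"
      using C(2)[of "hline q h t" "hline W h t"] by simp
    then have "Lip_H f * cc_dist (hline q h t) (hline W h t) \<le> err q W"
      unfolding err_def using Lip_H_bound(1)[OF f] by (rule mult_left_mono)
    then show ?thesis
      using Lip_H_bound(2)[OF f, of "hline q h t" "hline W h t"] abs_minus_commute[of "f (hline q h t)"] by linarith
  qed
  have \<eta>: "0 < \<eta>" "\<eta> < 1" using K by (auto simp: \<eta>_def)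
  have E_lim: "(\<lambda>n. join_tilt h T (A n) (B n)) \<longlonglongrightarrow> join_tilt h T a b"
    and Q_lim: "(\<lambda>n. \<bar>join_speed_square T (A n) (B n) - 1\<bar>) \<longlonglongrightarrow> \<bar>join_speed_square T a b - 1\<bar>"
    if "A \<longlonglongrightarrow> a" "B \<longlonglongrightarrow> b" "0 < T" "hproj b \<noteq> hproj a" for A B a b and T :: real
    unfolding join_tilt_def join_speed_square_def using that
    by (intro tendsto_intros tendsto_vdisp tendsto_hproj; simp)+
  have ne_lim: "\<forall>\<^sub>F n in sequentially. hproj (B n) \<noteq> hproj (A n)"
    if "A \<longlonglongrightarrow> a" "B \<longlonglongrightarrow> b" "hproj b \<noteq> hproj a" for A B and a b :: "'n heis"
  proof -
    have "(\<lambda>n. norm (hproj (B n) - hproj (A n))) \<longlonglongrightarrow> norm (hproj b - hproj a)"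
      using that by (intro tendsto_intros tendsto_hproj)
    then have "\<forall>\<^sub>F n in sequentially. 0 < norm (hproj (B n) - hproj (A n))"
      by (rule order_tendstoD(1)) (use that in simp)
    then show ?thesis by (rule eventually_mono) auto
  qed
  have e1: "\<forall>\<^sub>F n in sequentially. join_tilt h T1 (X n) (Y n) < \<eta>"
    by (rule order_tendstoD(2)[OF E_lim[OF X(2) Y(2) T_pos(1) est1(3)] est1(1)[folded \<eta>_def]])
  have e2: "\<forall>\<^sub>F n in sequentially. \<bar>join_speed_square T1 (X n) (Y n) - 1\<bar> < \<eta>\<^sup>2"
    by (rule order_tendstoD(2)[OF Q_lim[OF X(2) Y(2) T_pos(1) est1(3)] est1(2)[folded \<eta>_def]])
  have e3: "\<forall>\<^sub>F n in sequentially. join_tilt h T2 (Y n) (Z n) < \<eta>"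
    by (rule order_tendstoD(2)[OF E_lim[OF Y(2) Z(2) T_pos(2) est2(3)] est2(1)[folded \<eta>_def]])
  have e4: "\<forall>\<^sub>F n in sequentially. \<bar>join_speed_square T2 (Y n) (Z n) - 1\<bar> < \<eta>\<^sup>2"
    by (rule order_tendstoD(2)[OF Q_lim[OF Y(2) Z(2) T_pos(2) est2(3)] est2(2)[folded \<eta>_def]])
  note e5 = ne_lim[OF X(2) Y(2) est1(3)] and e6 = ne_lim[OF Y(2) Z(2) est2(3)]
  note e7 = order_tendstoD(2)[OF cont_f[OF X(2)] \<sigma>] and e8 = order_tendstoD(2)[OF cont_f[OF Y(2)] \<sigma>]
    and e9 = order_tendstoD(2)[OF cont_f[OF Z(2)] \<sigma>]
  have e10: "\<forall>\<^sub>F n in sequentially. norm (hproj (Z n) - hproj B0) < s"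
  proof (rule order_tendstoD(2))
    show "(\<lambda>n. norm (hproj (Z n) - hproj B0)) \<longlonglongrightarrow> norm (hproj B0 - hproj B0)"
      by (intro tendsto_intros tendsto_hproj Z(2))
  qed (use s0 in simp)
  have e11: "\<forall>\<^sub>F n in sequentially. \<bar>vdisp B0 (Z n)\<bar> < s\<^sup>2"
  proof (rule order_tendstoD(2))
    show "(\<lambda>n. \<bar>vdisp B0 (Z n)\<bar>) \<longlonglongrightarrow> \<bar>vdisp B0 B0\<bar>"
      by (intro tendsto_intros tendsto_vdisp Z(2))
  qed (use s0 in simp)
  have "\<forall>\<^sub>F n in sequentially. join_tilt h T1 (X n) (Y n) < \<eta> \<and> \<bar>join_speed_square T1 (X n) (Y n) - 1\<bar> < \<eta>\<^sup>2 \<and> hproj (Y n) \<noteq> hproj (X n)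
      \<and> join_tilt h T2 (Y n) (Z n) < \<eta> \<and> \<bar>join_speed_square T2 (Y n) (Z n) - 1\<bar> < \<eta>\<^sup>2 \<and> hproj (Z n) \<noteq> hproj (Y n)
      \<and> err A0 (X n) < \<sigma>
      \<and> err y (Y n) < \<sigma>
      \<and> err B0 (Z n) < \<sigma>
      \<and> norm (hproj (Z n) - hproj B0) < s \<and> \<bar>vdisp B0 (Z n)\<bar> < s\<^sup>2"
    by (intro eventually_conj e1 e2 e3 e4 e5 e6 e7 e8 e9 e10 e11)
  then obtain n where n: "join_tilt h T1 (X n) (Y n) < \<eta>" "\<bar>join_speed_square T1 (X n) (Y n) - 1\<bar> < \<eta>\<^sup>2" "hproj (Y n) \<noteq> hproj (X n)"
      "join_tilt h T2 (Y n) (Z n) < \<eta>" "\<bar>join_speed_square T2 (Y n) (Z n) - 1\<bar> < \<eta>\<^sup>2" "hproj (Z n) \<noteq> hproj (Y n)"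
      "err A0 (X n) < \<sigma>"
      "err y (Y n) < \<sigma>"
      "err B0 (Z n) < \<sigma>"
      "norm (hproj (Z n) - hproj B0) < s" "\<bar>vdisp B0 (Z n)\<bar> < s\<^sup>2"
    using eventually_happens'[OF sequentially_bot] by blast
  define A where "A = X n"
  define Y' where "Y' = Y n"
  define B where "B = Z n"
  obtain u1 u2 where j1: "hline (hline A u1 (T1 / 2)) u2 (T1 / 2) = Y'"
    and N1: "\<And>t. hline A u1 t \<in> N" "\<And>t. hline (hline A u1 (T1 / 2)) u2 t \<in> N"
    and d1: "\<And>u. u \<in> {u1, u2} \<Longrightarrow> norm (u - h) \<le> \<eta> \<and> \<bar>norm u - 1\<bar> \<le> \<eta>\<^sup>2"
    using rational_detour_pieces[OF N h \<eta>(2) X(1) Y(1) T_pos(1) n(3,1,2)] unfolding A_def Y'_def by metis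
  obtain u3 u4 where j2: "hline (hline Y' u3 (T2 / 2)) u4 (T2 / 2) = B"
    and N2: "\<And>t. hline Y' u3 t \<in> N" "\<And>t. hline (hline Y' u3 (T2 / 2)) u4 t \<in> N"
    and d2: "\<And>u. u \<in> {u3, u4} \<Longrightarrow> norm (u - h) \<le> \<eta> \<and> \<bar>norm u - 1\<bar> \<le> \<eta>\<^sup>2"
    using rational_detour_pieces[OF N h \<eta>(2) Y(1) Z(1) T_pos(2) n(6,4,5)] unfolding B_def Y'_def by metis
  define m1 where "m1 = - s + T1 / 2"
  define m2 where "m2 = \<zeta> + T2 / 2"
  have order: "- s < m1" "m1 < \<zeta>" "\<zeta> < m2" "m2 < s"
    and halves: "m1 + s = T1 / 2" "\<zeta> - m1 = T1 / 2" "m2 - \<zeta> = T2 / 2" "s - m2 = T2 / 2"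
    using T_pos by (auto simp: m1_def m2_def T1_def T2_def field_simps)
  define Q1 where "Q1 = hline A u1 (T1 / 2)"
  define Q2 where "Q2 = hline Y' u3 (T2 / 2)"
  have speed: "norm u \<le> 2" if "u \<in> {h, u1, u2, u3, u4}" for u
  proof -
    have "norm (u - h) \<le> \<eta>" using that d1[of u] d2[of u] \<eta>(1) by auto
    then show ?thesis using norm_triangle_ineq2[of u h] h \<eta>(2) by linarith
  qed
  define g5 where "g5 = (\<lambda>t. if t \<le> m2 then hline Y' u3 (t - \<zeta>) else if t \<le> s then hline Q2 u4 (t - m2) else hline B h (t - s))"
  define v5 where "v5 = (\<lambda>t. if t \<le> m2 then u3 else if t \<le> s then u4 else h)"
  define g where "g = (\<lambda>t. if t \<le> - s then hline A h (t - (- s)) else if t \<le> m1 then hline A u1 (t - (- s)) else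
      if t \<le> \<zeta> then hline Q1 u2 (t - m1) else g5 t)"
  define u where "u = (\<lambda>t. if t \<le> - s then h else if t \<le> m1 then u1 else if t \<le> \<zeta> then u2 else v5 t)"
  have speeds: "norm h \<le> 2" "norm u1 \<le> 2" "norm u2 \<le> 2" "norm u3 \<le> 2" "norm u4 \<le> 2"
    by (intro speed; simp)+
  have joins: "hline Q1 u2 (\<zeta> - m1) = Y'" "hline Q2 u4 (s - m2) = B"
    by (simp_all only: halves Q1_def Q2_def j1 j2)
  have joins': "hline A u1 (m1 - (- s)) = Q1" "hline Y' u3 (m2 - \<zeta>) = Q2"
  proof -
    have "m1 - (- s) = T1 / 2" using halves(1) by linarith
    then show "hline A u1 (m1 - (- s)) = Q1" by (simp only: Q1_def)
  qed (simp only: Q2_def halves(3))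
  note b = broken_line_hline[OF speeds(1)] broken_line_hline[OF speeds(2)] broken_line_hline[OF speeds(3)]
    broken_line_hline[OF speeds(4)] broken_line_hline[OF speeds(5)]
  have b5: "broken_line 2 (\<lambda>t. if t \<le> s then hline Q2 u4 (t - m2) else hline B h (t - s)) (\<lambda>t. if t \<le> s then u4 else h)
      (insert s ({} \<union> {}))"
    by (rule broken_line_glue[OF b(5) b(1)]) (simp add: joins)
  have b4: "broken_line 2 g5 v5 (insert m2 ({} \<union> insert s ({} \<union> {})))"
    unfolding g5_def v5_def by (rule broken_line_glue[OF b(4) b5]) (use order in \<open>simp add: joins'\<close>)
  have b3: "broken_line 2 (\<lambda>t. if t \<le> \<zeta> then hline Q1 u2 (t - m1) else g5 t) (\<lambda>t. if t \<le> \<zeta> then u2 else v5 t)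
      (insert \<zeta> ({} \<union> insert m2 ({} \<union> insert s ({} \<union> {}))))"
    by (rule broken_line_glue[OF b(3) b4]) (use order in \<open>simp add: joins g5_def\<close>)
  have b2: "broken_line 2 (\<lambda>t. if t \<le> m1 then hline A u1 (t - (- s)) else if t \<le> \<zeta> then hline Q1 u2 (t - m1) else g5 t)
      (\<lambda>t. if t \<le> m1 then u1 else if t \<le> \<zeta> then u2 else v5 t)
      (insert m1 ({} \<union> insert \<zeta> ({} \<union> insert m2 ({} \<union> insert s ({} \<union> {})))))"
    by (rule broken_line_glue[OF b(2) b3]) (use order joins' in simp)
  have S: "broken_line 2 g u (insert (- s) ({} \<union> insert m1 ({} \<union> insert \<zeta> ({} \<union> insert m2 ({} \<union> insert s ({} \<union> {}))))))"
    unfolding g_def u_def by (rule broken_line_glue[OF b(1) b2]) (use order in simp)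
  show thesis
  proof (rule that[OF S])
    have "u t \<in> {h, u1, u2, u3, u4}" for t by (simp add: u_def v5_def)
    then show "norm (u t - h) \<le> \<eta>" "\<bar>norm (u t) - 1\<bar> \<le> \<eta>\<^sup>2" for t
      using d1 d2 h \<eta>(1) by (metis (no_types, lifting) insert_iff empty_iff diff_self norm_zero abs_zero less_imp_le zero_le_power2)+
    show "g t \<in> N" if "\<bar>t\<bar> < s" for t
    proof -
      have "- s < t" "t < s" using that by (auto simp: abs_less_iff)
      then show ?thesis using N1 N2 by (simp add: g_def g5_def Q1_def Q2_def)
    qed
    have "g s = B" using order s0 by (simp add: g_def g5_def joins)
    then show "norm (hproj (g s) - hproj (hline x h s)) \<le> s" "\<bar>vdisp (hline x h s) (g s)\<bar> \<le> s\<^sup>2"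
      using n(10,11) by (simp_all add: B_def B0_def[symmetric] del: hproj_hline)
    have "g \<zeta> = Y'" using order by (simp add: g_def joins)
    then show "\<bar>f (g \<zeta>) - f y\<bar> \<le> \<sigma>"
      using close[of 0 Y' y] n(8) by (simp add: Y'_def)
    show "\<bar>f (g t) - f (hline x h t)\<bar> \<le> \<sigma>" if t: "s \<le> \<bar>t\<bar>" "\<bar>t\<bar> \<le> 2" for t
    proof (cases "t \<le> - s")
      case True
      have "hline x h t = hline A0 h (t + s)" by (simp add: A0_def hline_hline)
      moreover have "g t = hline A h (t + s)" using True by (simp add: g_def)
      moreover have "\<bar>t + s\<bar> \<le> 2" using True t s0 by linarith
      ultimately show ?thesis using close[of "t + s" A A0] n(7) by (simp add: A_def)
    next
      case False
      then have ts: "s \<le> t" using t by linarith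
      have "hline x h t = hline B0 h (t - s)" by (simp add: B0_def hline_hline)
      moreover have "g t = hline B h (t - s)"
      proof (cases "t = s")
        case True
        then show ?thesis using order by (simp add: g_def g5_def joins)
      next
        case False
        then show ?thesis using ts order by (simp add: g_def g5_def)
      qed
      moreover have "\<bar>t - s\<bar> \<le> 2" using ts t s0 by linarith
      ultimately show ?thesis using close[of "t - s" B B0] n(9) by (simp add: B_def)
    qed
  qed
qed

section \<open>Almost maximal directional derivatives\<close>

text \<open>
  Control of the increments of \<open>\<phi>\<close> from \<open>\<tau>\<close> on \<open>[-s, s]\<close> extends to all \<open>|t| < 1\<close>. Just outside \<open>[-s, s]\<close>
  both functions are nearly linear, and the errors are small relative to \<open>|t|\<close> since \<open>\<tau>\<close> keeps the
  distance \<open>\<beta> s\<close> from the ends; for \<open>|t| > \<rho>/2\<close> the trivial error \<open>6 s\<close> is already small compared with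
  \<open>|t|\<close>.
\<close>

lemma increment_comparison:
  fixes \<phi> \<psi> :: "real \<Rightarrow> real"
  assumes lip: "\<And>a b. \<bar>\<phi> a - \<phi> b\<bar> \<le> \<bar>a - b\<bar>" "\<And>a. \<bar>\<psi> a - \<psi> 0\<bar> \<le> \<bar>a\<bar>"
    and far: "\<And>t. s \<le> \<bar>t\<bar> \<Longrightarrow> \<bar>t\<bar> \<le> 2 \<Longrightarrow> \<bar>\<phi> t - \<psi> t\<bar> \<le> \<sigma> * s"
    and near: "\<And>t. \<bar>t\<bar> \<le> \<rho> \<Longrightarrow> \<bar>\<psi> t - \<psi> 0 - D * t\<bar> \<le> \<sigma> * \<bar>t\<bar>"
    and M: "0 \<le> M" "\<And>t. \<bar>t\<bar> \<le> s \<Longrightarrow> \<bar>(\<phi> t - D * t) - (\<phi> \<tau> - D * \<tau>)\<bar> \<le> M * \<bar>t - \<tau>\<bar>"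
    and \<tau>: "\<bar>\<tau>\<bar> \<le> s - \<beta> * s" and \<beta>: "0 < \<beta>" "\<beta> \<le> 1"
    and s: "0 < s" "2 * s \<le> \<rho>" "12 * s \<le> e * \<rho>" and \<rho>: "\<rho> \<le> 1"
    and \<sigma>: "0 \<le> \<sigma>" "\<sigma> \<le> 1" "6 * \<sigma> \<le> e * \<beta>"
    and t: "\<bar>t\<bar> < 1"
  shows "\<bar>\<phi> (\<tau> + t) - \<phi> \<tau> - (\<psi> t - \<psi> 0)\<bar> \<le> (M + e) * \<bar>t\<bar>"
proof -
  have \<beta>s: "0 \<le> \<beta> * s" "\<beta> * s \<le> s" using \<beta> s mult_right_mono[of \<beta> 1 s] by auto
  then have \<tau>s: "\<bar>\<tau>\<bar> \<le> s" using \<tau> by linarith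
  have e\<sigma>: "6 * \<sigma> \<le> e"
  proof -
    have "0 \<le> e * \<beta>" using \<sigma> by linarith
    then have "0 \<le> e" using \<beta>(1) by (simp add: zero_le_mult_iff)
    then have "e * \<beta> \<le> e" using \<beta>(2) by (simp add: mult_left_le)
    then show ?thesis using \<sigma>(3) by linarith
  qed
  define k where "k = (\<lambda>t. \<phi> t - D * t)"
  have k_M: "\<bar>k b - k \<tau>\<bar> \<le> M * \<bar>b - \<tau>\<bar>" if "\<bar>b\<bar> \<le> s" for b using M(2)[OF that] by (simp add: k_def)
  have split: "\<phi> (\<tau> + t) - \<phi> \<tau> - (\<psi> t - \<psi> 0) = (k (\<tau> + t) - k \<tau>) - (\<psi> t - \<psi> 0 - D * t)"
    by (simp add: k_def algebra_simps)
  have k_end: "\<bar>k b - \<psi> 0\<bar> \<le> \<sigma> * s + \<sigma> * \<bar>b\<bar>" if "s \<le> \<bar>b\<bar>" "\<bar>b\<bar> \<le> \<rho>" for b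
    using far[of b] near[of b] that \<rho> unfolding k_def by linarith
  have dist: "(M + e) * \<bar>t\<bar> = M * \<bar>t\<bar> + e * \<bar>t\<bar>" by (rule distrib_right)
  consider "\<bar>\<tau> + t\<bar> \<le> s" | "s < \<bar>\<tau> + t\<bar>" "\<bar>t\<bar> \<le> \<rho> / 2" | "\<rho> / 2 < \<bar>t\<bar>" by linarith
  then show ?thesis
  proof cases
    case 1
    have "\<bar>t\<bar> \<le> \<rho>" using 1 \<tau>s s by linarith
    then have "\<bar>\<psi> t - \<psi> 0 - D * t\<bar> \<le> \<sigma> * \<bar>t\<bar>" by (rule near)
    moreover have "\<sigma> * \<bar>t\<bar> \<le> e * \<bar>t\<bar>" using e\<sigma> \<sigma> by (intro mult_right_mono) auto
    moreover have "\<bar>k (\<tau> + t) - k \<tau>\<bar> \<le> M * \<bar>t\<bar>" using k_M[OF 1] by simp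
    ultimately show ?thesis unfolding split dist by linarith
  next
    case 2
    define b where "b = (if 0 < \<tau> + t then s else - s)"
    have b: "\<bar>b\<bar> = s" "\<bar>b - \<tau>\<bar> \<le> \<bar>t\<bar>" "\<beta> * s \<le> \<bar>t\<bar>"
      using 2 \<tau> \<tau>s s \<beta>s by (auto simp: b_def abs_if split: if_splits)
    have "\<bar>k b - k \<tau>\<bar> \<le> M * \<bar>t\<bar>"
      using k_M[of b] b mult_left_mono[OF b(2) M(1)] by linarith
    moreover have "\<bar>k b - \<psi> 0\<bar> \<le> \<sigma> * s + \<sigma> * s" using k_end[of b] b s by simp
    moreover have "\<bar>k (\<tau> + t) - \<psi> 0\<bar> \<le> \<sigma> * s + \<sigma> * (s + \<bar>t\<bar>)"
    proof -
      have "\<bar>\<tau> + t\<bar> \<le> \<rho>" using 2 \<tau>s s by linarith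
      then have "\<bar>k (\<tau> + t) - \<psi> 0\<bar> \<le> \<sigma> * s + \<sigma> * \<bar>\<tau> + t\<bar>" using k_end[of "\<tau> + t"] 2 by simp
      moreover have "\<sigma> * \<bar>\<tau> + t\<bar> \<le> \<sigma> * (s + \<bar>t\<bar>)" using \<tau>s \<sigma> by (intro mult_left_mono) auto
      ultimately show ?thesis by linarith
    qed
    moreover have "\<bar>\<psi> t - \<psi> 0 - D * t\<bar> \<le> \<sigma> * \<bar>t\<bar>" by (rule near) (use 2 s in linarith)
    ultimately have "\<bar>\<phi> (\<tau> + t) - \<phi> \<tau> - (\<psi> t - \<psi> 0)\<bar> \<le> M * \<bar>t\<bar> + (4 * (\<sigma> * s) + 2 * (\<sigma> * \<bar>t\<bar>))"
      unfolding split distrib_left by linarith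
    also have "4 * (\<sigma> * s) + 2 * (\<sigma> * \<bar>t\<bar>) \<le> e * \<bar>t\<bar>"
    proof -
      have "6 * \<sigma> * s \<le> e * \<beta> * s" using \<sigma>(3) s by (intro mult_right_mono) auto
      also have "\<dots> \<le> e * \<bar>t\<bar>" using mult_left_mono[OF b(3), of e] e\<sigma> \<sigma> by (simp add: mult.assoc)
      finally have "6 * (\<sigma> * s) \<le> e * \<bar>t\<bar>" by simp
      moreover have "6 * (\<sigma> * \<bar>t\<bar>) \<le> e * \<bar>t\<bar>"
        using mult_right_mono[OF e\<sigma>, of "\<bar>t\<bar>"] by (simp add: mult.assoc)
      ultimately show ?thesis by linarith
    qed
    finally show ?thesis unfolding dist by linarith
  next
    case 3
    have "\<sigma> * s \<le> s" using \<sigma> s by (simp add: mult_left_le_one_le)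
    moreover have "\<bar>\<phi> t - \<psi> t\<bar> \<le> \<sigma> * s" by (rule far) (use 3 t s in linarith)+
    moreover have "\<bar>\<phi> s - \<psi> s\<bar> \<le> \<sigma> * s" by (rule far) (use s \<rho> in linarith)+
    ultimately have "\<bar>\<phi> t - \<psi> t\<bar> \<le> s" "\<bar>\<phi> s - \<psi> s\<bar> \<le> s" by linarith+
    moreover have "\<bar>\<phi> (\<tau> + t) - \<phi> t\<bar> \<le> s" using lip(1)[of "\<tau> + t" t] \<tau>s by simp
    moreover have "\<bar>\<phi> \<tau> - \<phi> s\<bar> \<le> 2 * s" using lip(1)[of \<tau> s] \<tau>s by linarith
    moreover have "\<bar>\<psi> s - \<psi> 0\<bar> \<le> s" using lip(2)[of s] s by simp
    ultimately have "\<bar>\<phi> (\<tau> + t) - \<phi> \<tau> - (\<psi> t - \<psi> 0)\<bar> \<le> 6 * s" by linarith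
    also have "6 * s \<le> e * (\<rho> / 2)" using s(3) by simp
    also have "\<dots> \<le> e * \<bar>t\<bar>" using 3 e\<sigma> \<sigma> by (intro mult_left_mono) auto
    also have "\<dots> \<le> (M + e) * \<bar>t\<bar>" using M(1) by (simp add: dist)
    finally show ?thesis .
  qed
qed

text \<open>
  The triangle inequality for the homogeneous norm that is the maximum of the norm of the horizontal
  part and the square root of the vertical part.
\<close>

lemma gauge_triangle:
  fixes x y z :: "'n::finite heis"
  assumes "norm (hproj y - hproj x) \<le> a" "\<bar>vdisp x y\<bar> \<le> a\<^sup>2"
    and "norm (hproj z - hproj y) \<le> b" "\<bar>vdisp y z\<bar> \<le> b\<^sup>2"
  shows "norm (hproj z - hproj x) \<le> a + b" "\<bar>vdisp x z\<bar> \<le> (a + b)\<^sup>2"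
proof -
  have ab: "0 \<le> a" "0 \<le> b" using assms(1,3) norm_ge_zero order_trans by blast+
  show "norm (hproj z - hproj x) \<le> a + b"
    using norm_triangle_ineq[of "hproj z - hproj y" "hproj y - hproj x"] assms by simp
  have "norm (hproj y - hproj x) * norm (hproj z - hproj y) \<le> a * b"
    using assms ab by (intro mult_mono) auto
  then have "\<bar>sympl (hproj y - hproj x) (hproj z - hproj y)\<bar> \<le> a * b"
    using abs_sympl_le by (rule order_trans[rotated])
  then have "\<bar>vdisp x z\<bar> \<le> a\<^sup>2 + b\<^sup>2 + 2 * (a * b)"
    using vdisp_chain[of x z y] assms by linarith
  then show "\<bar>vdisp x z\<bar> \<le> (a + b)\<^sup>2" by (simp add: power2_sum)
qed

lemma gauge_hline:
  assumes "norm h = 1"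
  shows "norm (hproj (hline q h t) - hproj q) \<le> \<bar>t\<bar>" "\<bar>vdisp q (hline q h t)\<bar> \<le> \<bar>t\<bar>\<^sup>2"
  using assms by simp_all

lemma has_hderiv_le_Lip:
  assumes f: "hLipschitz f" and D: "has_hderiv f (hfield u) x D"
  shows "\<bar>D\<bar> \<le> Lip_H f * norm u"
proof (rule tendsto_upperbound)
  have "((\<lambda>s. (f (hline x u s) - f (hline x u 0)) / (s - 0)) \<longlongrightarrow> D) (at 0)"
    using D f by (simp add: has_hderiv_iff_line has_field_derivative_iff)
  then show "((\<lambda>s. \<bar>(f (hline x u s) - f (hline x u 0)) / (s - 0)\<bar>) \<longlongrightarrow> \<bar>D\<bar>) (at 0)"
    by (rule tendsto_rabs)
  have "\<bar>(f (hline x u s) - f (hline x u 0)) / (s - 0)\<bar> \<le> Lip_H f * norm u" if "s \<noteq> 0" for s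
  proof -
    have "\<bar>f (hline x u s) - f (hline x u 0)\<bar> \<le> Lip_H f * cc_dist (hline x u s) (hline x u 0)"
      by (rule Lip_H_bound(2)[OF f])
    also have "\<dots> \<le> Lip_H f * (\<bar>s\<bar> * norm u)"
      using cc_dist_hline[of x u s 0] Lip_H_bound(1)[OF f] by (intro mult_left_mono) auto
    finally show ?thesis using that by (simp add: abs_divide divide_le_eq mult_ac)
  qed
  then show "\<forall>\<^sub>F s in at 0. \<bar>(f (hline x u s) - f (hline x u 0)) / (s - 0)\<bar> \<le> Lip_H f * norm u"
    by (simp add: eventually_at_filter)
qed simp

lemma hline_scaled: "hline q ((1 / c) *\<^sub>R u) t = hline q u (t / c)"
  by (simp add: hline_def hfield_scaleR)

lemma broken_line_has_hderiv:
  assumes f: "hLipschitz f" and g: "broken_line K g u S" and \<tau>: "\<tau> \<notin> S"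
    and D: "((\<lambda>t. f (g t)) has_real_derivative D) (at \<tau>)" and u: "u \<tau> \<noteq> 0"
  shows "has_hderiv f (hfield ((1 / norm (u \<tau>)) *\<^sub>R u \<tau>)) (g \<tau>) (D / norm (u \<tau>))"
proof -
  define c where "c = norm (u \<tau>)"
  have c: "c > 0" using u by (simp add: c_def)
  obtain e where e: "e > 0" "\<forall>t'. \<bar>t' - \<tau>\<bar> < e \<longrightarrow> g t' = hline (g \<tau>) (u \<tau>) (t' - \<tau>)"
    using g \<tau> unfolding broken_line_def by blast
  have "((\<lambda>s. f (g (\<tau> + s))) has_real_derivative D) (at 0)"
    using D by (simp add: DERIV_def)
  then have "((\<lambda>s. f (hline (g \<tau>) (u \<tau>) s)) has_real_derivative D) (at 0)"
  proof (rule has_field_derivative_transform_within[OF _ e(1)])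
    fix s :: real assume "dist s 0 < e"
    then have "g (\<tau> + s) = hline (g \<tau>) (u \<tau>) ((\<tau> + s) - \<tau>)" using e(2)[rule_format, of "\<tau> + s"] by simp
    then show "f (g (\<tau> + s)) = f (hline (g \<tau>) (u \<tau>) s)" by (metis add_diff_cancel_left')
  qed simp
  then have "((\<lambda>s. f (hline (g \<tau>) (u \<tau>) s)) has_real_derivative D) (at (0 / c))" by simp
  then have "((\<lambda>s. f (hline (g \<tau>) (u \<tau>) (s / c))) has_real_derivative D * (1 / c)) (at 0)"
    by (rule DERIV_chain2) (use c in \<open>auto intro!: derivative_eq_intros\<close>)
  then have "((\<lambda>s. f (hline (g \<tau>) ((1 / c) *\<^sub>R u \<tau>) s)) has_real_derivative D / c) (at 0)"
    by (simp add: hline_scaled)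
  then show ?thesis using f by (simp add: has_hderiv_iff_line c_def)
qed

text \<open>
  The main step: \<open>D0\<close> is the slope of \<open>f\<close> to first order, in the homogeneous norm. The parameters are
  chosen in the order \<open>\<eta>\<close> (which fixes \<open>K\<close> and the slope excess \<open>\<theta> = \<epsilon> \<lambda> \<eta> / 128\<close>), the relative
  errors \<open>e\<close> and \<open>\<sigma>\<close>, the scale \<open>\<rho>\<close> on which the line through \<open>x0\<close> is differentiable up to \<open>\<sigma>\<close>, the radius
  \<open>\<delta>\<close> from almost maximality for \<open>\<theta>/2\<close>, and finally \<open>r\<close>. A failure at a point \<open>y\<close> then produces a
  member of \<open>M_set\<close> within \<open>\<delta>\<close> of \<open>x0\<close> with derivative at least \<open>D0 + 99/100 \<theta>\<close>.
\<close>

lemma almost_maximal_first_order: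
  fixes f :: "'n::finite heis \<Rightarrow> real" and h0 :: "'n hvec"
  assumes N: "contains_rational_horizontal_lines N" and f: "hLipschitz f" and half: "Lip_H f \<le> 1/2"
    and h0: "norm h0 = 1" and D0: "has_hderiv f (hfield h0) x0 D0"
    and max: "\<And>\<kappa>. 0 < \<kappa> \<Longrightarrow> \<exists>\<delta>>0. \<forall>x E. (x, E) \<in> M_set N f x0 (hfield h0) \<longrightarrow> cc_dist x x0 \<le> \<delta> \<longrightarrow>
        hderiv f E x < D0 + \<kappa>"
    and \<epsilon>: "0 < \<epsilon>" "\<epsilon> \<le> 1"
  shows "\<exists>r0>0. \<forall>r y. 0 < r \<longrightarrow> r < r0 \<longrightarrow> norm (hproj y - hproj x0) \<le> r \<longrightarrow> \<bar>vdisp x0 y\<bar> \<le> r\<^sup>2 \<longrightarrow>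
    \<bar>f y - f x0 - D0 * ((hproj y - hproj x0) \<bullet> h0)\<bar> \<le> \<epsilon> * Lip_H f * r"
proof (cases "Lip_H f = 0")
  case True
  have "f y = f x0" for y using Lip_H_bound(2)[OF f, of y x0] True by simp
  moreover have "D0 = 0" using has_hderiv_le_Lip[OF f D0] True by simp
  ultimately show ?thesis using True by (intro exI[of _ 1]) simp
next
  case False
  define lam where "lam = Lip_H f"
  have lam: "0 < lam" "lam \<le> 1/2" using False Lip_H_bound(1)[OF f] half by (auto simp: lam_def)
  obtain C where C: "1 \<le> C" "\<And>x y. cc_dist (x :: 'n heis) y \<le> norm (hproj y - hproj x) + C * sqrt \<bar>vdisp x y\<bar>"
    using cc_dist_upper by blast
  \<comment> \<open>Small against \<open>\<epsilon>\<close> for the loss \<open>lam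
    \<eta>\<^sup>2\<close> in the slope excess, and with \<open>C ^ 4\<close> for the loss \<open>4
    C lam \<surd>\<eta>\<close>, whose fourth power is compared with \<open>\<theta>
    lam\<close>.\<close>
  define \<eta> where "\<eta> = \<epsilon> / (200000 * C ^ 4)"
  have C4: "1 \<le> C ^ 4" using C(1) by simp
  have \<eta>: "0 < \<eta>" "200000 * C ^ 4 * \<eta> = \<epsilon>" "200000 * \<eta> \<le> \<epsilon>"
  proof -
    have "0 < 200000 * C ^ 4" using C4 by linarith
    then show \<eta>0: "0 < \<eta>" and eq: "200000 * C ^ 4 * \<eta> = \<epsilon>" using \<epsilon>(1) by (simp_all add: \<eta>_def)
    have "\<eta> \<le> C ^ 4 * \<eta>" using C4 \<eta>0 by simp
    then show "200000 * \<eta> \<le> \<epsilon>" using eq by linarith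
  qed
  have \<eta>1: "\<eta> \<le> 1" using \<eta>(3) \<epsilon>(2) by linarith
  define K where "K = 4 / \<eta>"
  have K: "10 \<le> K" "4 / K = \<eta>"
  proof -
    show "10 \<le> K" using \<eta> \<epsilon> by (simp add: K_def le_divide_eq)
    show "4 / K = \<eta>" using \<eta>(1) by (simp add: K_def)
  qed
  \<comment> \<open>Half of the error \<open>\<epsilon> lam r\<close> relative to \<open>s = K
    r\<close>; the other half absorbs the approximation of \<open>y\<close>.\<close>
  define \<omega> where "\<omega> = \<epsilon> * lam / (2 * K)"
  define \<theta> where "\<theta> = \<omega> / 16"
  have \<theta>_eq: "128 * \<theta> = \<epsilon> * lam * \<eta>" using \<eta>(1) by (simp add: \<theta>_def \<omega>_def K_def)
  have \<omega>: "0 < \<omega>" using \<epsilon> lam K by (simp add: \<omega>_def)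
  then have \<theta>: "0 < \<theta>" by (simp add: \<theta>_def)
  define L where "L = 3 * lam"
  define \<beta> where "\<beta> = \<omega> / (16 * L)"
  have \<beta>: "0 < \<beta>" "\<beta> \<le> 1"
  proof -
    show "0 < \<beta>" using \<omega> lam by (simp add: \<beta>_def L_def)
    have "\<epsilon> * lam \<le> 1 * lam" using \<epsilon> lam by (intro mult_right_mono) auto
    then have "\<omega> \<le> lam" using K lam unfolding \<omega>_def by (simp add: divide_le_eq)
    then show "\<beta> \<le> 1" using lam by (simp add: \<beta>_def L_def)
  qed
  \<comment> \<open>Half of a lower bound for the fourth root \<open>Q\<close> below, so that
    \<open>2 e \<le> Q\<close>.\<close>
  define e where "e = root 4 (\<theta> * lam / 2) / 2"
  have e: "0 < e" "(2 * e) ^ 4 = \<theta> * lam / 2" using \<theta> lam by (simp_all add: e_def)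
  define \<sigma> where "\<sigma> = min (min (\<omega> / 32) (e * \<beta> / 6)) 1"
  have \<sigma>: "0 < \<sigma>" "\<sigma> \<le> \<omega> / 32" "6 * \<sigma> \<le> e * \<beta>" "\<sigma> \<le> 1"
    using \<omega> e \<beta> by (auto simp: \<sigma>_def)
  define \<psi> where "\<psi> = (\<lambda>t. f (hline x0 h0 t))"
  have \<psi>0: "\<psi> 0 = f x0" by (simp add: \<psi>_def)
  have D0_le: "\<bar>D0\<bar> \<le> lam" using has_hderiv_le_Lip[OF f D0] h0 by (simp add: lam_def)
  have "(\<psi> has_real_derivative D0) (at 0)"
    using D0 f by (simp add: has_hderiv_iff_line \<psi>_def)
  then obtain \<rho>' where \<rho>': "0 < \<rho>'" "\<And>t. \<bar>t\<bar> < \<rho>' \<Longrightarrow> \<bar>\<psi> t - \<psi> 0 - D0 * t\<bar> \<le> \<sigma> * \<bar>t\<bar>"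
    unfolding has_field_derivative_def has_derivative_within_alt using \<sigma>(1) by auto
  define \<rho> where "\<rho> = min 1 (\<rho>' / 2)"
  have \<rho>: "0 < \<rho>" "\<rho> \<le> 1" "\<And>t. \<bar>t\<bar> \<le> \<rho> \<Longrightarrow> \<bar>\<psi> t - \<psi> 0 - D0 * t\<bar> \<le> \<sigma> * \<bar>t\<bar>"
    using \<rho>' by (auto simp: \<rho>_def)
  obtain \<delta> where \<delta>: "0 < \<delta>" "\<And>x E. (x, E) \<in> M_set N f x0 (hfield h0) \<Longrightarrow> cc_dist x x0 \<le> \<delta> \<Longrightarrow>
        hderiv f E x < D0 + \<theta> / 2"
    using max[of "\<theta> / 2"] \<theta> by auto
  define s0 where "s0 = min (min (\<rho> / 2) (e * \<rho> / 12)) (\<delta> / (9 * (1 + C)))"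
  have s0: "0 < s0" using \<rho> e \<delta> C(1) by (simp add: s0_def)
  show ?thesis
  proof (intro exI[of _ "s0 / K"] conjI allI impI)
    show "0 < s0 / K" using s0 K by simp
    fix r y
    assume r: "0 < r" "r < s0 / K" and y: "norm (hproj y - hproj x0) \<le> r" "\<bar>vdisp x0 y\<bar> \<le> r\<^sup>2"
    define s where "s = K * r"
    define \<zeta> where "\<zeta> = (hproj y - hproj x0) \<bullet> h0"
    have s_lt: "s < s0" using r K by (simp add: s_def less_divide_eq mult.commute)
    have s: "0 < s" "2 * s \<le> \<rho>" "12 * s \<le> e * \<rho>" "9 * (1 + C) * s \<le> \<delta>"
    proof -
      show "0 < s" using r K by (simp add: s_def)
      show "2 * s \<le> \<rho>" "12 * s \<le> e * \<rho>" using s_lt by (simp_all add: s0_def)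
      have "s \<le> \<delta> / (9 * (1 + C))" using s_lt by (simp add: s0_def)
      then show "9 * (1 + C) * s \<le> \<delta>" using C(1) by (simp add: le_divide_eq mult.commute)
    qed
    show "\<bar>f y - f x0 - D0 * \<zeta>\<bar> \<le> \<epsilon> * Lip_H f * r"
    proof (rule ccontr)
      assume "\<not> ?thesis"
      then have bad: "\<epsilon> * lam * r < \<bar>f y - f x0 - D0 * \<zeta>\<bar>" by (simp add: lam_def)
      have \<omega>s: "\<epsilon> * lam * r = 2 * \<omega> * s" using K by (simp add: \<omega>_def s_def)
      have "0 < \<sigma> * s" using \<sigma> s by simp
      then obtain g u S where g: "broken_line 2 g u S" and u: "\<And>t. norm (u t - h0) \<le> \<eta>" "\<And>t. \<bar>norm (u t) - 1\<bar> \<le> \<eta>\<^sup>2"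
        and gN: "\<And>t. \<bar>t\<bar> < s \<Longrightarrow> g t \<in> N" and g\<zeta>: "\<bar>f (g \<zeta>) - f y\<bar> \<le> \<sigma> * s"
        and far: "\<And>t. s \<le> \<bar>t\<bar> \<Longrightarrow> \<bar>t\<bar> \<le> 2 \<Longrightarrow> \<bar>f (g t) - \<psi> t\<bar> \<le> \<sigma> * s"
        and gs: "norm (hproj (g s) - hproj (hline x0 h0 s)) \<le> s" "\<bar>vdisp (hline x0 h0 s) (g s)\<bar> \<le> s\<^sup>2"
        using rational_detour[OF N f h0 r(1) K(1) y, of "\<sigma> * s"]
        unfolding s_def[symmetric] \<zeta>_def[symmetric] K(2) \<psi>_def by metis
      define \<phi> where "\<phi> = (\<lambda>t. f (g t))"
      have \<phi>_lip: "\<bar>\<phi> a - \<phi> b\<bar> \<le> 2 * lam * \<bar>a - b\<bar>" for a b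
        using g f by (simp add: broken_line_def \<phi>_def lam_def mult.assoc mult.left_commute)
      define k where "k = (\<lambda>t. \<phi> t - f x0 - D0 * t)"
      have k_lip: "\<bar>k a - k b\<bar> \<le> L * \<bar>a - b\<bar>" for a b
      proof -
        have "k a - k b = (\<phi> a - \<phi> b) - D0 * (a - b)" by (simp add: k_def algebra_simps)
        moreover have "\<bar>D0 * (a - b)\<bar> \<le> lam * \<bar>a - b\<bar>"
          unfolding abs_mult using D0_le by (rule mult_right_mono) simp
        ultimately show ?thesis using \<phi>_lip[of a b] by (simp add: L_def)
      qed
      have k_end: "\<bar>k b\<bar> \<le> \<omega> / 16 * s" if b: "\<bar>b\<bar> = s" for b
      proof -
        have "\<bar>\<phi> b - \<psi> b\<bar> \<le> \<sigma> * s" using far[of b] b s \<rho> by (simp add: \<phi>_def)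
        moreover have "\<bar>\<psi> b - \<psi> 0 - D0 * b\<bar> \<le> \<sigma> * s" using \<rho>(3)[of b] b s by simp
        moreover have "\<sigma> * s \<le> \<omega> / 32 * s" using \<sigma>(2) s by (intro mult_right_mono) auto
        ultimately show ?thesis unfolding k_def \<psi>0 by linarith
      qed
      have \<zeta>_le: "\<bar>\<zeta>\<bar> \<le> s"
      proof -
        have "\<bar>\<zeta>\<bar> \<le> r" using Cauchy_Schwarz_ineq2[of "hproj y - hproj x0" h0] h0 y by (simp add: \<zeta>_def)
        moreover have "r \<le> s" using K r by (simp add: s_def)
        ultimately show ?thesis by linarith
      qed
      have mid: "\<omega> * s \<le> \<bar>k \<zeta>\<bar>"
      proof -
        have "\<sigma> * s \<le> \<omega> * s" using \<sigma>(2) \<omega> s by (intro mult_right_mono) auto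
        then show ?thesis using bad g\<zeta> unfolding \<omega>s k_def \<phi>_def by linarith
      qed
      have "finite S" using g by (simp add: broken_line_def)
      then have negS: "negligible S" by (rule negligible_finite)
      have L0: "0 < L" using lam by (simp add: L_def)
      obtain \<tau> D M where \<tau>: "\<tau> \<notin> S" "\<bar>\<tau>\<bar> \<le> s - \<beta> * s" and D: "(k has_real_derivative D) (at \<tau>)" "\<theta> \<le> D"
        and M: "0 \<le> M" "M ^ 4 \<le> 80 * L ^ 3 * D" "\<And>t. t \<in> {-s..s} \<Longrightarrow> \<bar>k t - k \<tau>\<bar> \<le> M * \<bar>t - \<tau>\<bar>"
        using lipschitz_point_of_increase[of k L s \<omega> \<zeta> S, OF k_lip L0 s(1) \<omega> k_end k_end \<zeta>_le mid negS] s(1)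
        unfolding \<beta>_def \<theta>_def by (metis abs_minus_cancel abs_of_pos)
      define x where "x = g \<tau>"
      have "0 < \<beta> * s" using \<beta> s by simp
      then have \<tau>s: "\<bar>\<tau>\<bar> < s" using \<tau> by linarith
      have xN: "x \<in> N" unfolding x_def using gN[OF \<tau>s] .
      define c where "c = norm (u \<tau>)"
      have "\<eta>\<^sup>2 \<le> \<eta>" using \<eta>(1) \<eta>1 by (simp add: power2_eq_square mult_left_le)
      then have c: "\<bar>c - 1\<bar> \<le> \<eta>\<^sup>2" "1 / 2 \<le> c"
        using u(2)[of \<tau>] \<eta>(3) \<epsilon>(2) by (auto simp: c_def abs_le_iff)
      define F where "F = D + D0"
      have "((\<lambda>t. k t + f x0 + D0 * t) has_real_derivative F) (at \<tau>)"
        unfolding F_def by (rule derivative_eq_intros D(1) refl | simp)+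
      then have \<phi>_deriv: "((\<lambda>t. f (g t)) has_real_derivative F) (at \<tau>)"
        by (simp add: k_def \<phi>_def)
      have u0: "u \<tau> \<noteq> 0" using c by (auto simp: c_def)
      define E where "E = hfield ((1 / c) *\<^sub>R u \<tau>)"
      have E_deriv: "has_hderiv f E x (F / c)"
        unfolding E_def x_def c_def by (rule broken_line_has_hderiv[OF f g \<tau>(1) \<phi>_deriv u0])
      have E_omega: "omega E = 1" unfolding E_def omega_hfield using u0 by (simp add: c_def)
      have E_field: "E \<in> horizontal_fields" by (simp add: E_def horizontal_fields_def)
      have E_hderiv: "hderiv f E x = F / c" unfolding E_def by (rule hderiv_eqI[OF f E_deriv[unfolded E_def]])
      have D0_hderiv: "hderiv f (hfield h0) x0 = D0" by (rule hderiv_eqI[OF f D0])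
      have F_c: "\<bar>F / c\<bar> \<le> lam"
        using has_hderiv_le_Lip[OF f E_deriv[unfolded E_def]] u0 by (simp add: lam_def c_def)
      define D' where "D' = F / c - D0"
      have D': "99 / 100 * D \<le> D'"
      proof -
        \<comment> \<open>Normalizing the velocity \<open>u \<tau>\<close> changes the derivative
          only by \<open>O(\<eta>\<^sup>2)\<close>.\<close>
        have "D' - D = (F / c) * (1 - c)" using c(2) by (simp add: D'_def F_def field_simps)
        moreover have "\<bar>(F / c) * (1 - c)\<bar> \<le> lam * \<eta>\<^sup>2"
          unfolding abs_mult using F_c c(1) lam(1) by (intro mult_mono) (simp_all add: abs_minus_commute)
        moreover have "lam * \<eta>\<^sup>2 \<le> 1 / 100 * \<theta>"
        proof -
          have "lam * \<eta> * (200000 * \<eta>) \<le> lam * \<eta> * \<epsilon>" using \<eta> lam by (intro mult_left_mono) auto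
          then show ?thesis using \<theta>_eq \<theta> by (simp add: power2_eq_square mult_ac)
        qed
        ultimately show ?thesis using D(2) by linarith
      qed
      have D'0: "0 < D'" using D' D(2) \<theta> by linarith
      define Q where "Q = ((hderiv f E x - hderiv f (hfield h0) x0) * Lip_H f) powr (1/4)"
      have Q_eq: "Q = (D' * lam) powr (1/4)" by (simp add: Q_def E_hderiv D0_hderiv D'_def lam_def)
      have Q0: "0 \<le> Q" by (simp add: Q_def)
      have Q4: "Q ^ 4 = D' * lam"
      proof -
        have "Q ^ 4 = Q powr 4" using D'0 lam by (simp add: Q_eq powr_realpow[of Q 4, symmetric] powr_numeral)
        also have "\<dots> = D' * lam" unfolding Q_eq powr_powr using D'0 lam by simp
        finally show ?thesis .
      qed
      have \<theta>_Q: "99 / 100 * (\<theta> * lam) \<le> Q ^ 4"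
      proof -
        have "99 / 100 * \<theta> * lam \<le> D' * lam" using D' D(2) lam by (intro mult_right_mono) auto
        then show ?thesis unfolding Q4 by simp
      qed
      have fourth_root: "a \<le> b" if "a ^ 4 \<le> b ^ 4" "0 \<le> b" for a b :: real
        using that by (metis power_mono_iff linear numeral_eq_Suc power_le_imp_le_base)
      \<comment> \<open>Here \<open>lam \<le> 1/2\<close> turns the third power of the Lipschitz
        constant into a first power.\<close>
      have M_Q: "M \<le> 5 * Q"
      proof (rule fourth_root)
        have "80 * L ^ 3 * D = 2160 * (lam\<^sup>2 * (lam * D))" by (simp add: L_def power2_eq_square power3_eq_cube)
        also have "lam\<^sup>2 * (lam * D) \<le> (1 / 4) * (lam * D)"
        proof (rule mult_right_mono)
          have "lam\<^sup>2 \<le> (1/2)\<^sup>2" using lam by (intro power_mono) auto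
          then show "lam\<^sup>2 \<le> 1 / 4" by (simp add: power2_eq_square)
        qed (use lam D \<theta> in auto)
        also have "lam * (99 / 100 * D) \<le> lam * D'" using D' lam by (intro mult_left_mono) auto
        then have "2160 * ((1 / 4) * (lam * D)) \<le> 625 * (D' * lam)"
          using D'0 lam by (simp add: mult_ac)
        finally have "80 * L ^ 3 * D \<le> 625 * (D' * lam)" by simp
        moreover have "(5 * Q) ^ 4 = 625 * (D' * lam)" by (simp add: power_mult_distrib Q4)
        ultimately show "M ^ 4 \<le> (5 * Q) ^ 4" using M(2) by linarith
      qed (use Q0 in simp)
      have e_Q: "2 * e \<le> Q"
      proof (rule fourth_root)
        have "\<theta> * lam / 2 \<le> 99 / 100 * (\<theta> * lam)" using \<theta> lam by simp
        then show "(2 * e) ^ 4 \<le> Q ^ 4" using e(2) \<theta>_Q by linarith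
      qed (rule Q0)
      have \<eta>_Q: "8 * C * lam * sqrt \<eta> \<le> Q"
      proof (rule fourth_root)
        have "(sqrt \<eta>) ^ 4 = \<eta>\<^sup>2" using \<eta>(1) by (simp add: power4_eq_xxxx power2_eq_square)
        then have "(8 * C * lam * sqrt \<eta>) ^ 4 = 4096 * C ^ 4 * lam ^ 4 * \<eta>\<^sup>2"
          by (simp add: power_mult_distrib)
        also have "\<dots> = (200000 * C ^ 4 * \<eta>) * (4096 / 200000 * lam\<^sup>2) * (lam\<^sup>2 * \<eta>)"
          by (simp add: power2_eq_square power4_eq_xxxx)
        also have "\<dots> \<le> \<epsilon> * (4096 / 200000 * (1 / 4)) * (lam\<^sup>2 * \<eta>)"
        proof -
          have "lam\<^sup>2 \<le> (1/2)\<^sup>2" using lam by (intro power_mono) auto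
          then show ?thesis unfolding \<eta>(2) using \<epsilon> \<eta>(1) by (intro mult_mono mult_left_mono) (auto simp: power2_eq_square)
        qed
        also have "\<dots> = 4096 / 200000 / 4 * 128 * (\<theta> * lam)"
          using \<theta>_eq by (simp add: power2_eq_square)
        also have "\<dots> \<le> 99 / 100 * (\<theta> * lam)" using \<theta> lam by (intro mult_right_mono) auto
        finally show "(8 * C * lam * sqrt \<eta>) ^ 4 \<le> Q ^ 4" using \<theta>_Q by linarith
      qed (rule Q0)
      have angle: "\<bar>f (hline x h0 t) - \<phi> (\<tau> + t)\<bar> \<le> Q / 2 * \<bar>t\<bar>" for t
      proof -
        note a = broken_line_angle[OF g u(1) h0 \<eta>1, of \<tau> t, folded x_def]
        have "sqrt \<bar>vdisp (hline x h0 t) (g (\<tau> + t))\<bar> \<le> 3 * sqrt \<eta> * \<bar>t\<bar>"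
        proof (rule real_le_lsqrt)
          have "6 * \<eta> * t\<^sup>2 \<le> 9 * \<eta> * t\<^sup>2" using \<eta>(1) by (intro mult_right_mono) auto
          then show "\<bar>vdisp (hline x h0 t) (g (\<tau> + t))\<bar> \<le> (3 * sqrt \<eta> * \<bar>t\<bar>)\<^sup>2"
            using a(2) \<eta>(1) by (simp add: power_mult_distrib)
        qed (use \<eta> in simp)
        then have "C * sqrt \<bar>vdisp (hline x h0 t) (g (\<tau> + t))\<bar> \<le> C * (3 * sqrt \<eta> * \<bar>t\<bar>)"
          using C(1) by (intro mult_left_mono) auto
        moreover have "\<eta> * \<bar>t\<bar> \<le> C * (sqrt \<eta> * \<bar>t\<bar>)"
        proof -
          have "\<eta> \<le> sqrt \<eta>" using \<eta>(1) \<eta>1 by (intro real_le_rsqrt) (simp add: power2_eq_square mult_left_le)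
          then have "\<eta> * \<bar>t\<bar> \<le> sqrt \<eta> * \<bar>t\<bar>" by (intro mult_right_mono) auto
          also have "\<dots> \<le> C * (sqrt \<eta> * \<bar>t\<bar>)" using C(1) \<eta>(1) mult_right_mono[of 1 C "sqrt \<eta> * \<bar>t\<bar>"] by simp
          finally show ?thesis .
        qed
        ultimately have cc: "cc_dist (hline x h0 t) (g (\<tau> + t)) \<le> 4 * C * sqrt \<eta> * \<bar>t\<bar>"
          using C(2)[of "hline x h0 t" "g (\<tau> + t)"] a(1) by (simp add: mult_ac)
        have "\<bar>f (hline x h0 t) - \<phi> (\<tau> + t)\<bar> \<le> lam * cc_dist (hline x h0 t) (g (\<tau> + t))"
          unfolding \<phi>_def lam_def by (rule Lip_H_bound(2)[OF f])
        also have "\<dots> \<le> lam * (4 * C * sqrt \<eta> * \<bar>t\<bar>)" using cc lam by (intro mult_left_mono) auto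
        also have "\<dots> = (8 * C * lam * sqrt \<eta>) / 2 * \<bar>t\<bar>" by simp
        also have "\<dots> \<le> Q / 2 * \<bar>t\<bar>" using \<eta>_Q by (intro mult_right_mono) auto
        finally show ?thesis .
      qed
      have M_ineq: "\<bar>(f (x + t *\<^sub>R hfield h0 x) - f x) - (f (x0 + t *\<^sub>R hfield h0 x0) - f x0)\<bar> \<le> 6 * \<bar>t\<bar> * Q"
        if t: "t \<in> {-1<..<1}" for t
      proof -
        have "\<bar>\<phi> (\<tau> + t) - \<phi> \<tau> - (\<psi> t - \<psi> 0)\<bar> \<le> (M + e) * \<bar>t\<bar>"
        proof (rule increment_comparison[where s=s and \<sigma>=\<sigma> and \<rho>=\<rho> and D=D0 and \<beta>=\<beta>])
          show "\<bar>\<phi> a - \<phi> b\<bar> \<le> \<bar>a - b\<bar>" for a b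
            using \<phi>_lip[of a b] mult_right_mono[of "2 * lam" 1 "\<bar>a - b\<bar>"] lam by simp
          show "\<bar>\<psi> a - \<psi> 0\<bar> \<le> \<bar>a\<bar>" for a
          proof -
            have "\<bar>\<psi> a - \<psi> 0\<bar> \<le> lam * cc_dist (hline x0 h0 a) (hline x0 h0 0)"
              unfolding \<psi>_def lam_def by (rule Lip_H_bound(2)[OF f])
            also have "\<dots> \<le> 1 * \<bar>a\<bar>"
              using cc_dist_hline[of x0 h0 a 0] h0 lam cc_dist_nonneg[of "hline x0 h0 a" "hline x0 h0 0"]
              by (intro mult_mono) auto
            finally show ?thesis by simp
          qed
          show "\<bar>\<phi> t - \<psi> t\<bar> \<le> \<sigma> * s" if "s \<le> \<bar>t\<bar>" "\<bar>t\<bar> \<le> 2" for t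
            using far[OF that] by (simp add: \<phi>_def)
          show "\<bar>(\<phi> t - D0 * t) - (\<phi> \<tau> - D0 * \<tau>)\<bar> \<le> M * \<bar>t - \<tau>\<bar>" if "\<bar>t\<bar> \<le> s" for t
            using M(3)[of t] that by (simp add: k_def abs_le_iff)
        qed (use \<rho> M(1) \<tau>(2) \<beta> s \<sigma> t in \<open>auto simp: abs_less_iff\<close>)
        also have "\<dots> \<le> (5 * Q + Q / 2) * \<bar>t\<bar>" using M_Q e_Q by (intro mult_right_mono) auto
        finally have "\<bar>\<phi> (\<tau> + t) - \<phi> \<tau> - (\<psi> t - \<psi> 0)\<bar> \<le> (5 * Q + Q / 2) * \<bar>t\<bar>" .
        moreover have lines: "f x = \<phi> \<tau>" "x + t *\<^sub>R hfield h0 x = hline x h0 t" "f (x0 + t *\<^sub>R hfield h0 x0) = \<psi> t"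
          by (simp_all add: hline_def \<psi>_def \<phi>_def x_def)
        ultimately have "\<bar>(f (x + t *\<^sub>R hfield h0 x) - f x) - (f (x0 + t *\<^sub>R hfield h0 x0) - f x0)\<bar>
            \<le> (5 * Q + Q / 2) * \<bar>t\<bar> + Q / 2 * \<bar>t\<bar>"
          unfolding lines \<psi>0[symmetric] using angle[of t] by linarith
        also have "\<dots> = 6 * \<bar>t\<bar> * Q" by (simp add: algebra_simps)
        finally show ?thesis .
      qed
      have "(x, E) \<in> D_set N f"
        using xN E_field E_omega E_deriv by (auto simp: D_set_def)
      moreover have "hderiv f (hfield h0) x0 \<le> hderiv f E x"
        using D'0 by (simp add: E_hderiv D0_hderiv D'_def)
      ultimately have "(x, E) \<in> M_set N f x0 (hfield h0)"
        unfolding M_set_def using M_ineq[unfolded Q_def] by blast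
      moreover have "cc_dist x x0 \<le> \<delta>"
      proof -
        let ?t = "s - \<tau>"
        have t: "\<bar>?t\<bar> \<le> 2 * s" using \<tau>s by linarith
        note a = broken_line_angle[OF g u(1) h0 \<eta>1, of \<tau> ?t, folded x_def]
        have a1: "norm (hproj (g s) - hproj (hline x h0 ?t)) \<le> 5 * s"
        proof -
          have "\<eta> * \<bar>?t\<bar> \<le> 1 * (2 * s)" using \<eta>1 t s \<eta>(1) by (intro mult_mono) auto
          then show ?thesis using a(1) s by simp
        qed
        have a2: "\<bar>vdisp (hline x h0 ?t) (g s)\<bar> \<le> (5 * s)\<^sup>2"
        proof -
          have "\<bar>?t\<bar>\<^sup>2 \<le> (2 * s)\<^sup>2" using t by (intro power_mono) auto
          then have "6 * \<eta> * ?t\<^sup>2 \<le> 6 * 1 * (2 * s)\<^sup>2" using \<eta>1 \<eta>(1) by (intro mult_mono) auto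
          then show ?thesis using a(2) zero_le_power2[of s] by (simp add: power_mult_distrib)
        qed
        have b1: "norm (hproj (hline x0 h0 s) - hproj x0) \<le> s" "\<bar>vdisp x0 (hline x0 h0 s)\<bar> \<le> s\<^sup>2"
          using gauge_hline[OF h0, of x0 s] s by simp_all
        have b2: "norm (hproj x - hproj (hline x h0 ?t)) \<le> 2 * s" "\<bar>vdisp x (hline x h0 ?t)\<bar> \<le> (2 * s)\<^sup>2"
          using gauge_hline[OF h0, of x ?t] t by (simp_all add: norm_minus_commute h0)
        have b3: "norm (hproj (hline x h0 ?t) - hproj x) \<le> 2 * s"
          using b2(1) by (simp add: norm_minus_commute)
        \<comment> \<open>From \<open>x\<close> to \<open>x0\<close> by way of the ends of the
          line through \<open>x\<close>, the broken line and the line through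
          \<open>x0\<close>.\<close>
        note c1 = gauge_triangle[OF b3 b2(2) a1 a2]
        have gs': "norm (hproj (hline x0 h0 s) - hproj (g s)) \<le> s" "\<bar>vdisp (g s) (hline x0 h0 s)\<bar> \<le> s\<^sup>2"
          using gs vdisp_swap[of "g s" "hline x0 h0 s"] by (simp_all add: norm_minus_commute)
        have b1': "norm (hproj x0 - hproj (hline x0 h0 s)) \<le> s" "\<bar>vdisp (hline x0 h0 s) x0\<bar> \<le> s\<^sup>2"
          using b1 vdisp_swap[of "hline x0 h0 s" x0] by (simp_all add: norm_minus_commute)
        note c2 = gauge_triangle[OF c1 gs']
        note c3 = gauge_triangle[OF c2 b1']
        have "sqrt \<bar>vdisp x x0\<bar> \<le> 9 * s"
          by (rule real_le_lsqrt) (use c3(2) s in \<open>auto simp: algebra_simps\<close>)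
        then have "C * sqrt \<bar>vdisp x x0\<bar> \<le> C * (9 * s)" using C(1) by (intro mult_left_mono) auto
        then have "cc_dist x x0 \<le> 9 * s + C * (9 * s)" using C(2)[of x x0] c3(1) by linarith
        then show ?thesis using s(4) by (simp add: algebra_simps)
      qed
      ultimately have "hderiv f E x < D0 + \<theta> / 2" by (rule \<delta>(2))
      moreover have "99 / 100 * \<theta> \<le> D'" using D' D(2) by linarith
      ultimately show False using \<theta> unfolding E_hderiv D'_def by linarith
    qed
  qed
qed

theorem theorem5p6:
  fixes N :: "'n::finite heis set"
    and f :: "'n heis \<Rightarrow> real"
    and x\<^sub>0 :: "'n heis"
    and E\<^sub>0 :: "'n heis \<Rightarrow> 'n heis"
    and l :: real
  assumes "gdelta N" and "N \<in> null_sets lebesgue" and "contains_rational_horizontal_lines N"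
    and "hLipschitz f" and "Lip_H f \<le> 1/2"
    and "(x\<^sub>0, E\<^sub>0) \<in> D_set N f"
    and "((\<lambda>\<delta>. Sup {hderiv f E x | x E. (x, E) \<in> M_set N f x\<^sub>0 E\<^sub>0 \<and> cc_dist x x\<^sub>0 \<le> \<delta>})
           \<longlongrightarrow> l) (at_right 0)"
    and "l \<le> hderiv f E\<^sub>0 x\<^sub>0"
  shows "has_pansu_derivative f (\<lambda>x. hderiv f E\<^sub>0 x\<^sub>0 * (x \<bullet> E\<^sub>0 0)) x\<^sub>0 \<and>
         (\<forall>x. hderiv f E\<^sub>0 x\<^sub>0 * (x \<bullet> E\<^sub>0 0) =
              hderiv f E\<^sub>0 x\<^sub>0 * (hproj x \<bullet> hproj_field E\<^sub>0))"
proof -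
  note N = assms(3) and f = assms(4)
  define S where "S = (\<lambda>\<delta>. {hderiv f E x | x E. (x, E) \<in> M_set N f x\<^sub>0 E\<^sub>0 \<and> cc_dist x x\<^sub>0 \<le> \<delta>})"
  have field: "\<exists>h. E = hfield h \<and> norm h = 1" and diff: "\<exists>D. has_hderiv f E x D" if "(x, E) \<in> D_set N f" for x E
  proof -
    have E: "E \<in> range hfield" "omega E = 1" and "\<exists>D. has_hderiv f E x D"
      using that unfolding D_set_def horizontal_fields_def by auto
    then show "\<exists>D. has_hderiv f E x D" by blast
    show "\<exists>h. E = hfield h \<and> norm h = 1" using E omega_hfield by (metis rangeE)
  qed
  obtain h0 where E\<^sub>0: "E\<^sub>0 = hfield h0" and h0: "norm h0 = 1" using field[OF assms(6)] by blast
  define D0 where "D0 = hderiv f E\<^sub>0 x\<^sub>0"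
  have D0: "has_hderiv f (hfield h0) x\<^sub>0 D0"
    using diff[OF assms(6)] hderiv_eqI[OF f] unfolding D0_def E\<^sub>0 by metis
  have bdd: "bdd_above (S \<delta>)" for \<delta>
  proof (rule bdd_aboveI[of _ "Lip_H f"])
    fix d assume "d \<in> S \<delta>"
    then obtain x E where d: "d = hderiv f E x" "(x, E) \<in> M_set N f x\<^sub>0 E\<^sub>0" by (auto simp: S_def)
    then have "(x, E) \<in> D_set N f" by (simp add: M_set_def)
    then obtain h D where h: "E = hfield h" "norm h = 1" "has_hderiv f E x D" using field diff by blast
    then have "d = D" using d hderiv_eqI[OF f] by blast
    then show "d \<le> Lip_H f" using has_hderiv_le_Lip[OF f, of h x D] h by simp
  qed
  have max: "\<exists>\<delta>>0. \<forall>x E. (x, E) \<in> M_set N f x\<^sub>0 (hfield h0) \<longrightarrow> cc_dist x x\<^sub>0 \<le> \<delta> \<longrightarrow> hderiv f E x < D0 + \<kappa>"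
    if \<kappa>: "0 < \<kappa>" for \<kappa>
  proof -
    have "\<forall>\<^sub>F \<delta> in at_right 0. Sup (S \<delta>) < D0 + \<kappa>"
      using assms(7,8) \<kappa> unfolding S_def D0_def by (intro order_tendstoD(2)) auto
    then obtain b where b: "0 < b" "\<And>\<delta>. 0 < \<delta> \<Longrightarrow> \<delta> < b \<Longrightarrow> Sup (S \<delta>) < D0 + \<kappa>"
      unfolding eventually_at_right_field by auto
    have "hderiv f E x < D0 + \<kappa>" if "(x, E) \<in> M_set N f x\<^sub>0 (hfield h0)" "cc_dist x x\<^sub>0 \<le> b / 2" for x E
    proof -
      have "hderiv f E x \<in> S (b / 2)" using that unfolding S_def E\<^sub>0 by blast
      then have "hderiv f E x \<le> Sup (S (b / 2))" by (rule cSup_upper[OF _ bdd])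
      then show ?thesis using b(1) b(2)[of "b / 2"] by simp
    qed
    then show ?thesis using b(1) by (intro exI[of _ "b / 2"]) auto
  qed
  have inner: "x \<bullet> E\<^sub>0 0 = hproj x \<bullet> h0" for x
    by (simp add: E\<^sub>0 hfield_eq hproj_eq inner_prod_def sympl_simps zero_prod_def[symmetric])
  have proj: "hproj_field E\<^sub>0 = h0" by (simp add: hproj_field_def E\<^sub>0)
  have linear: "H_linear (\<lambda>x. D0 * (hproj x \<bullet> h0))"
    unfolding H_linear_def
  proof (intro conjI allI impI)
    show "D0 * (hproj (hmult x y) \<bullet> h0) = D0 * (hproj x \<bullet> h0) + D0 * (hproj y \<bullet> h0)" for x y
      by (cases x; cases y) (simp add: inner_add_left distrib_left flip: add_Pair)
    show "D0 * (hproj (hdil r x) \<bullet> h0) = r * (D0 * (hproj x \<bullet> h0))" for r x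
      by (cases x) (simp flip: scaleR_Pair)
  qed
  obtain C where C: "1 \<le> C" "\<And>x y. cc_dist (x :: 'n heis) y \<le> norm (hproj y - hproj x) + C * sqrt \<bar>vdisp x y\<bar>"
    using cc_dist_upper by blast
  have cc_lim: "((\<lambda>y. cc_dist x\<^sub>0 y) \<longlongrightarrow> 0) (at x\<^sub>0)"
  proof (rule tendsto_sandwich[OF _ _ tendsto_const])
    have "((\<lambda>y. norm (hproj y - hproj x\<^sub>0) + C * sqrt \<bar>vdisp x\<^sub>0 y\<bar>) \<longlongrightarrow>
        norm (hproj x\<^sub>0 - hproj x\<^sub>0) + C * sqrt \<bar>vdisp x\<^sub>0 x\<^sub>0\<bar>) (at x\<^sub>0)"
      by (intro tendsto_intros tendsto_hproj tendsto_vdisp)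
    then show "((\<lambda>y. norm (hproj y - hproj x\<^sub>0) + C * sqrt \<bar>vdisp x\<^sub>0 y\<bar>) \<longlongrightarrow> 0) (at x\<^sub>0)" by simp
  qed (auto intro!: always_eventually cc_dist_nonneg C(2) simp del: split_paired_All)
  have cc_pos: "0 < cc_dist x\<^sub>0 y" if "y \<noteq> x\<^sub>0" for y
  proof (rule ccontr)
    assume "\<not> 0 < cc_dist x\<^sub>0 y"
    then have zero: "cc_dist x\<^sub>0 y = 0" using cc_dist_nonneg[of x\<^sub>0 y] by linarith
    have p: "hproj y = hproj x\<^sub>0" using hproj_le_cc_dist[of y x\<^sub>0] zero by simp
    then have "snd (snd y) = snd (snd x\<^sub>0)" using vdisp_le_cc_dist[of x\<^sub>0 y] zero by (simp add: vdisp_def)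
    then show False using heis_eqI[OF p] that by blast
  qed
  have limit: "((\<lambda>y. \<bar>f y - f x\<^sub>0 - D0 * (hproj (hmult (hinv x\<^sub>0) y) \<bullet> h0)\<bar> / cc_dist x\<^sub>0 y) \<longlongrightarrow> 0) (at x\<^sub>0)"
  proof (rule tendstoI)
    fix e :: real assume e: "0 < e"
    define \<epsilon> where "\<epsilon> = min (e / 2) 1"
    have \<epsilon>: "0 < \<epsilon>" "\<epsilon> \<le> 1" "\<epsilon> < e" using e by (auto simp: \<epsilon>_def)
    obtain r0 where r0: "0 < r0" "\<And>r y. 0 < r \<Longrightarrow> r < r0 \<Longrightarrow> norm (hproj y - hproj x\<^sub>0) \<le> r \<Longrightarrow> \<bar>vdisp x\<^sub>0 y\<bar> \<le> r\<^sup>2 \<Longrightarrow>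
        \<bar>f y - f x\<^sub>0 - D0 * ((hproj y - hproj x\<^sub>0) \<bullet> h0)\<bar> \<le> \<epsilon> * Lip_H f * r"
      using almost_maximal_first_order[OF N f assms(5) h0 D0 max \<epsilon>(1,2)] by blast
    have "\<forall>\<^sub>F y in at x\<^sub>0. cc_dist x\<^sub>0 y < r0 / 2"
      by (rule order_tendstoD(2)[OF cc_lim]) (use r0(1) in simp)
    moreover have "\<forall>\<^sub>F y in at x\<^sub>0. y \<noteq> x\<^sub>0" by (simp add: eventually_at_filter)
    ultimately show "\<forall>\<^sub>F y in at x\<^sub>0. dist (\<bar>f y - f x\<^sub>0 - D0 * (hproj (hmult (hinv x\<^sub>0) y) \<bullet> h0)\<bar> / cc_dist x\<^sub>0 y) 0 < e"
    proof eventually_elim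
      case (elim y)
      define c where "c = cc_dist x\<^sub>0 y"
      have c: "0 < c" "2 * c < r0" using elim cc_pos by (auto simp: c_def)
      have "\<bar>f y - f x\<^sub>0 - D0 * ((hproj y - hproj x\<^sub>0) \<bullet> h0)\<bar> \<le> \<epsilon> * Lip_H f * (2 * c)"
      proof (rule r0(2)[OF _ c(2)])
        show "norm (hproj y - hproj x\<^sub>0) \<le> 2 * c" using hproj_le_cc_dist[of y x\<^sub>0] c(1) by (simp add: c_def)
        show "\<bar>vdisp x\<^sub>0 y\<bar> \<le> (2 * c)\<^sup>2" using vdisp_le_cc_dist[of x\<^sub>0 y] by (simp add: c_def power_mult_distrib)
      qed (use c in simp)
      also have "\<dots> = \<epsilon> * c * (2 * Lip_H f)" by simp
      also have "\<dots> \<le> \<epsilon> * c * 1" using assms(5) \<epsilon> c by (intro mult_left_mono) auto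
      also have "\<dots> < e * c" using \<epsilon> c by simp
      finally show ?case using c(1) by (simp add: hproj_displacement c_def divide_less_eq)
    qed
  qed
  show ?thesis
    unfolding has_pansu_derivative_def inner proj D0_def[symmetric] using linear limit by simp
qed

end
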